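(* Let $U$ be an open subset of a Riemannian manifold $M$ and let $k$ be an integer with $0\le k\le \dim M$. The Mackey topology $\tau(\mathcal P_k(U),\mathcal B_k(U))$ on $\mathcal P_k(U)$ is the subspace topology on $\mathcal P_k(U)$ considered as a subspace of $(\mathcal B_k'(U),\beta(\mathcal B_k'(U),\mathcal B_k(U)))$, via the map sending a pointed chain $A$ to the functional $\omega\mapsto\int_A\omega$.
   Context: Pointed chains: $\mathcal P_k=\mathcal P_k(U)$ is the real vector space of finitely supported sections of $\Lambda_k(TU)$ (the $k$-th exterior power of the tangent bundle of $U$), i.e. finite formal sums $A=\sum_{i=1}^s (p_i;\alpha_i)$ with $p_i\in U$, $\alpha_i\in\Lambda_k(T_{p_i}U)$, with $(p;\cdot)$ linear. For a $k$-form $\omega$ on $U$ put $\int_A\omega:=\sum_{i=1}^s\omega(p_i;\alpha_i)$, where $\omega(p;\alpha)$ is the value of $\omega$ at $p$ on the $k$-vector $\alpha$. Forms: $\mathcal B_k^r=\mathcal B_k^r(U)$ ($r\ge 0$) is the space of $C^r$ $k$-forms on $U$ whose derivatives of order $\le r$ are bounded on $U$, with norm $\|\omega\|_{C^r}$ the supremum over $U$ of the pointwise norms of these derivatives (for $U\subset\mathbb R^n$: Lie derivatives $L_{v_1}\cdots L_{v_j}\omega$, $0\le j\le r$, along constant unit vector fields; in general, iterated covariant derivatives with respect to the Riemannian metric). $\mathcal B_k=\mathcal B_k(U)=\varprojlim_r\mathcal B_k^r$ is the Fréchet space of smooth $k$-forms with all derivatives bounded, topologized by the norms $\|\cdot\|_{C^r}$,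 $r\ge0$; $\mathcal B_k'$ is its continuous dual, and $\beta(\mathcal B_k',\mathcal B_k)$ is the strong topology (uniform convergence on bounded subsets of $\mathcal B_k$). $(\mathcal P_k,\mathcal B_k)$ is a dual pair under $(A,\omega)\mapsto\int_A\omega$; the Mackey topology $\tau(\mathcal P_k,\mathcal B_k)$ is the finest locally convex topology on $\mathcal P_k$ whose continuous dual is $\mathcal B_k$. *)

theory Defs
  imports "HOL-Analysis.Analysis" "HOL-Library.Function_Algebras"
begin

text \<open>
  The distribution has neither manifolds, tensor fields nor dual pairs, so they are set up here.
  Tensors are handled in the classical way, as families of components, one for each chart,
  that satisfy the tensor transformation law. The dimension is a natural number (possibly \<open>0\<close>)
  and the model space is \<^term>\<open>Euclidean_space n\<close>, whose points have coordinates
  \<open>0, \<dots>, n - 1\<close>.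
\<close>

section \<open>Locally convex topologies, dual pairs\<close>

instantiation "fun" :: (type, real_vector) real_vector
begin

definition scaleR_fun :: "real \<Rightarrow> ('a \<Rightarrow> 'b) \<Rightarrow> 'a \<Rightarrow> 'b"
  where "scaleR_fun a f = (\<lambda>x. a *\<^sub>R f x)"

instance
  by standard (simp_all add: scaleR_fun_def fun_eq_iff algebra_simps)

end

definition locally_convex_topology_on :: "'v::real_vector set \<Rightarrow> 'v topology \<Rightarrow> bool"
  where "locally_convex_topology_on S T \<longleftrightarrow>
    subspace S \<and> topspace T = S \<and>
    continuous_map (prod_topology T T) T (\<lambda>(x, y). x + y) \<and>
    continuous_map (prod_topology euclideanreal T) T (\<lambda>(a, x). a *\<^sub>R x) \<and>
    (\<forall>V. openin T V \<and> 0 \<in> V \<longrightarrow>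
      (\<exists>W C. openin T W \<and> 0 \<in> W \<and> W \<subseteq> C \<and> C \<subseteq> V \<and> convex C))"

definition linear_functional_on :: "'v::real_vector set \<Rightarrow> ('v \<Rightarrow> real) \<Rightarrow> bool"
  where "linear_functional_on S f \<longleftrightarrow>
    (\<forall>x\<in>S. \<forall>y\<in>S. f (x + y) = f x + f y) \<and> (\<forall>a. \<forall>x\<in>S. f (a *\<^sub>R x) = a * f x)"

text \<open>Functionals on a subspace are made unique, as functions on the whole type, by the
  value \<open>0\<close> outside of it.\<close>

definition continuous_dual :: "'v::real_vector topology \<Rightarrow> ('v \<Rightarrow> real) set"
  where "continuous_dual T =
    {f. linear_functional_on (topspace T) f \<and> continuous_map T euclideanreal f \<and>
        (\<forall>x. x \<notin> topspace T \<longrightarrow> f x = 0)}"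

definition functional_on :: "'v set \<Rightarrow> ('v \<Rightarrow> real) \<Rightarrow> 'v \<Rightarrow> real"
  where "functional_on S f = (\<lambda>x. if x \<in> S then f x else 0)"

definition compatible_topology ::
    "'v::real_vector set \<Rightarrow> 'w set \<Rightarrow> ('v \<Rightarrow> 'w \<Rightarrow> real) \<Rightarrow> 'v topology \<Rightarrow> bool"
  where "compatible_topology E F b T \<longleftrightarrow>
    locally_convex_topology_on E T \<and>
    continuous_dual T = (\<lambda>y. functional_on E (\<lambda>x. b x y)) ` F"

text \<open>\<open>is_mackey_topology E F b T\<close>: \<open>T\<close> is the Mackey topology \<open>\<tau>(E, F)\<close> of the pairing
  \<open>b\<close>, i.e. the finest locally convex topology on \<open>E\<close> whose continuous dual is \<open>F\<close>.\<close>

definition is_mackey_topology ::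
    "'v::real_vector set \<Rightarrow> 'w set \<Rightarrow> ('v \<Rightarrow> 'w \<Rightarrow> real) \<Rightarrow> 'v topology \<Rightarrow> bool"
  where "is_mackey_topology E F b T \<longleftrightarrow>
    compatible_topology E F b T \<and>
    (\<forall>T'. compatible_topology E F b T' \<longrightarrow> (\<forall>V. openin T' V \<longrightarrow> openin T V))"

definition seminorm_topology :: "'v::real_vector set \<Rightarrow> ('v \<Rightarrow> real) set \<Rightarrow> 'v topology"
  where "seminorm_topology S Q =
    topology_generated_by {{y \<in> S. q (y - x) < e} | q x e. q \<in> Q \<and> x \<in> S \<and> 0 < e}"

definition bounded_in :: "'v::real_vector topology \<Rightarrow> 'v set \<Rightarrow> bool"
  where "bounded_in T D \<longleftrightarrow> D \<subseteq> topspace T \<and>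
    (\<forall>V. openin T V \<and> 0 \<in> V \<longrightarrow> (\<exists>s>0. \<forall>t\<ge>s. D \<subseteq> (\<lambda>x. t *\<^sub>R x) ` V))"

text \<open>Inserting \<open>0\<close> only matters when \<open>D\<close> is empty, as \<^const>\<open>Sup\<close> of the empty set of
  reals is unspecified.\<close>

definition strong_dual_topology :: "'v::real_vector topology \<Rightarrow> ('v \<Rightarrow> real) topology"
  where "strong_dual_topology T =
    seminorm_topology (continuous_dual T)
      {(\<lambda>f. Sup (insert 0 ((\<lambda>x. \<bar>f x\<bar>) ` D))) | D. bounded_in T D}"

section \<open>Riemannian manifolds\<close>

type_synonym 'm chart = "'m set \<times> ('m \<Rightarrow> nat \<Rightarrow> real)"

abbreviation dom_of :: "'m chart \<Rightarrow> 'm set"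
  where "dom_of c \<equiv> fst c"

abbreviation coord :: "'m chart \<Rightarrow> 'm \<Rightarrow> nat \<Rightarrow> real"
  where "coord c \<equiv> snd c"

definition chart_inv :: "'m chart \<Rightarrow> (nat \<Rightarrow> real) \<Rightarrow> 'm"
  where "chart_inv c = inv_into (dom_of c) (coord c)"

definition is_chart :: "'m topology \<Rightarrow> nat \<Rightarrow> 'm chart \<Rightarrow> bool"
  where "is_chart X n c \<longleftrightarrow>
    openin X (dom_of c) \<and> openin (Euclidean_space n) (coord c ` dom_of c) \<and>
    homeomorphic_map (subtopology X (dom_of c))
      (subtopology (Euclidean_space n) (coord c ` dom_of c)) (coord c)"

text \<open>\<open>chart_partial c j f p\<close> is \<open>\<partial>f/\<partial>x\<^sup>j\<close> at \<open>p\<close> with respect to the coordinates of \<open>c\<close>.\<close>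

definition chart_partial :: "'m chart \<Rightarrow> nat \<Rightarrow> ('m \<Rightarrow> real) \<Rightarrow> 'm \<Rightarrow> real"
  where "chart_partial c j f p =
    deriv (\<lambda>t. f (chart_inv c ((coord c p)(j := t)))) (coord c p j)"

primrec chart_partials :: "'m chart \<Rightarrow> nat list \<Rightarrow> ('m \<Rightarrow> real) \<Rightarrow> 'm \<Rightarrow> real"
  where
    "chart_partials c [] f = f"
  | "chart_partials c (j # js) f = chart_partial c j (chart_partials c js f)"

text \<open>\<open>f\<close> is of class \<open>C\<^sup>r\<close> on the open set \<open>W \<subseteq> dom_of c\<close>: all iterated partial derivatives
  of order at most \<open>r\<close> exist and are continuous. As \<^const>\<open>deriv\<close> is total, existence is
  required separately.\<close>

definition chart_Cr :: "'m topology \<Rightarrow> nat \<Rightarrow> 'm chart \<Rightarrow> nat \<Rightarrow> 'm set \<Rightarrow> ('m \<Rightarrow> real) \<Rightarrow> bool"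
  where "chart_Cr X n c r W f \<longleftrightarrow>
    (\<forall>js. set js \<subseteq> {..<n} \<and> length js \<le> r \<longrightarrow>
      continuous_map (subtopology X W) euclideanreal (chart_partials c js f)) \<and>
    (\<forall>js. set js \<subseteq> {..<n} \<and> length js < r \<longrightarrow>
      (\<forall>j<n. \<forall>p\<in>W. (\<lambda>t. chart_partials c js f (chart_inv c ((coord c p)(j := t))))
         differentiable at (coord c p j)))"

text \<open>\<open>transition_deriv c d p i j\<close> is \<open>\<partial>y\<^sup>i/\<partial>x\<^sup>j\<close> at \<open>p\<close>, with \<open>x\<close> the coordinates of \<open>c\<close> and \<open>y\<close>
  those of \<open>d\<close>.\<close>

definition transition_deriv :: "'m chart \<Rightarrow> 'm chart \<Rightarrow> 'm \<Rightarrow> nat \<Rightarrow> nat \<Rightarrow> real"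
  where "transition_deriv c d p i j = chart_partial c j (\<lambda>q. coord d q i) p"

text \<open>The field \<open>metric\<close> gives the components \<open>g\<^sub>i\<^sub>j\<close> of the metric in each chart.\<close>

record 'm riemannian =
  mtop :: "'m topology"
  mdim :: nat
  atlas :: "'m chart set"
  metric :: "'m chart \<Rightarrow> 'm \<Rightarrow> nat \<Rightarrow> nat \<Rightarrow> real"

definition smooth_atlas :: "'m topology \<Rightarrow> nat \<Rightarrow> 'm chart set \<Rightarrow> bool"
  where "smooth_atlas X n \<A> \<longleftrightarrow>
    (\<forall>c\<in>\<A>. is_chart X n c) \<and> \<Union> (dom_of ` \<A>) = topspace X \<and>
    (\<forall>c\<in>\<A>. \<forall>d\<in>\<A>. \<forall>i<n. \<forall>r. chart_Cr X n c r (dom_of c \<inter> dom_of d) (\<lambda>q. coord d q i))"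

definition riemannian_metric ::
    "'m topology \<Rightarrow> nat \<Rightarrow> 'm chart set \<Rightarrow> ('m chart \<Rightarrow> 'm \<Rightarrow> nat \<Rightarrow> nat \<Rightarrow> real) \<Rightarrow> bool"
  where "riemannian_metric X n \<A> g \<longleftrightarrow>
    (\<forall>c\<in>\<A>. \<forall>i<n. \<forall>j<n. \<forall>r. chart_Cr X n c r (dom_of c) (\<lambda>p. g c p i j)) \<and>
    (\<forall>c\<in>\<A>. \<forall>p\<in>dom_of c. \<forall>i<n. \<forall>j<n. g c p i j = g c p j i) \<and>
    (\<forall>c\<in>\<A>. \<forall>p\<in>dom_of c. \<forall>v. (\<exists>i<n. v i \<noteq> 0) \<longrightarrow>
      0 < (\<Sum>i<n. \<Sum>j<n. g c p i j * v i * v j)) \<and>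
    (\<forall>c\<in>\<A>. \<forall>d\<in>\<A>. \<forall>p\<in>dom_of c \<inter> dom_of d. \<forall>i<n. \<forall>j<n.
      g c p i j = (\<Sum>a<n. \<Sum>b<n. g d p a b * transition_deriv c d p a i * transition_deriv c d p b j))"

definition riemannian_manifold :: "'m riemannian \<Rightarrow> bool"
  where "riemannian_manifold M \<longleftrightarrow>
    Hausdorff_space (mtop M) \<and> second_countable (mtop M) \<and>
    smooth_atlas (mtop M) (mdim M) (atlas M) \<and>
    riemannian_metric (mtop M) (mdim M) (atlas M) (metric M)"

definition inverse_metric :: "'m riemannian \<Rightarrow> 'm chart \<Rightarrow> 'm \<Rightarrow> nat \<Rightarrow> nat \<Rightarrow> real"
  where "inverse_metric M c p = (THE h.
    (\<forall>i j. mdim M \<le> i \<or> mdim M \<le> j \<longrightarrow> h i j = 0) \<and>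
    (\<forall>i<mdim M. \<forall>k<mdim M.
      (\<Sum>j<mdim M. h i j * metric M c p j k) = (if i = k then 1 else 0)))"

text \<open>\<open>christoffel M c p l i j\<close> is the symbol \<open>\<Gamma>\<^sup>l\<^sub>i\<^sub>j\<close> of the Levi-Civita connection.\<close>

definition christoffel :: "'m riemannian \<Rightarrow> 'm chart \<Rightarrow> 'm \<Rightarrow> nat \<Rightarrow> nat \<Rightarrow> nat \<Rightarrow> real"
  where "christoffel M c p l i j = (1/2) * (\<Sum>m<mdim M. inverse_metric M c p l m *
    (chart_partial c i (\<lambda>q. metric M c q j m) p
     + chart_partial c j (\<lambda>q. metric M c q i m) p
     - chart_partial c m (\<lambda>q. metric M c q i j) p))"

section \<open>Forms and pointed chains\<close>

text \<open>\<open>T c p I\<close> is the component of the tensor field \<open>T\<close> in the chart \<open>c\<close> at the point \<open>p\<close>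
  with multi-index \<open>I\<close>. Whether the indices are covariant or contravariant is decided by the
  transformation law imposed on \<open>T\<close>. Components with a meaningless argument are \<open>0\<close>, so that
  equality and the vector space operations of functions are those of tensor fields.\<close>

type_synonym 'm tensor_field = "'m chart \<Rightarrow> 'm \<Rightarrow> nat list \<Rightarrow> real"

definition multi_indices :: "nat \<Rightarrow> nat \<Rightarrow> nat list set"
  where "multi_indices n k = {I. set I \<subseteq> {..<n} \<and> length I = k}"

definition components_on :: "'m riemannian \<Rightarrow> 'm set \<Rightarrow> nat \<Rightarrow> 'm tensor_field \<Rightarrow> bool"
  where "components_on M U k T \<longleftrightarrow>
    (\<forall>c p I. \<not> (c \<in> atlas M \<and> p \<in> dom_of c \<inter> U \<and> I \<in> multi_indices (mdim M) k) \<longrightarrow>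
      T c p I = 0)"

definition alternating :: "nat \<Rightarrow> 'm tensor_field \<Rightarrow> bool"
  where "alternating k T \<longleftrightarrow>
    (\<forall>c p I i j. length I = k \<and> i < j \<and> j < k \<longrightarrow>
      T c p (I[i := I ! j, j := I ! i]) = - T c p I)"

definition covariant :: "'m riemannian \<Rightarrow> 'm set \<Rightarrow> nat \<Rightarrow> 'm tensor_field \<Rightarrow> bool"
  where "covariant M U k T \<longleftrightarrow>
    (\<forall>c\<in>atlas M. \<forall>d\<in>atlas M. \<forall>p\<in>dom_of c \<inter> dom_of d \<inter> U. \<forall>I\<in>multi_indices (mdim M) k.
      T c p I =
        (\<Sum>K\<in>multi_indices (mdim M) k. T d p K * (\<Prod>a<k. transition_deriv c d p (K ! a) (I ! a))))"

definition contravariant :: "'m riemannian \<Rightarrow> 'm set \<Rightarrow> nat \<Rightarrow> 'm tensor_field \<Rightarrow> bool"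
  where "contravariant M U k T \<longleftrightarrow>
    (\<forall>c\<in>atlas M. \<forall>d\<in>atlas M. \<forall>p\<in>dom_of c \<inter> dom_of d \<inter> U. \<forall>K\<in>multi_indices (mdim M) k.
      T d p K =
        (\<Sum>I\<in>multi_indices (mdim M) k. T c p I * (\<Prod>a<k. transition_deriv c d p (K ! a) (I ! a))))"

definition Cr_forms :: "'m riemannian \<Rightarrow> 'm set \<Rightarrow> nat \<Rightarrow> nat \<Rightarrow> 'm tensor_field set"
  where "Cr_forms M U k r =
    {\<omega>. components_on M U k \<omega> \<and> alternating k \<omega> \<and> covariant M U k \<omega> \<and>
        (\<forall>c\<in>atlas M. \<forall>I\<in>multi_indices (mdim M) k.
          chart_Cr (mtop M) (mdim M) c r (dom_of c \<inter> U) (\<lambda>p. \<omega> c p I))}"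

text \<open>The Levi-Civita covariant derivative of a covariant tensor field. The new slot comes
  first: \<open>\<nabla>\<^sub>jT\<^sub>I = \<partial>\<^sub>jT\<^sub>I - (\<Sum>a l. \<Gamma>\<^sup>l\<^sub>j\<^sub>i T\<^sub>I\<^sub>'\<close>), where \<open>i\<close> is the \<open>a\<close>-th entry of \<open>I\<close> and
  \<open>I'\<close> is \<open>I\<close> with that entry replaced by \<open>l\<close>.\<close>

definition cov_deriv :: "'m riemannian \<Rightarrow> 'm tensor_field \<Rightarrow> 'm tensor_field"
  where "cov_deriv M T = (\<lambda>c p J. case J of [] \<Rightarrow> 0 | j # I \<Rightarrow>
    chart_partial c j (\<lambda>q. T c q I) p
    - (\<Sum>a<length I. \<Sum>l<mdim M. christoffel M c p l j (I ! a) * T c p (I[a := l])))"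

text \<open>The norm of a covariant \<open>m\<close>-tensor at \<open>p\<close> as a multilinear map,
  \<open>sup |T(v\<^sub>0, \<dots>, v\<^sub>m\<^sub>-\<^sub>1)|\<close> over tangent vectors of length at most \<open>1\<close>. On alternating tensors it
  is the comass; on \<open>\<nabla>\<^sup>j\<omega>\<close> it is the supremum of the comass of the derivatives of \<open>\<omega>\<close> in unit
  directions.\<close>

definition pointwise_norm :: "'m riemannian \<Rightarrow> nat \<Rightarrow> 'm tensor_field \<Rightarrow> 'm chart \<Rightarrow> 'm \<Rightarrow> real"
  where "pointwise_norm M m T c p =
    Sup {\<bar>\<Sum>I\<in>multi_indices (mdim M) m. T c p I * (\<Prod>a<m. v a (I ! a))\<bar> | v.
      \<forall>a<m. (\<Sum>i<mdim M. \<Sum>j<mdim M. metric M c p i j * v a i * v a j) \<le> 1}"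

text \<open>The set of all pointwise norms of \<open>\<nabla>\<^sup>j\<omega>\<close>, \<open>j \<le> r\<close>, on \<open>U\<close>; these do not depend on the
  chart.\<close>

definition deriv_norms :: "'m riemannian \<Rightarrow> 'm set \<Rightarrow> nat \<Rightarrow> nat \<Rightarrow> 'm tensor_field \<Rightarrow> real set"
  where "deriv_norms M U k r \<omega> =
    {pointwise_norm M (j + k) ((cov_deriv M ^^ j) \<omega>) c p | j c p.
      j \<le> r \<and> c \<in> atlas M \<and> p \<in> dom_of c \<inter> U}"

definition bounded_Cr_forms :: "'m riemannian \<Rightarrow> 'm set \<Rightarrow> nat \<Rightarrow> nat \<Rightarrow> 'm tensor_field set"
  where "bounded_Cr_forms M U k r = {\<omega> \<in> Cr_forms M U k r. bdd_above (deriv_norms M U k r \<omega>)}"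

text \<open>As before, inserting \<open>0\<close> only matters when \<open>U\<close> is empty.\<close>

definition Cr_norm :: "'m riemannian \<Rightarrow> 'm set \<Rightarrow> nat \<Rightarrow> nat \<Rightarrow> 'm tensor_field \<Rightarrow> real"
  where "Cr_norm M U k r \<omega> = Sup (insert 0 (deriv_norms M U k r \<omega>))"

definition bounded_forms :: "'m riemannian \<Rightarrow> 'm set \<Rightarrow> nat \<Rightarrow> 'm tensor_field set"
  where "bounded_forms M U k = (\<Inter>r. bounded_Cr_forms M U k r)"

definition bounded_forms_topology :: "'m riemannian \<Rightarrow> 'm set \<Rightarrow> nat \<Rightarrow> 'm tensor_field topology"
  where "bounded_forms_topology M U k =
    seminorm_topology (bounded_forms M U k) (range (Cr_norm M U k))"

text \<open>A \<open>k\<close>-vector is given by its components as an alternating contravariant tensor, i.e. by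
  its coefficients with respect to the \<open>e\<^sub>i\<^sub>1 \<and> \<dots> \<and> e\<^sub>i\<^sub>k\<close> for increasing multi-indices,
  extended to all multi-indices by antisymmetry.\<close>

definition chain_support :: "'m tensor_field \<Rightarrow> 'm set"
  where "chain_support A = {p. \<exists>c I. A c p I \<noteq> 0}"

definition pointed_chains :: "'m riemannian \<Rightarrow> 'm set \<Rightarrow> nat \<Rightarrow> 'm tensor_field set"
  where "pointed_chains M U k =
    {A. components_on M U k A \<and> alternating k A \<and> contravariant M U k A \<and>
        finite (chain_support A)}"

text \<open>The value \<open>\<omega>(p; A(p))\<close>; by the transformation laws any chart around \<open>p\<close> gives the same
  number.\<close>

definition eval_at :: "'m riemannian \<Rightarrow> nat \<Rightarrow> 'm tensor_field \<Rightarrow> 'm tensor_field \<Rightarrow> 'm \<Rightarrow> real"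
  where "eval_at M k A \<omega> p =
    (let c = (SOME c. c \<in> atlas M \<and> p \<in> dom_of c)
     in \<Sum>I | I \<in> multi_indices (mdim M) k \<and> sorted_wrt (<) I. \<omega> c p I * A c p I)"

definition chain_integral :: "'m riemannian \<Rightarrow> nat \<Rightarrow> 'm tensor_field \<Rightarrow> 'm tensor_field \<Rightarrow> real"
  where "chain_integral M k A \<omega> = (\<Sum>p\<in>chain_support A. eval_at M k A \<omega> p)"

definition chain_to_dual ::
    "'m riemannian \<Rightarrow> 'm set \<Rightarrow> nat \<Rightarrow> 'm tensor_field \<Rightarrow> 'm tensor_field \<Rightarrow> real"
  where "chain_to_dual M U k A = functional_on (bounded_forms M U k) (\<lambda>\<omega>. chain_integral M k A \<omega>)"

end

theory Submission
  imports Defs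
begin

text \<open>
  Let \<open>T\<close> be the topology induced by the strong dual. Its seminorms are
  \<open>A \<mapsto> sup {\<bar>\<integral>\<^sub>A \<omega>\<bar> | \<omega> \<in> D}\<close> for \<open>D\<close> bounded in \<open>\<B>\<^sub>k\<close>.

  A \<open>T\<close>-continuous functional is bounded by such a seminorm, so by Hahn--Banach it extends to a
  functional \<open>\<Phi>\<close> on the bounded functions on \<open>D\<close>, and it is integration of the form whose
  components are \<open>\<omega>\<^sub>I(p) = \<Phi>(\<omega>' \<mapsto> \<omega>'\<^sub>I(p))\<close>. This form is smooth with bounded derivatives: by the
  bounds on second derivatives, difference quotients converge uniformly on \<open>D\<close>, so \<open>\<Phi>\<close> commutes with
  covariant derivatives.

  Conversely let \<open>K\<close> be the polar of a neighbourhood of \<open>0\<close> in a topology with dual \<open>\<B>\<^sub>k\<close>. Functionals bounded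
  on the neighbourhood are forms, so \<open>K\<close> contains the sums of suitable series, which is all that the
  Banach--Steinhaus theorem needs. Covariant derivatives at a point are iterated limits of
  evaluations on chains, hence bounded on \<open>K\<close>, and uniformly so over all points. Thus \<open>K\<close> is bounded
  and its polar is a \<open>T\<close>-neighbourhood.
\<close>

section \<open>Sublinear functionals and the Hahn--Banach theorem\<close>

definition sublinear_on :: "'v::real_vector set \<Rightarrow> ('v \<Rightarrow> real) \<Rightarrow> bool"
  where "sublinear_on S p \<longleftrightarrow> p 0 = 0 \<and> (\<forall>x\<in>S. \<forall>y\<in>S. p (x + y) \<le> p x + p y) \<and>
    (\<forall>t>0. \<forall>x\<in>S. p (t *\<^sub>R x) = t * p x)"

lemma sublinear_onI:
  assumes S: "subspace S" and z: "p 0 = 0"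
    and add: "\<And>x y. x \<in> S \<Longrightarrow> y \<in> S \<Longrightarrow> p (x + y) \<le> p x + p y"
    and scale: "\<And>t x. 0 < t \<Longrightarrow> x \<in> S \<Longrightarrow> p (t *\<^sub>R x) \<le> t * p x"
  shows "sublinear_on S p"
proof -
  have "p (t *\<^sub>R x) = t * p x" if "t > 0" "x \<in> S" for t x
  proof (rule antisym)
    have "p (inverse t *\<^sub>R (t *\<^sub>R x)) \<le> inverse t * p (t *\<^sub>R x)"
      using that S by (intro scale) (auto simp: subspace_scale)
    then have "p x \<le> inverse t * p (t *\<^sub>R x)"
      using that by simp
    then show "t * p x \<le> p (t *\<^sub>R x)"
      using that by (simp add: field_simps)
  qed (use scale that in auto)
  then show ?thesis
    using z add by (auto simp: sublinear_on_def)
qed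

lemma sublinear_on_add:
  "sublinear_on S p \<Longrightarrow> x \<in> S \<Longrightarrow> y \<in> S \<Longrightarrow> p (x + y) \<le> p x + p y"
  by (auto simp: sublinear_on_def)

lemma sublinear_on_scale:
  "sublinear_on S p \<Longrightarrow> x \<in> S \<Longrightarrow> t \<ge> 0 \<Longrightarrow> p (t *\<^sub>R x) = t * p x"
  by (cases "t = 0") (auto simp: sublinear_on_def)

lemma sublinear_on_lower:
  assumes "subspace S" "sublinear_on S p" "x \<in> S"
  shows "- p (- x) \<le> p x"
  using sublinear_on_add[of S p x "- x"] assms by (auto simp: sublinear_on_def subspace_neg)

lemma linear_functional_onD:
  assumes "linear_functional_on S f"
  shows "x \<in> S \<Longrightarrow> y \<in> S \<Longrightarrow> f (x + y) = f x + f y" "x \<in> S \<Longrightarrow> f (a *\<^sub>R x) = a * f x"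
  using assms by (auto simp: linear_functional_on_def)

lemma linear_functional_on_0: "subspace S \<Longrightarrow> linear_functional_on S f \<Longrightarrow> f 0 = 0"
  using linear_functional_onD(2)[of S f 0 0] by (simp add: subspace_0)

lemma linear_functional_on_minus:
  "linear_functional_on S f \<Longrightarrow> x \<in> S \<Longrightarrow> f (- x) = - f x"
  using linear_functional_onD(2)[of S f x "-1"] by simp

lemma linear_functional_on_diff:
  "subspace S \<Longrightarrow> linear_functional_on S f \<Longrightarrow> x \<in> S \<Longrightarrow> y \<in> S \<Longrightarrow> f (x - y) = f x - f y"
  using linear_functional_onD(1)[of S f x "- y"]
  by (simp add: linear_functional_on_minus subspace_neg)

lemma linear_functional_on_sum:
  assumes "subspace S" "linear_functional_on S f" "\<And>i. i \<in> A \<Longrightarrow> g i \<in> S"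
  shows "f (sum g A) = (\<Sum>i\<in>A. f (g i))"
  using assms(3)
  by (induction A rule: infinite_finite_induct)
    (auto simp: linear_functional_on_0[OF assms(1,2)] linear_functional_onD[OF assms(2)]
      subspace_sum[OF assms(1)])

text \<open>Chains of sublinear functionals have infima, so there is a minimal one below \<open>p\<close>. Minimality,
  applied to \<open>x \<mapsto> inf\<^sub>t (q (x + t a) - t q a)\<close>, makes it superadditive.\<close>

lemma minimal_sublinear:
  assumes S: "subspace S" and p: "sublinear_on S p"
  shows "\<exists>q. sublinear_on S q \<and> (\<forall>x\<in>S. q x \<le> p x) \<and>
    (\<forall>q'. sublinear_on S q' \<and> (\<forall>x\<in>S. q' x \<le> q x) \<longrightarrow> (\<forall>x\<in>S. q' x = q x))"
proof -
  define A where "A = {q. sublinear_on S q \<and> (\<forall>x\<in>S. q x \<le> p x) \<and> (\<forall>x. x \<notin> S \<longrightarrow> q x = 0)}"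
  let ?P = "\<lambda>q q'. q' \<le> (q :: 'a \<Rightarrow> real)"
  have "\<exists>m\<in>A. \<forall>a\<in>A. ?P m a \<longrightarrow> a = m"
  proof (rule predicate_Zorn)
    show "partial_order_on A (relation_of ?P A)"
      by (rule partial_order_on_relation_ofI) auto
  next
    fix C assume C: "C \<in> Chains (relation_of ?P A)"
    then have CA: "C \<subseteq> A" by (rule Chains_relation_of)
    have tot: "a \<le> b \<or> b \<le> a" if "a \<in> C" "b \<in> C" for a b
      using C that by (auto simp: Chains_def relation_of_def)
    show "\<exists>u\<in>A. \<forall>a\<in>C. ?P a u"
    proof (cases "C = {}")
      case True
      let ?u = "\<lambda>x. if x \<in> S then p x else 0"
      have "?u \<in> A"
        using p S by (auto simp: A_def sublinear_on_def subspace_add subspace_scale)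
      then show ?thesis using True by blast
    next
      case False
      define u where "u x = (INF c\<in>C. c x)" for x
      have bdd: "bdd_below ((\<lambda>c. c x) ` C)" for x
      proof (cases "x \<in> S")
        case True
        have "- p (- x) \<le> c x" if "c \<in> C" for c
        proof -
          have c: "sublinear_on S c" "c (- x) \<le> p (- x)"
            using that CA True S by (auto simp: A_def subspace_neg)
          show ?thesis using sublinear_on_lower[OF S c(1) True] c(2) by simp
        qed
        then show ?thesis by (intro bdd_belowI2)
      next
        case False
        then have "c x = 0" if "c \<in> C" for c using that CA by (auto simp: A_def)
        then show ?thesis by (metis bdd_belowI2 order_refl)
      qed
      have le: "u x \<le> c x" if "c \<in> C" for c x
        unfolding u_def using that bdd by (rule cINF_lower[rotated])
      have ge: "m \<le> u x" if "\<And>c. c \<in> C \<Longrightarrow> m \<le> c x" for m x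
        unfolding u_def using False that by (rule cINF_greatest)
      have Csub: "sublinear_on S c" if "c \<in> C" for c using that CA by (auto simp: A_def)
      obtain c0 where c0: "c0 \<in> C" using False by blast
      have "sublinear_on S u"
      proof (rule sublinear_onI[OF S])
        have "c 0 = 0" if "c \<in> C" for c using Csub[OF that] by (simp add: sublinear_on_def)
        then show "u 0 = 0" using le[OF c0, of 0] ge[of 0 0] c0 by fastforce
      next
        fix x y assume xy: "x \<in> S" "y \<in> S"
        have "u (x + y) \<le> a x + b y" if "a \<in> C" "b \<in> C" for a b
        proof -
          obtain c where c: "c \<in> C" "c \<le> a" "c \<le> b"
            using tot[of a b] \<open>a \<in> C\<close> \<open>b \<in> C\<close> by (metis order_refl)
          have "u (x + y) \<le> c x + c y"
            using le[OF c(1), of "x + y"] sublinear_on_add[OF Csub[OF c(1)] xy] by simp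
          also have "\<dots> \<le> a x + b y" using c by (intro add_mono) (auto simp: le_fun_def)
          finally show ?thesis .
        qed
        then have "u (x + y) - a x \<le> u y" if "a \<in> C" for a
          using that by (intro ge) (simp add: diff_le_eq add.commute[of _ "a x"])
        then have "u (x + y) - u y \<le> u x"
          by (intro ge) (smt (verit))
        then show "u (x + y) \<le> u x + u y" by simp
      next
        fix t :: real and x assume t: "0 < t" and x: "x \<in> S"
        have "u (t *\<^sub>R x) / t \<le> u x"
        proof (rule ge)
          fix c assume c: "c \<in> C"
          have "u (t *\<^sub>R x) \<le> t * c x"
            using le[OF c, of "t *\<^sub>R x"] sublinear_on_scale[OF Csub[OF c] x, of t] t by simp
          then show "u (t *\<^sub>R x) / t \<le> c x" using t by (simp add: field_simps)
        qed
        then show "u (t *\<^sub>R x) \<le> t * u x" using t by (simp add: field_simps)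
      qed
      moreover have "u x \<le> p x" if "x \<in> S" for x
        using le[OF c0, of x] c0 CA that by (force simp: A_def)
      moreover have "u x = 0" if "x \<notin> S" for x
      proof -
        have "c x = 0" if "c \<in> C" for c using that CA \<open>x \<notin> S\<close> by (auto simp: A_def)
        then show ?thesis using le[OF c0, of x] ge[of 0 x] c0 by (metis order_antisym_conv order_refl)
      qed
      ultimately have "u \<in> A" by (simp add: A_def)
      then show ?thesis using le by (auto simp: le_fun_def)
    qed
  qed
  then obtain q where q: "q \<in> A" and min: "\<And>a. a \<in> A \<Longrightarrow> a \<le> q \<Longrightarrow> a = q" by blast
  show ?thesis
  proof (intro exI[of _ q] conjI allI impI, goal_cases)
    case (3 q')
    then have q': "sublinear_on S q'" "\<forall>x\<in>S. q' x \<le> q x" by auto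
    let ?q = "\<lambda>x. if x \<in> S then q' x else 0"
    have "?q \<in> A"
      using q q' S by (fastforce simp: A_def sublinear_on_def subspace_add subspace_scale)
    moreover have "?q \<le> q" using q q' by (auto simp: A_def le_fun_def)
    ultimately have "?q = q" by (rule min)
    then have "q' x = q x" if "x \<in> S" for x using fun_cong[of ?q q x] that by simp
    then show ?case by blast
  qed (use q in \<open>auto simp: A_def\<close>)
qed

lemma linear_below_sublinear:
  assumes S: "subspace S" and p: "sublinear_on S p"
  shows "\<exists>f. linear_functional_on S f \<and> (\<forall>x\<in>S. f x \<le> p x)"
proof -
  obtain q where q: "sublinear_on S q" "\<And>x. x \<in> S \<Longrightarrow> q x \<le> p x"
    and min: "\<And>q'. sublinear_on S q' \<Longrightarrow> \<forall>x\<in>S. q' x \<le> q x \<Longrightarrow> \<forall>x\<in>S. q' x = q x"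
    using minimal_sublinear[OF S p] by blast
  note q_add = sublinear_on_add[OF q(1)] and q_scale = sublinear_on_scale[OF q(1)]
  have q0: "q 0 = 0" using q(1) by (simp add: sublinear_on_def)
  have add: "q (x + a) = q x + q a" if x: "x \<in> S" and a: "a \<in> S" for x a
  proof (rule antisym)
    define r where "r x = (INF t\<in>{0..}. q (x + t *\<^sub>R a) - t * q a)" for x
    have in_S: "x + t *\<^sub>R a \<in> S" if "x \<in> S" for x t
      using that a S by (simp add: subspace_add subspace_scale)
    have low: "- q (- x) \<le> q (x + t *\<^sub>R a) - t * q a" if "x \<in> S" "t \<ge> 0" for x t
      using q_add[OF in_S[OF that(1), of t], of "- x"] q_scale[OF a that(2)] that S
      by (simp add: subspace_neg)
    have le: "r x \<le> q (x + t *\<^sub>R a) - t * q a" if "x \<in> S" "t \<ge> 0" for x t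
      unfolding r_def using that low by (intro cINF_lower bdd_belowI2) auto
    have ge: "m \<le> r x" if "\<And>t. t \<ge> 0 \<Longrightarrow> m \<le> q (x + t *\<^sub>R a) - t * q a" for m x
      unfolding r_def using that by (intro cINF_greatest) auto
    have "sublinear_on S r"
    proof (rule sublinear_onI[OF S])
      show "r 0 = 0"
        using le[of 0 0] ge[of 0 0] q_scale[OF a] S q0 by (simp add: subspace_0)
    next
      fix x y assume xy: "x \<in> S" "y \<in> S"
      have *: "r (x + y) \<le> (q (x + s *\<^sub>R a) - s * q a) + (q (y + t *\<^sub>R a) - t * q a)"
        if "s \<ge> 0" "t \<ge> 0" for s t
      proof -
        have "(x + y) + (s + t) *\<^sub>R a = (x + s *\<^sub>R a) + (y + t *\<^sub>R a)"
          by (simp add: algebra_simps)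
        then show ?thesis
          using le[of "x + y" "s + t"] q_add[OF in_S[OF xy(1), of s] in_S[OF xy(2), of t]] xy that S
          by (simp add: subspace_add algebra_simps)
      qed
      have "r (x + y) - (q (x + s *\<^sub>R a) - s * q a) \<le> r y" if "s \<ge> 0" for s
        using *[OF that] by (intro ge) (smt (verit))
      then have "r (x + y) - r y \<le> r x"
        by (intro ge) (smt (verit))
      then show "r (x + y) \<le> r x + r y" by simp
    next
      fix t :: real and x assume t: "0 < t" and x: "x \<in> S"
      have "r (t *\<^sub>R x) / t \<le> r x"
      proof (rule ge)
        fix s :: real assume s: "s \<ge> 0"
        have "r (t *\<^sub>R x) \<le> q (t *\<^sub>R x + (t * s) *\<^sub>R a) - (t * s) * q a"
          using x s t S by (intro le) (auto simp: subspace_scale)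
        also have "t *\<^sub>R x + (t * s) *\<^sub>R a = t *\<^sub>R (x + s *\<^sub>R a)"
          by (simp add: algebra_simps)
        also have "q \<dots> = t * q (x + s *\<^sub>R a)"
          using t by (intro q_scale in_S x) simp
        finally show "r (t *\<^sub>R x) / t \<le> q (x + s *\<^sub>R a) - s * q a"
          using t by (simp add: field_simps)
      qed
      then show "r (t *\<^sub>R x) \<le> t * r x" using t by (simp add: field_simps)
    qed
    moreover have "r x \<le> q x" if "x \<in> S" for x
      using le[OF that, of 0] by simp
    ultimately have "r x = q x" using x min by blast
    then show "q x + q a \<le> q (x + a)" using le[OF x, of 1] by simp
  qed (use q_add that in auto)
  have minus: "q (- x) = - q x" if "x \<in> S" for x
    using add[OF that, of "- x"] S that q0 by (simp add: subspace_neg)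
  have "q (t *\<^sub>R x) = t * q x" if x: "x \<in> S" for t x
  proof (cases "t \<ge> 0")
    case False
    then have "q ((- t) *\<^sub>R x) = (- t) * q x" using x by (intro q_scale) auto
    then show ?thesis using minus[of "t *\<^sub>R x"] x S by (simp add: subspace_scale)
  qed (use q_scale x in auto)
  then have "linear_functional_on S q" using add by (auto simp: linear_functional_on_def)
  then show ?thesis using q(2) by blast
qed

theorem hahn_banach:
  fixes J :: "'e::real_vector \<Rightarrow> 's::real_vector"
  assumes S: "subspace S" and q: "sublinear_on S q" and E: "subspace E"
    and J: "\<And>x. x \<in> E \<Longrightarrow> J x \<in> S" "\<And>x y. x \<in> E \<Longrightarrow> y \<in> E \<Longrightarrow> J (x + y) = J x + J y"
      "\<And>a x. x \<in> E \<Longrightarrow> J (a *\<^sub>R x) = a *\<^sub>R J x"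
    and phi: "linear_functional_on E \<phi>" and le: "\<And>x. x \<in> E \<Longrightarrow> \<phi> x \<le> q (J x)"
  obtains f where "linear_functional_on S f" "\<And>x. x \<in> S \<Longrightarrow> f x \<le> q x"
    "\<And>x. x \<in> E \<Longrightarrow> f (J x) = \<phi> x"
proof -
  define p where "p l = (INF x\<in>E. q (l - J x) + \<phi> x)" for l
  note phi' = linear_functional_onD[OF phi]
  have E0: "0 \<in> E" using E by (rule subspace_0)
  have J0: "J 0 = 0" using J(3)[OF E0, of 0] by simp
  have phi0: "\<phi> 0 = 0" using E phi by (rule linear_functional_on_0)
  have q0: "q 0 = 0" using q by (simp add: sublinear_on_def)
  have low: "- q (- l) \<le> q (l - J x) + \<phi> x" if "l \<in> S" "x \<in> E" for l x
  proof -
    have "\<phi> (- x) \<le> q (J (- x))" using that E by (intro le) (simp add: subspace_neg)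
    also have "J (- x) = (l - J x) + (- l)" using J(3)[of x "-1"] that by simp
    also have "q \<dots> \<le> q (l - J x) + q (- l)"
      using that J S by (intro sublinear_on_add[OF q]) (auto simp: subspace_diff subspace_neg)
    finally show ?thesis using linear_functional_on_minus[OF phi that(2)] by simp
  qed
  have p_le: "p l \<le> q (l - J x) + \<phi> x" if "l \<in> S" "x \<in> E" for l x
    unfolding p_def using that low by (intro cINF_lower bdd_belowI2) auto
  have p_ge: "m \<le> p l" if "\<And>x. x \<in> E \<Longrightarrow> m \<le> q (l - J x) + \<phi> x" for m l
    unfolding p_def using that E0 by (intro cINF_greatest) auto
  have p: "sublinear_on S p"
  proof (rule sublinear_onI[OF S])
    show "p 0 = 0"
      using p_le[OF subspace_0[OF S] E0] p_ge[of 0 0] low[OF subspace_0[OF S]]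
      by (simp add: J0 phi0 q0)
  next
    fix l m assume lm: "l \<in> S" "m \<in> S"
    have *: "p (l + m) \<le> (q (l - J x) + \<phi> x) + (q (m - J y) + \<phi> y)" if "x \<in> E" "y \<in> E" for x y
    proof -
      have "p (l + m) \<le> q ((l + m) - J (x + y)) + \<phi> (x + y)"
        using lm that E S by (intro p_le) (auto simp: subspace_add)
      also have "(l + m) - J (x + y) = (l - J x) + (m - J y)" using J(2) that by simp
      also have "q \<dots> \<le> q (l - J x) + q (m - J y)"
        using lm that J S by (intro sublinear_on_add[OF q]) (auto simp: subspace_diff)
      finally show ?thesis using phi'(1) that by simp
    qed
    have "p (l + m) - (q (l - J x) + \<phi> x) \<le> p m" if "x \<in> E" for x
      using *[OF that] by (intro p_ge) (smt (verit))
    then have "p (l + m) - p m \<le> p l"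
      by (intro p_ge) (smt (verit))
    then show "p (l + m) \<le> p l + p m" by simp
  next
    fix t :: real and l assume t: "0 < t" and l: "l \<in> S"
    have "p (t *\<^sub>R l) / t \<le> p l"
    proof (rule p_ge)
      fix x assume x: "x \<in> E"
      have "p (t *\<^sub>R l) \<le> q (t *\<^sub>R l - J (t *\<^sub>R x)) + \<phi> (t *\<^sub>R x)"
        using x l S E by (intro p_le) (auto simp: subspace_scale)
      also have "t *\<^sub>R l - J (t *\<^sub>R x) = t *\<^sub>R (l - J x)" using J(3) x by (simp add: algebra_simps)
      also have "q \<dots> = t * q (l - J x)"
        using x l t S J by (intro sublinear_on_scale[OF q]) (auto simp: subspace_diff)
      finally show "p (t *\<^sub>R l) / t \<le> q (l - J x) + \<phi> x"
        using t phi'(2) x by (simp add: field_simps)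
    qed
    then show "p (t *\<^sub>R l) \<le> t * p l" using t by (simp add: field_simps)
  qed
  obtain f where f: "linear_functional_on S f" "\<And>x. x \<in> S \<Longrightarrow> f x \<le> p x"
    using linear_below_sublinear[OF S p] by blast
  have le': "f (J x) \<le> \<phi> x" if "x \<in> E" for x
    using f(2)[OF J(1)[OF that]] p_le[OF J(1)[OF that] that] q0 by simp
  show ?thesis
  proof (rule that[OF f(1)])
    show "f x \<le> q x" if "x \<in> S" for x
      using f(2)[OF that] p_le[OF that E0] by (simp add: J0 phi0)
    show "f (J x) = \<phi> x" if "x \<in> E" for x
    proof (rule antisym)
      have "f (J (- x)) \<le> \<phi> (- x)" using that E by (intro le') (simp add: subspace_neg)
      moreover have "f (J (- x)) = - f (J x)"
        using J(3)[OF that, of "-1"] linear_functional_on_minus[OF f(1) J(1)[OF that]] by simp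
      ultimately show "\<phi> x \<le> f (J x)" using linear_functional_on_minus[OF phi that] by simp
    qed (use le' that in auto)
  qed
qed

section \<open>Topologies given by seminorms\<close>

definition seminorm_on :: "'v::real_vector set \<Rightarrow> ('v \<Rightarrow> real) \<Rightarrow> bool"
  where "seminorm_on S q \<longleftrightarrow> (\<forall>x\<in>S. \<forall>y\<in>S. q (x + y) \<le> q x + q y) \<and>
    (\<forall>a. \<forall>x\<in>S. q (a *\<^sub>R x) = \<bar>a\<bar> * q x)"

lemma seminorm_onD:
  assumes "seminorm_on S q"
  shows "x \<in> S \<Longrightarrow> y \<in> S \<Longrightarrow> q (x + y) \<le> q x + q y" "x \<in> S \<Longrightarrow> q (a *\<^sub>R x) = \<bar>a\<bar> * q x"
  using assms by (auto simp: seminorm_on_def)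

lemma seminorm_on_minus: "seminorm_on S q \<Longrightarrow> x \<in> S \<Longrightarrow> q (- x) = q x"
  using seminorm_onD(2)[of S q x "-1"] by simp

lemma seminorm_on_0: "subspace S \<Longrightarrow> seminorm_on S q \<Longrightarrow> q 0 = 0"
  using seminorm_onD(2)[of S q 0 0] by (simp add: subspace_0)

lemma seminorm_on_nonneg: "subspace S \<Longrightarrow> seminorm_on S q \<Longrightarrow> x \<in> S \<Longrightarrow> 0 \<le> q x"
  using seminorm_onD(1)[of S q x "- x"]
  by (simp add: seminorm_on_minus seminorm_on_0 subspace_neg)

lemma seminorm_on_triangle:
  assumes "subspace S" "seminorm_on S q" "x \<in> S" "y \<in> S" "z \<in> S"
  shows "q (x - z) \<le> q (x - y) + q (y - z)"
  using seminorm_onD(1)[OF assms(2), of "x - y" "y - z"] assms by (simp add: subspace_diff)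

lemma seminorm_on_sublinear: "subspace S \<Longrightarrow> seminorm_on S q \<Longrightarrow> sublinear_on S q"
  by (simp add: sublinear_on_def seminorm_on_0 seminorm_onD)

definition seminorm_ball :: "'v::real_vector set \<Rightarrow> ('v \<Rightarrow> real) set \<Rightarrow> 'v \<Rightarrow> real \<Rightarrow> 'v set"
  where "seminorm_ball S F x e = {y \<in> S. \<forall>q\<in>F. q (y - x) < e}"

locale seminorm_family =
  fixes S :: "'v::real_vector set" and Q :: "('v \<Rightarrow> real) set"
  assumes S: "subspace S" and Q_ne: "Q \<noteq> {}" and Q: "\<And>q. q \<in> Q \<Longrightarrow> seminorm_on S q"
begin

abbreviation T where "T \<equiv> seminorm_topology S Q"

lemma center_in_ball:
  assumes "x \<in> S" "F \<subseteq> Q" "0 < e"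
  shows "x \<in> seminorm_ball S F x e"
proof -
  have "q (x - x) < e" if "q \<in> F" for q
    using seminorm_on_0[OF S Q, of q] that assms by auto
  then show ?thesis using assms by (simp add: seminorm_ball_def)
qed

lemma topspace_eq: "topspace T = S"
proof -
  obtain q where q: "q \<in> Q" using Q_ne by blast
  have "x \<in> \<Union> {{y \<in> S. q (y - x) < e} |q x e. q \<in> Q \<and> x \<in> S \<and> 0 < e}" if "x \<in> S" for x
  proof -
    have "{y \<in> S. q (y - x) < 1} \<in> {{y \<in> S. q (y - x) < e} |q x e. q \<in> Q \<and> x \<in> S \<and> 0 < e}"
      using q that zero_less_one by blast
    moreover have "x \<in> {y \<in> S. q (y - x) < 1}"
      using that seminorm_on_0[OF S Q[OF q]] by simp
    ultimately show ?thesis by (rule UnionI)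
  qed
  then show ?thesis
    unfolding seminorm_topology_def topology_generated_by_topspace by auto
qed

lemma openin_ball:
  assumes "x \<in> S" "finite F" "F \<subseteq> Q" "0 < e"
  shows "openin T (seminorm_ball S F x e)"
  using assms(2,3)
proof (induction F rule: finite_induct)
  case empty
  then show ?case
    using openin_topspace[of T] by (simp add: seminorm_ball_def topspace_eq)
next
  case (insert q F)
  have "openin T {y \<in> S. q (y - x) < e}"
    unfolding seminorm_topology_def using insert assms
    by (intro topology_generated_by_Basis) blast
  moreover have "seminorm_ball S (insert q F) x e = {y \<in> S. q (y - x) < e} \<inter> seminorm_ball S F x e"
    by (auto simp: seminorm_ball_def)
  ultimately show ?case using insert by auto
qed

lemma openin_iff:
  "openin T V \<longleftrightarrow> V \<subseteq> S \<and> (\<forall>x\<in>V. \<exists>F e. F \<subseteq> Q \<and> finite F \<and> 0 < e \<and> seminorm_ball S F x e \<subseteq> V)"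
  (is "_ \<longleftrightarrow> ?R V")
proof
  assume "openin T V"
  then have "generate_topology_on {{y \<in> S. q (y - x) < e} |q x e. q \<in> Q \<and> x \<in> S \<and> 0 < e} V"
    by (simp add: seminorm_topology_def openin_topology_generated_by_iff)
  then show "?R V"
  proof induction
    case (Int a b)
    have "\<exists>F e. F \<subseteq> Q \<and> finite F \<and> 0 < e \<and> seminorm_ball S F x e \<subseteq> a \<inter> b" if x: "x \<in> a \<inter> b" for x
    proof -
      obtain F e where F: "F \<subseteq> Q" "finite F" "0 < e" "seminorm_ball S F x e \<subseteq> a"
        using Int x by blast
      obtain G d where G: "G \<subseteq> Q" "finite G" "0 < d" "seminorm_ball S G x d \<subseteq> b"
        using Int x by blast
      have "seminorm_ball S (F \<union> G) x (min e d) \<subseteq> seminorm_ball S F x e \<inter> seminorm_ball S G x d"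
        by (auto simp: seminorm_ball_def)
      then show ?thesis using F G by (intro exI[of _ "F \<union> G"] exI[of _ "min e d"]) auto
    qed
    then show ?case using Int by blast
  next
    case (UN K)
    then show ?case by (meson Sup_least UnionE Union_upper order_trans)
  next
    case (Basis s)
    then obtain q z e where s: "s = {y \<in> S. q (y - z) < e}" "q \<in> Q" "z \<in> S" "0 < e" by blast
    have "\<exists>F e. F \<subseteq> Q \<and> finite F \<and> 0 < e \<and> seminorm_ball S F x e \<subseteq> s" if "x \<in> s" for x
    proof (intro exI conjI)
      show "seminorm_ball S {q} x (e - q (x - z)) \<subseteq> s"
        using that s seminorm_on_triangle[OF S Q[OF s(2)] _ _ s(3)]
        by (fastforce simp: seminorm_ball_def)
    qed (use that s in auto)
    then show ?case using s by blast
  qed auto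
next
  assume R: "?R V"
  then show "openin T V"
    using center_in_ball openin_ball openin_subopen[of T V] by (meson subset_iff)
qed

lemma ball_0_scale:
  assumes "F \<subseteq> Q" "finite F" "0 < e" "x \<in> S" "d > 0"
  shows "(e / ((\<Sum>q\<in>F. q x) + d)) *\<^sub>R x \<in> seminorm_ball S F 0 e" "0 \<le> (\<Sum>q\<in>F. q x)"
proof -
  have nn: "0 \<le> q x" if "q \<in> F" for q
    using that assms seminorm_on_nonneg[OF S Q] by blast
  show s: "0 \<le> (\<Sum>q\<in>F. q x)" using nn by (rule sum_nonneg)
  have "q ((e / ((\<Sum>q\<in>F. q x) + d)) *\<^sub>R x) < e" if "q \<in> F" for q
  proof -
    have "q x < (\<Sum>q\<in>F. q x) + d"
      using member_le_sum[of q F "\<lambda>q. q x"] nn that assms by force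
    then have "e * q x < e * ((\<Sum>q\<in>F. q x) + d)" using assms by simp
    moreover have "q ((e / ((\<Sum>q\<in>F. q x) + d)) *\<^sub>R x) = e / ((\<Sum>q\<in>F. q x) + d) * q x"
      using seminorm_onD(2)[OF Q] that assms s by (subst seminorm_onD(2)[OF Q]) auto
    moreover have "e / ((\<Sum>q\<in>F. q x) + d) * q x < e"
      using \<open>e * q x < _\<close> s assms by (simp add: pos_divide_less_eq)
    ultimately show ?thesis by simp
  qed
  then show "(e / ((\<Sum>q\<in>F. q x) + d)) *\<^sub>R x \<in> seminorm_ball S F 0 e"
    using assms S by (auto simp: seminorm_ball_def subspace_scale)
qed

lemma ball_0_subset_open:
  assumes "openin T V" "0 \<in> V"
  obtains F e where "F \<subseteq> Q" "finite F" "0 < e" "seminorm_ball S F 0 e \<subseteq> V"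
  using assms by (auto simp: openin_iff)

lemma continuous_functional_bound:
  assumes f: "linear_functional_on S f" and cont: "continuous_map T euclideanreal f"
  obtains F C where "F \<subseteq> Q" "finite F" "0 \<le> C" "\<And>x. x \<in> S \<Longrightarrow> \<bar>f x\<bar> \<le> C * (\<Sum>q\<in>F. q x)"
proof -
  have "openin T {x \<in> S. f x \<in> {-1<..<1}}"
    using openin_continuous_map_preimage[OF cont, of "{-1<..<1}"] by (simp add: topspace_eq)
  moreover have "0 \<in> {x \<in> S. f x \<in> {-1<..<1}}"
    using linear_functional_on_0[OF S f] S by (simp add: subspace_0)
  ultimately obtain F e where F: "F \<subseteq> Q" "finite F" "0 < e"
    "seminorm_ball S F 0 e \<subseteq> {x \<in> S. f x \<in> {-1<..<1}}" by (rule ball_0_subset_open)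
  show ?thesis
  proof (rule that[of F "1 / e"])
    fix x assume x: "x \<in> S"
    have "\<bar>f x\<bar> * e \<le> (\<Sum>q\<in>F. q x)"
    proof (rule field_le_epsilon)
      fix d :: real assume d: "0 < d"
      let ?s = "e / ((\<Sum>q\<in>F. q x) + d)"
      note b = ball_0_scale[OF F(1-3) x d]
      have "\<bar>f (?s *\<^sub>R x)\<bar> \<le> 1" using subsetD[OF F(4) b(1)] by auto
      then have "\<bar>?s\<bar> * \<bar>f x\<bar> \<le> 1" using linear_functional_onD(2)[OF f x] by (simp add: abs_mult)
      then show "\<bar>f x\<bar> * e \<le> (\<Sum>q\<in>F. q x) + d"
        using b(2) d F(3) by (simp add: field_simps)
    qed
    then show "\<bar>f x\<bar> \<le> 1 / e * (\<Sum>q\<in>F. q x)" using F(3) by (simp add: field_simps)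
  qed (use F in auto)
qed

lemma continuous_functionalI:
  assumes f: "linear_functional_on S f" and q: "q \<in> Q" and le: "\<And>x. x \<in> S \<Longrightarrow> \<bar>f x\<bar> \<le> C * q x"
  shows "continuous_map T euclideanreal f"
proof -
  have "openin T {x \<in> S. f x \<in> U}" if "open U" for U
  proof -
    have "\<exists>F e. F \<subseteq> Q \<and> finite F \<and> 0 < e \<and> seminorm_ball S F x e \<subseteq> {x \<in> S. f x \<in> U}"
      if x: "x \<in> S" "f x \<in> U" for x
    proof -
      obtain d where d: "d > 0" "ball (f x) d \<subseteq> U" using \<open>open U\<close> x by (meson open_contains_ball)
      have "f y \<in> U" if y: "y \<in> S" "q (y - x) < d / (\<bar>C\<bar> + 1)" for y
      proof -
        have yx: "y - x \<in> S" using x y S by (simp add: subspace_diff)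
        have nn: "0 \<le> q (y - x)" using seminorm_on_nonneg[OF S Q[OF q] yx] .
        have "\<bar>f y - f x\<bar> \<le> C * q (y - x)"
          using le[OF yx] linear_functional_on_diff[OF S f y(1) x(1)] by simp
        also have "\<dots> \<le> (\<bar>C\<bar> + 1) * q (y - x)" using nn by (intro mult_right_mono) auto
        also have "\<dots> < d" using y by (simp add: field_simps)
        finally show ?thesis using d by (auto simp: dist_real_def subset_iff)
      qed
      then have "seminorm_ball S {q} x (d / (\<bar>C\<bar> + 1)) \<subseteq> {x \<in> S. f x \<in> U}"
        by (auto simp: seminorm_ball_def)
      then show ?thesis
        using q d by (intro exI[of _ "{q}"] exI[of _ "d / (\<bar>C\<bar> + 1)"]) auto
    qed
    then show ?thesis by (auto simp: openin_iff)
  qed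
  then show ?thesis by (auto simp: continuous_map_def topspace_eq)
qed

lemma bounded_in_iff: "bounded_in T D \<longleftrightarrow> D \<subseteq> S \<and> (\<forall>q\<in>Q. \<exists>C. \<forall>x\<in>D. q x \<le> C)"
proof
  assume D: "bounded_in T D"
  have "\<exists>C. \<forall>x\<in>D. q x \<le> C" if q: "q \<in> Q" for q
  proof -
    have "openin T (seminorm_ball S {q} 0 1)" "0 \<in> seminorm_ball S {q} 0 1"
      using q S by (auto intro!: openin_ball center_in_ball simp: subspace_0)
    then obtain t where t: "t > 0" "D \<subseteq> (\<lambda>x. t *\<^sub>R x) ` seminorm_ball S {q} 0 1"
      using D unfolding bounded_in_def by (metis order_refl)
    have "q x \<le> t" if x: "x \<in> D" for x
    proof -
      obtain y where "y \<in> seminorm_ball S {q} 0 1" "x = t *\<^sub>R y"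
        using x t(2) by blast
      then have y: "x = t *\<^sub>R y" "y \<in> S" "q y < 1"
        by (auto simp: seminorm_ball_def)
      then show ?thesis using seminorm_onD(2)[OF Q[OF q] y(2), of t] t by simp
    qed
    then show ?thesis by blast
  qed
  then show "D \<subseteq> S \<and> (\<forall>q\<in>Q. \<exists>C. \<forall>x\<in>D. q x \<le> C)"
    using D by (simp add: bounded_in_def topspace_eq)
next
  assume D: "D \<subseteq> S \<and> (\<forall>q\<in>Q. \<exists>C. \<forall>x\<in>D. q x \<le> C)"
  have "\<exists>s>0. \<forall>t\<ge>s. D \<subseteq> (\<lambda>x. t *\<^sub>R x) ` V" if V: "openin T V" "0 \<in> V" for V
  proof -
    obtain F e where F: "F \<subseteq> Q" "finite F" "0 < e" "seminorm_ball S F 0 e \<subseteq> V"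
      using V by (rule ball_0_subset_open)
    obtain C where C: "\<And>q x. q \<in> Q \<Longrightarrow> x \<in> D \<Longrightarrow> q x \<le> C q" using D by metis
    define s where "s = (1 + (\<Sum>q\<in>F. \<bar>C q\<bar>)) / e"
    have s: "s > 0" using F(3) by (auto simp: s_def intro!: divide_pos_pos add_pos_nonneg sum_nonneg)
    have "x \<in> (\<lambda>x. t *\<^sub>R x) ` V" if t: "t \<ge> s" and x: "x \<in> D" for t x
    proof -
      have t0: "t > 0" using s t by simp
      have "q (inverse t *\<^sub>R x) < e" if q: "q \<in> F" for q
      proof -
        have "q x \<le> \<bar>C q\<bar>" using C[of q x] q F x by fastforce
        also have "\<dots> \<le> (\<Sum>q\<in>F. \<bar>C q\<bar>)" using F q by (intro member_le_sum) auto
        also have "\<dots> < s * e" using F(3) by (simp add: s_def)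
        also have "\<dots> \<le> t * e" using t F(3) by simp
        finally have "q x < t * e" .
        moreover have "q (inverse t *\<^sub>R x) = inverse t * q x"
          using seminorm_onD(2)[OF Q, of q x "inverse t"] q F x D t0 by auto
        moreover have "inverse t * q x < e"
          using \<open>q x < t * e\<close> t0 by (simp add: field_simps)
        ultimately show ?thesis by simp
      qed
      moreover have "inverse t *\<^sub>R x \<in> S" using x D S by (auto simp: subspace_scale)
      ultimately have "inverse t *\<^sub>R x \<in> seminorm_ball S F 0 e"
        unfolding seminorm_ball_def diff_zero by blast
      then have "inverse t *\<^sub>R x \<in> V" using F(4) by blast
      moreover have "x = t *\<^sub>R (inverse t *\<^sub>R x)" using t0 by simp
      ultimately show ?thesis by (rule rev_image_eqI)
    qed
    then show ?thesis using s by blast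
  qed
  then show "bounded_in T D" using D by (simp add: bounded_in_def topspace_eq)
qed

lemma continuous_map_plus: "continuous_map (prod_topology T T) T (\<lambda>(x, y). x + y)"
proof -
  have "openin (prod_topology T T) {z \<in> S \<times> S. (case z of (x, y) \<Rightarrow> x + y) \<in> V}" if V: "openin T V" for V
  proof (unfold openin_prod_topology_alt, intro allI impI)
    fix x y assume "(x, y) \<in> {z \<in> S \<times> S. (case z of (x, y) \<Rightarrow> x + y) \<in> V}"
    then have xy: "x \<in> S" "y \<in> S" "x + y \<in> V" by auto
    then obtain F e where F: "F \<subseteq> Q" "finite F" "0 < e" "seminorm_ball S F (x + y) e \<subseteq> V"
      using V by (auto simp: openin_iff)
    have "u + v \<in> V" if u: "u \<in> seminorm_ball S F x (e / 2)" and v: "v \<in> seminorm_ball S F y (e / 2)" for u v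
    proof -
      have uv: "u \<in> S" "v \<in> S" using u v by (auto simp: seminorm_ball_def)
      have "q ((u + v) - (x + y)) < e" if q: "q \<in> F" for q
      proof -
        have "q ((u - x) + (v - y)) \<le> q (u - x) + q (v - y)"
          using q F uv xy S by (intro seminorm_onD(1)[OF Q]) (auto simp: subspace_diff)
        also have "\<dots> < e" using u v q by (fastforce simp: seminorm_ball_def)
        finally show ?thesis by (simp add: algebra_simps)
      qed
      then have "u + v \<in> seminorm_ball S F (x + y) e"
        using uv S by (auto simp: seminorm_ball_def subspace_add)
      then show ?thesis using F by blast
    qed
    moreover have "u \<in> S" if "u \<in> seminorm_ball S F z (e / 2)" for u z
      using that by (simp add: seminorm_ball_def)
    ultimately have "seminorm_ball S F x (e / 2) \<times> seminorm_ball S F y (e / 2) \<subseteq>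
        {z \<in> S \<times> S. (case z of (x, y) \<Rightarrow> x + y) \<in> V}"
      by auto
    then show "\<exists>U W. openin T U \<and> openin T W \<and> x \<in> U \<and> y \<in> W \<and>
        U \<times> W \<subseteq> {z \<in> S \<times> S. (case z of (x, y) \<Rightarrow> x + y) \<in> V}"
      using xy openin_ball[OF _ F(2,1) half_gt_zero[OF F(3)]]
        center_in_ball[OF _ F(1) half_gt_zero[OF F(3)]] by blast
  qed
  then show ?thesis using S by (auto simp: continuous_map_def topspace_eq subspace_add)
qed

lemma continuous_map_scale: "continuous_map (prod_topology euclideanreal T) T (\<lambda>(a, x). a *\<^sub>R x)"
proof -
  have "openin (prod_topology euclideanreal T) {z \<in> UNIV \<times> S. (case z of (a, x) \<Rightarrow> a *\<^sub>R x) \<in> V}"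
    if V: "openin T V" for V
  proof (unfold openin_prod_topology_alt, intro allI impI)
    fix a x assume "(a, x) \<in> {z \<in> UNIV \<times> S. (case z of (a, x) \<Rightarrow> a *\<^sub>R x) \<in> V}"
    then have x: "x \<in> S" "a *\<^sub>R x \<in> V" by auto
    then obtain F e where F: "F \<subseteq> Q" "finite F" "0 < e" "seminorm_ball S F (a *\<^sub>R x) e \<subseteq> V"
      using V by (auto simp: openin_iff)
    define m where "m = (\<Sum>q\<in>F. q x)"
    have nn: "0 \<le> q x" if "q \<in> F" for q using that F x seminorm_on_nonneg[OF S Q] by blast
    have m: "0 \<le> m" unfolding m_def using nn by (rule sum_nonneg)
    define d where "d = min 1 (e / (\<bar>a\<bar> + 1 + m))"
    have d: "0 < d" "d \<le> 1" "d \<le> e / (\<bar>a\<bar> + 1 + m)"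
      using F(3) m by (auto simp: d_def intro!: divide_pos_pos)
    then have de: "d * (\<bar>a\<bar> + 1 + m) \<le> e"
      using m by (simp add: pos_le_divide_eq)
    have "b *\<^sub>R u \<in> V" if b: "b \<in> ball a d" and u: "u \<in> seminorm_ball S F x d" for b u
    proof -
      have uS: "u \<in> S" using u by (auto simp: seminorm_ball_def)
      have "q (b *\<^sub>R u - a *\<^sub>R x) < e" if q: "q \<in> F" for q
      proof -
        have qs: "seminorm_on S q" using q F Q by blast
        have "q (b *\<^sub>R (u - x) + (b - a) *\<^sub>R x) \<le> q (b *\<^sub>R (u - x)) + q ((b - a) *\<^sub>R x)"
          using uS x S by (intro seminorm_onD(1)[OF qs]) (auto simp: subspace_diff subspace_scale)
        also have "\<dots> = \<bar>b\<bar> * q (u - x) + \<bar>b - a\<bar> * q x"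
          using uS x S by (simp add: seminorm_onD(2)[OF qs] subspace_diff)
        also have "\<dots> < (\<bar>a\<bar> + 1) * d + d * m"
        proof (rule add_less_le_mono)
          have "\<bar>b\<bar> * q (u - x) \<le> (\<bar>a\<bar> + 1) * q (u - x)"
            using b d seminorm_on_nonneg[OF S qs, of "u - x"] uS x S
            by (intro mult_right_mono) (auto simp: dist_real_def subspace_diff)
          also have "\<dots> < (\<bar>a\<bar> + 1) * d"
            using u q by (intro mult_strict_left_mono) (auto simp: seminorm_ball_def)
          finally show "\<bar>b\<bar> * q (u - x) < (\<bar>a\<bar> + 1) * d" .
          have "q x \<le> m" unfolding m_def
            using member_le_sum[of q F "\<lambda>q. q x"] F(2) q nn by blast
          then show "\<bar>b - a\<bar> * q x \<le> d * m"
            using b d nn[OF q] by (intro mult_mono) (auto simp: dist_real_def)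
        qed
        also have "\<dots> \<le> e" using de by (simp add: algebra_simps)
        finally show ?thesis by (simp add: algebra_simps)
      qed
      then have "b *\<^sub>R u \<in> seminorm_ball S F (a *\<^sub>R x) e"
        using uS S by (auto simp: seminorm_ball_def subspace_scale)
      then show ?thesis using F by blast
    qed
    moreover have "u \<in> S" if "u \<in> seminorm_ball S F x d" for u
      using that by (simp add: seminorm_ball_def)
    ultimately have "ball a d \<times> seminorm_ball S F x d \<subseteq>
        {z \<in> UNIV \<times> S. (case z of (a, x) \<Rightarrow> a *\<^sub>R x) \<in> V}"
      by auto
    moreover have "openin euclideanreal (ball a d)" "a \<in> ball a d" using d by auto
    ultimately show "\<exists>U W. openin euclideanreal U \<and> openin T W \<and> a \<in> U \<and> x \<in> W \<and>
        U \<times> W \<subseteq> {z \<in> UNIV \<times> S. (case z of (a, x) \<Rightarrow> a *\<^sub>R x) \<in> V}"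
      using openin_ball[OF x(1) F(2,1) d(1)] center_in_ball[OF x(1) F(1) d(1)] by blast
  qed
  then show ?thesis using S by (auto simp: continuous_map_def topspace_eq subspace_scale)
qed

lemma convex_ball_0:
  assumes "F \<subseteq> Q"
  shows "convex (seminorm_ball S F 0 e)"
proof (rule convexI)
  fix x y :: 'v and u v :: real
  assume xy: "x \<in> seminorm_ball S F 0 e" "y \<in> seminorm_ball S F 0 e" and uv: "0 \<le> u" "0 \<le> v" "u + v = 1"
  have S': "x \<in> S" "y \<in> S" using xy by (auto simp: seminorm_ball_def)
  have "q (u *\<^sub>R x + v *\<^sub>R y) < e" if q: "q \<in> F" for q
  proof -
    have qs: "seminorm_on S q" using q assms Q by blast
    have "q (u *\<^sub>R x + v *\<^sub>R y) \<le> u * q x + v * q y"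
      using seminorm_onD(1)[OF qs, of "u *\<^sub>R x" "v *\<^sub>R y"] S' S uv
      by (simp add: seminorm_onD(2)[OF qs] subspace_scale)
    also have "\<dots> < e"
      using xy q uv by (intro convex_bound_lt) (auto simp: seminorm_ball_def)
    finally show ?thesis .
  qed
  then show "u *\<^sub>R x + v *\<^sub>R y \<in> seminorm_ball S F 0 e"
    using S' S by (auto simp: seminorm_ball_def subspace_add subspace_scale)
qed

theorem locally_convex: "locally_convex_topology_on S T"
proof -
  have "\<exists>W C. openin T W \<and> 0 \<in> W \<and> W \<subseteq> C \<and> C \<subseteq> V \<and> convex C" if V: "openin T V" "0 \<in> V" for V
  proof -
    obtain F e where F: "F \<subseteq> Q" "finite F" "0 < e" "seminorm_ball S F 0 e \<subseteq> V"
      using V by (rule ball_0_subset_open)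
    then show ?thesis
      using openin_ball[OF subspace_0[OF S] F(2,1,3)] center_in_ball[OF subspace_0[OF S] F(1,3)]
        convex_ball_0[OF F(1)] by blast
  qed
  then show ?thesis
    unfolding locally_convex_topology_on_def
    using S topspace_eq continuous_map_plus continuous_map_scale by blast
qed

end

lemma pullback_seminorm_topology:
  assumes "seminorm_family S Q" and E: "subspace E"
    and J: "\<And>x. x \<in> E \<Longrightarrow> J x \<in> S" "\<And>x y. x \<in> E \<Longrightarrow> y \<in> E \<Longrightarrow> J (x + y) = J x + J y"
      "\<And>a x. x \<in> E \<Longrightarrow> J (a *\<^sub>R x) = a *\<^sub>R J x"
  shows "seminorm_family E ((\<lambda>q. q \<circ> J) ` Q)"
    and "pullback_topology E J (seminorm_topology S Q) = seminorm_topology E ((\<lambda>q. q \<circ> J) ` Q)"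
proof -
  interpret A: seminorm_family S Q by fact
  have semi: "seminorm_on E (q \<circ> J)" if "q \<in> Q" for q
    using seminorm_onD[OF A.Q[OF that]] J by (simp add: seminorm_on_def)
  show "seminorm_family E ((\<lambda>q. q \<circ> J) ` Q)"
    using E A.Q_ne semi by unfold_locales auto
  then interpret B: seminorm_family E "(\<lambda>q. q \<circ> J) ` Q" .
  have Jdiff: "J (x - y) = J x - J y" if "x \<in> E" "y \<in> E" for x y
    using J(2)[of x "- y"] J(3)[of y "-1"] that E by (simp add: subspace_neg)
  have ball: "seminorm_ball E ((\<lambda>q. q \<circ> J) ` F) x e = J -` seminorm_ball S F (J x) e \<inter> E"
    if "x \<in> E" for F x e
    using that Jdiff J(1) by (auto simp: seminorm_ball_def)
  show "pullback_topology E J A.T = B.T"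
  proof (unfold topology_eq, intro allI iffI)
    fix V assume "openin (pullback_topology E J A.T) V"
    then obtain U where U: "openin A.T U" "V = J -` U \<inter> E" by (auto simp: openin_pullback_topology)
    have "\<exists>F e. F \<subseteq> (\<lambda>q. q \<circ> J) ` Q \<and> finite F \<and> 0 < e \<and> seminorm_ball E F x e \<subseteq> V"
      if "x \<in> V" for x
    proof -
      obtain F e where F: "F \<subseteq> Q" "finite F" "0 < e" "seminorm_ball S F (J x) e \<subseteq> U"
        using U \<open>x \<in> V\<close> by (auto simp: A.openin_iff)
      then show ?thesis
        using U that by (intro exI[of _ "(\<lambda>q. q \<circ> J) ` F"] exI[of _ e]) (auto simp: ball)
    qed
    then show "openin B.T V" using U by (auto simp: B.openin_iff)
  next
    fix V assume V: "openin B.T V"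
    have "\<exists>F e. F \<subseteq> Q \<and> finite F \<and> 0 < e \<and> J -` seminorm_ball S F (J x) e \<inter> E \<subseteq> V" if x: "x \<in> V" for x
    proof -
      obtain F e where F: "F \<subseteq> (\<lambda>q. q \<circ> J) ` Q" "finite F" "0 < e" "seminorm_ball E F x e \<subseteq> V"
        using V x by (auto simp: B.openin_iff)
      obtain F' where "F' \<subseteq> Q" "finite F'" "F = (\<lambda>q. q \<circ> J) ` F'"
        using F by (meson finite_subset_image)
      moreover have "x \<in> E" using V x by (auto simp: B.openin_iff)
      ultimately show ?thesis using F ball[of x F' e] by metis
    qed
    note ex = this
    have VE: "V \<subseteq> E" using V by (simp add: B.openin_iff)
    define \<B> where "\<B> = {B. openin A.T B \<and> J -` B \<inter> E \<subseteq> V}"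
    have "V \<subseteq> J -` \<Union> \<B>"
    proof
      fix x assume x: "x \<in> V"
      obtain F e where F: "F \<subseteq> Q" "finite F" "0 < e" "J -` seminorm_ball S F (J x) e \<inter> E \<subseteq> V"
        using ex[OF x] by blast
      have "J x \<in> S" using x VE J(1) by blast
      then have "seminorm_ball S F (J x) e \<in> \<B>" "J x \<in> seminorm_ball S F (J x) e"
        using A.openin_ball[OF _ F(2,1,3)] A.center_in_ball[OF _ F(1,3)] F(4) unfolding \<B>_def by blast+
      then show "x \<in> J -` \<Union> \<B>" unfolding vimage_def by blast
    qed
    then have "V = J -` \<Union> \<B> \<inter> E" using VE by (auto simp: \<B>_def)
    moreover have "openin A.T (\<Union> \<B>)" by (rule openin_Union) (auto simp: \<B>_def)
    ultimately show "openin (pullback_topology E J A.T) V" by (auto simp: openin_pullback_topology)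
  qed
qed

section \<open>Banach--Steinhaus and Mackey topologies\<close>

definition series_complete :: "'w::real_vector set \<Rightarrow> 'w set \<Rightarrow> bool"
  where "series_complete F K \<longleftrightarrow> (\<forall>\<xi>. (\<forall>n. \<xi> n \<in> K) \<longrightarrow>
    (\<exists>x\<in>F. \<forall>n. \<exists>y\<in>K. x - (\<Sum>m<n. (1/3)^m *\<^sub>R \<xi> m) = (3/2 * (1/3)^n) *\<^sub>R y))"

text \<open>Sokal's proof of the uniform boundedness theorem: one of \<open>f (x + \<xi>)\<close>, \<open>f (x - \<xi>)\<close> is at
  least \<open>\<bar>f \<xi>\<bar>\<close> in absolute value.\<close>

theorem uniform_boundedness_series_complete:
  assumes F: "subspace F" and KF: "K \<subseteq> F" and sym: "\<And>y. y \<in> K \<Longrightarrow> - y \<in> K"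
    and complete: "series_complete F K"
    and lin: "\<And>f. f \<in> \<Phi> \<Longrightarrow> linear_functional_on F f"
    and bdd: "\<And>f. f \<in> \<Phi> \<Longrightarrow> \<exists>C. \<forall>y\<in>K. \<bar>f y\<bar> \<le> C"
    and pointwise: "\<And>x. x \<in> F \<Longrightarrow> \<exists>C. \<forall>f\<in>\<Phi>. \<bar>f x\<bar> \<le> C"
  shows "\<exists>C. \<forall>f\<in>\<Phi>. \<forall>y\<in>K. \<bar>f y\<bar> \<le> C"
proof (rule ccontr)
  assume contra: "\<not> (\<exists>C. \<forall>f\<in>\<Phi>. \<forall>y\<in>K. \<bar>f y\<bar> \<le> C)"
  have "\<exists>f \<xi>. f \<in> \<Phi> \<and> \<xi> \<in> K \<and> C < \<bar>f \<xi>\<bar> \<and> (\<forall>y\<in>K. \<bar>f y\<bar> \<le> 3/2 * \<bar>f \<xi>\<bar>)" for C :: real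
  proof -
    obtain f y where fy: "f \<in> \<Phi>" "y \<in> K" "\<bar>C\<bar> < \<bar>f y\<bar>"
      using contra by (meson not_le)
    define s where "s = Sup ((\<lambda>y. \<bar>f y\<bar>) ` K)"
    have bdd': "bdd_above ((\<lambda>y. \<bar>f y\<bar>) ` K)"
      using bdd[OF fy(1)] by (auto simp: bdd_above_def)
    have le: "\<bar>f z\<bar> \<le> s" if "z \<in> K" for z
      unfolding s_def using that bdd' by (intro cSup_upper) auto
    have "max \<bar>C\<bar> (2/3 * s) < s" using le[OF fy(2)] fy(3) by auto
    then have "\<exists>a\<in>(\<lambda>y. \<bar>f y\<bar>) ` K. max \<bar>C\<bar> (2/3 * s) < a"
      unfolding s_def using less_cSup_iff[OF _ bdd'] fy(2) by blast
    then obtain \<xi> where "\<xi> \<in> K" "max \<bar>C\<bar> (2/3 * s) < \<bar>f \<xi>\<bar>" by blast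
    then show ?thesis using le fy(1) by (intro exI[of _ f] exI[of _ \<xi>]) fastforce
  qed
  then have "\<forall>n. \<exists>f \<xi>. f \<in> \<Phi> \<and> \<xi> \<in> K \<and> 4 * 3^n * real n < \<bar>f \<xi>\<bar> \<and> (\<forall>y\<in>K. \<bar>f y\<bar> \<le> 3/2 * \<bar>f \<xi>\<bar>)"
    by blast
  then obtain f \<xi> where f: "\<And>n. f n \<in> \<Phi>" and \<xi>: "\<And>n. \<xi> n \<in> K"
    and big: "\<And>n. 4 * 3^n * real n < \<bar>f n (\<xi> n)\<bar>"
    and norm: "\<And>n y. y \<in> K \<Longrightarrow> \<bar>f n y\<bar> \<le> 3/2 * \<bar>f n (\<xi> n)\<bar>"
    by metis
  define pick where "pick n x =
    (if \<bar>f n (x - (1/3)^n *\<^sub>R \<xi> n)\<bar> \<le> \<bar>f n (x + (1/3)^n *\<^sub>R \<xi> n)\<bar> then \<xi> n else - \<xi> n)" for n x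
  define X where "X = rec_nat 0 (\<lambda>n x. x + (1/3)^n *\<^sub>R pick n x)"
  define \<eta> where "\<eta> n = pick n (X n)" for n
  have X0: "X 0 = 0" and XSuc: "X (Suc n) = X n + (1/3)^n *\<^sub>R \<eta> n" for n
    by (simp_all add: X_def \<eta>_def)
  have X_sum: "X n = (\<Sum>m<n. (1/3)^m *\<^sub>R \<eta> m)" for n
    by (induction n) (simp_all add: X0 XSuc)
  have \<eta>: "\<eta> n \<in> K" for n using \<xi> sym by (simp add: \<eta>_def pick_def)
  have XF: "X n \<in> F" for n
    unfolding X_sum using \<eta> KF F by (intro subspace_sum subspace_scale) auto
  have \<xi>F: "(1/3)^n *\<^sub>R \<xi> n \<in> F" for n using \<xi> KF F by (auto intro: subspace_scale)
  obtain x where x: "x \<in> F" "\<And>n. \<exists>y\<in>K. x - X n = (3/2 * (1/3)^n) *\<^sub>R y"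
    using complete \<eta> unfolding series_complete_def X_sum by blast
  obtain C where C: "\<And>g. g \<in> \<Phi> \<Longrightarrow> \<bar>g x\<bar> \<le> C" using pointwise[OF x(1)] by blast
  have "real n \<le> C" for n
  proof -
    note l = lin[OF f[of n]]
    let ?a = "\<bar>f n (\<xi> n)\<bar>"
    have fs: "f n ((1/3)^n *\<^sub>R \<xi> n) = (1/3)^n * f n (\<xi> n)"
      using linear_functional_onD(2)[OF l] \<xi> KF by blast
    have "f n (X n + (1/3)^n *\<^sub>R \<xi> n) = f n (X n) + (1/3)^n * f n (\<xi> n)"
      "f n (X n - (1/3)^n *\<^sub>R \<xi> n) = f n (X n) - (1/3)^n * f n (\<xi> n)"
      using linear_functional_onD(1)[OF l XF \<xi>F] linear_functional_on_diff[OF F l XF \<xi>F] fs by auto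
    moreover have "\<bar>f n (X (Suc n))\<bar> =
      max \<bar>f n (X n + (1/3)^n *\<^sub>R \<xi> n)\<bar> \<bar>f n (X n - (1/3)^n *\<^sub>R \<xi> n)\<bar>"
      unfolding XSuc \<eta>_def pick_def by auto
    ultimately have "\<bar>(1/3)^n * f n (\<xi> n)\<bar> \<le> \<bar>f n (X (Suc n))\<bar>" by linarith
    then have 1: "(1/3)^n * ?a \<le> \<bar>f n (X (Suc n))\<bar>" by (simp add: abs_mult)
    obtain y where y: "y \<in> K" "x - X (Suc n) = (3/2 * (1/3)^Suc n) *\<^sub>R y" using x(2) by blast
    have "f n x - f n (X (Suc n)) = (3/2 * (1/3)^Suc n) * f n y"
      using linear_functional_on_diff[OF F l x(1) XF, of "Suc n"] y(2)
        linear_functional_onD(2)[OF l, of y] y(1) KF by auto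
    also have "3/2 * (1/3)^Suc n = 1/2 * (1/3::real)^n" by simp
    finally have eq: "f n x - f n (X (Suc n)) = (1/2 * (1/3)^n) * f n y" .
    have "\<bar>f n x - f n (X (Suc n))\<bar> = (1/2 * (1/3)^n) * \<bar>f n y\<bar>"
      by (subst eq) (simp add: abs_mult)
    also have "\<dots> \<le> (1/2 * (1/3)^n) * (3/2 * ?a)" using norm[OF y(1)] by (intro mult_left_mono) auto
    finally have "\<bar>f n x - f n (X (Suc n))\<bar> \<le> 3/4 * ((1/3)^n * ?a)" by simp
    then have "1/4 * ((1/3)^n * ?a) \<le> \<bar>f n x\<bar>" using 1 by linarith
    moreover have "(1/3)^n * (4 * 3^n * real n) \<le> (1/3)^n * ?a"
      using big[of n] by (intro mult_left_mono) auto
    then have "real n \<le> 1/4 * ((1/3)^n * ?a)" by (simp add: power_one_over)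
    ultimately show ?thesis using C[OF f[of n]] by linarith
  qed
  then show False by (meson not_le reals_Archimedean2)
qed

lemma limit_bounded_on_series_complete:
  assumes "subspace F" "K \<subseteq> F" "\<And>y. y \<in> K \<Longrightarrow> - y \<in> K" "series_complete F K"
    and lin: "\<And>n. linear_functional_on F (f n)"
    and bdd: "\<And>n. \<exists>C. \<forall>y\<in>K. \<bar>f n y\<bar> \<le> C"
    and lim: "\<And>x. x \<in> F \<Longrightarrow> (\<lambda>n. f n x) \<longlonglongrightarrow> g x"
  shows "\<exists>C. \<forall>y\<in>K. \<bar>g y\<bar> \<le> C"
proof -
  have "\<exists>C. \<forall>h\<in>range f. \<bar>h x\<bar> \<le> C" if "x \<in> F" for x
  proof -
    have "Bseq (\<lambda>n. f n x)" using lim[OF that] by (meson convergentI convergent_imp_Bseq)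
    then show ?thesis by (auto simp: Bseq_def)
  qed
  then have "\<exists>C. \<forall>h\<in>range f. \<forall>y\<in>K. \<bar>h y\<bar> \<le> C"
    using lin bdd by (intro uniform_boundedness_series_complete[OF assms(1-4)]) blast+
  then obtain C where C: "\<And>n y. y \<in> K \<Longrightarrow> \<bar>f n y\<bar> \<le> C" by blast
  have "\<bar>g y\<bar> \<le> C" if "y \<in> K" for y
    using lim[of y] that assms(2) C
    by (intro LIMSEQ_le_const2[OF tendsto_rabs[of "\<lambda>n. f n y"]]) auto
  then show ?thesis by blast
qed

lemma locally_convex_affine_openin:
  assumes T: "locally_convex_topology_on E T" and x: "x \<in> E" and W: "openin T W"
  shows "openin T {y \<in> E. a *\<^sub>R y + x \<in> W}"
proof -
  have top: "topspace T = E" using T by (simp add: locally_convex_topology_on_def)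
  have plus: "continuous_map (prod_topology T T) T (\<lambda>(x, y). x + y)"
    and scale: "continuous_map (prod_topology euclideanreal T) T (\<lambda>(a, x). a *\<^sub>R x)"
    using T by (auto simp: locally_convex_topology_on_def)
  have "continuous_map T T ((\<lambda>(a, x). a *\<^sub>R x) \<circ> (\<lambda>y. (a, y)))"
    by (rule continuous_map_compose[OF _ scale]) (simp add: continuous_map_pairedI)
  then have "continuous_map T (prod_topology T T) (\<lambda>y. (a *\<^sub>R y, x))"
    using x top by (intro continuous_map_pairedI) (auto simp: o_def)
  from continuous_map_compose[OF this plus] have "continuous_map T T (\<lambda>y. a *\<^sub>R y + x)"
    by (simp add: o_def)
  from openin_continuous_map_preimage[OF this W] show ?thesis by (simp add: top)
qed

lemma locally_convex_functional_continuous: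
  assumes T: "locally_convex_topology_on E T" and f: "linear_functional_on E f"
    and W: "openin T W" "0 \<in> W" and le: "\<And>z. z \<in> W \<Longrightarrow> \<bar>f z\<bar> \<le> c"
  shows "continuous_map T euclideanreal f"
proof -
  have top: "topspace T = E" and E: "subspace E"
    using T by (auto simp: locally_convex_topology_on_def)
  have "openin T {x \<in> E. f x \<in> U}" if "open U" for U
  proof (subst openin_subopen, intro ballI)
    fix x assume x: "x \<in> {x \<in> E. f x \<in> U}"
    then obtain d where d: "d > 0" "ball (f x) d \<subseteq> U" using \<open>open U\<close> by (auto simp: open_contains_ball)
    let ?s = "(\<bar>c\<bar> + 1) / d"
    have s: "?s > 0" using d by auto
    let ?N = "{y \<in> E. ?s *\<^sub>R y + - (?s *\<^sub>R x) \<in> W}"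
    have "openin T ?N"
      using x E W by (intro locally_convex_affine_openin[OF T]) (auto simp: subspace_neg subspace_scale)
    moreover have "f y \<in> U" if y: "y \<in> ?N" for y
    proof -
      have yx: "y - x \<in> E" using x y E by (auto simp: subspace_diff)
      have "?s *\<^sub>R y + - (?s *\<^sub>R x) = ?s *\<^sub>R (y - x)" by (simp add: algebra_simps)
      then have "\<bar>?s * f (y - x)\<bar> \<le> c"
        using le[of "?s *\<^sub>R (y - x)"] y linear_functional_onD(2)[OF f yx, of ?s] by auto
      then have "\<bar>f (y - x)\<bar> * ?s \<le> c" unfolding abs_mult using s by (simp only: abs_of_pos mult.commute)
      then have "\<bar>f (y - x)\<bar> * ?s < \<bar>c\<bar> + 1" by linarith
      then have "\<bar>f (y - x)\<bar> * (\<bar>c\<bar> + 1) < d * (\<bar>c\<bar> + 1)"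
        using d(1) by (simp add: pos_divide_less_eq mult.commute)
      then have "\<bar>f (y - x)\<bar> < d" by (simp add: mult_less_cancel_right)
      then have "\<bar>f y - f x\<bar> < d" using linear_functional_on_diff[OF E f, of y x] x y by auto
      then show ?thesis using d by (auto simp: dist_real_def subset_iff abs_minus_commute)
    qed
    ultimately show "\<exists>N. openin T N \<and> x \<in> N \<and> N \<subseteq> {x \<in> E. f x \<in> U}"
      using x W by (intro exI[of _ ?N]) auto
  qed
  then show ?thesis by (auto simp: continuous_map_def top)
qed

lemma locally_convex_absorbing:
  assumes T: "locally_convex_topology_on E T" and W: "openin T W" "0 \<in> W" and x: "x \<in> E"
  obtains t where "t > 0" "\<And>s. \<bar>s\<bar> \<le> t \<Longrightarrow> s *\<^sub>R x \<in> W"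
proof -
  have top: "topspace T = E" using T by (simp add: locally_convex_topology_on_def)
  have scale: "continuous_map (prod_topology euclideanreal T) T (\<lambda>(a, x). a *\<^sub>R x)"
    using T by (auto simp: locally_convex_topology_on_def)
  have "continuous_map euclideanreal (prod_topology euclideanreal T) (\<lambda>a. (a, x))"
    using x top by (intro continuous_map_pairedI) auto
  from continuous_map_compose[OF this scale] have "continuous_map euclideanreal T (\<lambda>a. a *\<^sub>R x)"
    by (simp add: o_def)
  from openin_continuous_map_preimage[OF this W(1)] have "open {a. a *\<^sub>R x \<in> W}" by simp
  moreover have "0 \<in> {a. a *\<^sub>R x \<in> W}" using W by simp
  ultimately obtain e where e: "e > 0" "ball 0 e \<subseteq> {a. a *\<^sub>R x \<in> W}"
    by (meson open_contains_ball)
  show ?thesis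
    by (rule that[of "e / 2"]) (use e in \<open>auto simp: subset_iff dist_real_def\<close>)
qed

definition gauge_of :: "'v::real_vector set \<Rightarrow> 'v \<Rightarrow> real"
  where "gauge_of C y = Inf {t. 0 < t \<and> inverse t *\<^sub>R y \<in> C}"

locale absorbing_convex =
  fixes E C :: "'v::real_vector set"
  assumes E: "subspace E" and CE: "C \<subseteq> E" and convex: "convex C"
    and absorbing: "\<And>x. x \<in> E \<Longrightarrow> \<exists>t>0. t *\<^sub>R x \<in> C" and zero: "0 \<in> C"
begin

lemma gauge_le: "0 < t \<Longrightarrow> inverse t *\<^sub>R y \<in> C \<Longrightarrow> gauge_of C y \<le> t"
  unfolding gauge_of_def by (rule cInf_lower) (auto intro: bdd_belowI[of _ 0])

lemma gauge_ge:
  assumes "y \<in> E" "\<And>t. 0 < t \<Longrightarrow> inverse t *\<^sub>R y \<in> C \<Longrightarrow> m \<le> t"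
  shows "m \<le> gauge_of C y"
proof -
  obtain t where "t > 0" "t *\<^sub>R y \<in> C" using absorbing[OF assms(1)] by blast
  then have "inverse t \<in> {t. 0 < t \<and> inverse t *\<^sub>R y \<in> C}" by simp
  then have "{t. 0 < t \<and> inverse t *\<^sub>R y \<in> C} \<noteq> {}" by blast
  then show ?thesis unfolding gauge_of_def using assms(2) by (intro cInf_greatest) auto
qed

lemma gauge_nonneg: "y \<in> E \<Longrightarrow> 0 \<le> gauge_of C y"
  by (rule gauge_ge) auto

lemma gauge_ge_1:
  assumes y: "y \<in> E" "y \<notin> C"
  shows "1 \<le> gauge_of C y"
proof (rule gauge_ge[OF y(1)], rule ccontr)
  fix t :: real assume t: "0 < t" "inverse t *\<^sub>R y \<in> C" "\<not> 1 \<le> t"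
  then have "t *\<^sub>R (inverse t *\<^sub>R y) + (1 - t) *\<^sub>R 0 \<in> C"
    using convex zero by (intro convexD) auto
  then show False using t y by simp
qed

lemma gauge_le_1: "y \<in> C \<Longrightarrow> gauge_of C y \<le> 1"
  by (rule gauge_le) auto

lemma gauge_sublinear: "sublinear_on E (gauge_of C)"
proof (rule sublinear_onI[OF E])
  have "gauge_of C 0 \<le> 0"
    by (rule field_le_epsilon) (use zero in \<open>auto intro: gauge_le\<close>)
  then show "gauge_of C 0 = 0" using gauge_nonneg[OF subspace_0[OF E]] by simp
next
  fix x y assume xy: "x \<in> E" "y \<in> E"
  have *: "gauge_of C (x + y) \<le> s + t"
    if s: "0 < s" "inverse s *\<^sub>R x \<in> C" and t: "0 < t" "inverse t *\<^sub>R y \<in> C" for s t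
  proof (rule gauge_le)
    have "(s / (s + t)) *\<^sub>R (inverse s *\<^sub>R x) + (t / (s + t)) *\<^sub>R (inverse t *\<^sub>R y) \<in> C"
      using convex s t by (intro convexD) (auto simp: add_divide_distrib[symmetric])
    also have "(s / (s + t)) *\<^sub>R (inverse s *\<^sub>R x) + (t / (s + t)) *\<^sub>R (inverse t *\<^sub>R y) =
        inverse (s + t) *\<^sub>R (x + y)"
    proof -
      have "(s / (s + t)) * inverse s = inverse (s + t)" "(t / (s + t)) * inverse t = inverse (s + t)"
        using s t by (auto simp: divide_simps)
      then show ?thesis by (simp only: scaleR_scaleR scaleR_add_right)
    qed
    finally show "inverse (s + t) *\<^sub>R (x + y) \<in> C" .
  qed (use s t in simp)
  have "gauge_of C (x + y) - s \<le> gauge_of C y" if "0 < s" "inverse s *\<^sub>R x \<in> C" for s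
    using *[OF that] by (intro gauge_ge[OF xy(2)]) (smt (verit))
  then have "gauge_of C (x + y) - gauge_of C y \<le> gauge_of C x"
    by (intro gauge_ge[OF xy(1)]) (smt (verit))
  then show "gauge_of C (x + y) \<le> gauge_of C x + gauge_of C y" by simp
next
  fix t :: real and x assume t: "0 < t" and x: "x \<in> E"
  have "gauge_of C (t *\<^sub>R x) / t \<le> gauge_of C x"
  proof (rule gauge_ge[OF x])
    fix s :: real assume s: "0 < s" "inverse s *\<^sub>R x \<in> C"
    have "inverse (t * s) * t = inverse s" using s t by simp
    then have "inverse (t * s) *\<^sub>R (t *\<^sub>R x) \<in> C" using s by (simp only: scaleR_scaleR)
    then have "gauge_of C (t *\<^sub>R x) \<le> t * s" using s t by (intro gauge_le) auto
    then show "gauge_of C (t *\<^sub>R x) / t \<le> s" using t by (simp add: field_simps)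
  qed
  then show "gauge_of C (t *\<^sub>R x) \<le> t * gauge_of C x" using t by (simp add: field_simps)
qed

lemma separating_functional:
  assumes y: "y \<in> E" "y \<notin> C"
  obtains f where "linear_functional_on E f" "1 \<le> f y" "\<And>x. x \<in> C \<Longrightarrow> f x \<le> 1"
proof -
  have le: "t * gauge_of C y \<le> gauge_of C (t *\<^sub>R y)" for t
  proof (cases "t \<ge> 0")
    case True
    then show ?thesis using sublinear_on_scale[OF gauge_sublinear y(1)] by simp
  next
    case False
    then have "t * gauge_of C y \<le> 0"
      using gauge_nonneg[OF y(1)] by (simp add: mult_nonpos_nonneg)
    also have "0 \<le> gauge_of C (t *\<^sub>R y)" using y(1) E by (intro gauge_nonneg) (auto simp: subspace_scale)
    finally show ?thesis .
  qed
  obtain f where "linear_functional_on E f" "\<And>x. x \<in> E \<Longrightarrow> f x \<le> gauge_of C x"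
    "\<And>t. t \<in> UNIV \<Longrightarrow> f (t *\<^sub>R y) = t * gauge_of C y"
    by (rule hahn_banach[OF E gauge_sublinear subspace_UNIV,
          of "\<lambda>t. t *\<^sub>R y" "\<lambda>t. t * gauge_of C y"])
      (use y E le in \<open>auto simp: subspace_scale algebra_simps linear_functional_on_def\<close>)
  then show ?thesis
    using that[of f] gauge_ge_1[OF y] gauge_le_1 CE
    by (metis UNIV_I mult_1 order_trans scaleR_one subsetD)
qed

end

lemma sum_third_powers: "(\<lambda>m. (1/3::real)^(m + n)) sums (3/2 * (1/3)^n)"
  using sums_mult2[OF geometric_sums[of "1/3::real"], of "(1/3)^n"] by (simp add: power_add)

text \<open>A functional bounded by \<open>1\<close> on \<open>C\<close> is continuous, so \<open>F\<close> contains the sums of all series that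
  converge uniformly on \<open>C\<close>.\<close>

lemma polar_series_complete:
  fixes b :: "'e::real_vector \<Rightarrow> 'w::real_vector \<Rightarrow> real"
  assumes E: "subspace E" and F: "subspace F"
    and lin_F: "\<And>x. x \<in> E \<Longrightarrow> linear_functional_on F (b x)"
    and lin_E: "\<And>w. w \<in> F \<Longrightarrow> linear_functional_on E (\<lambda>x. b x w)"
    and C: "C \<subseteq> E" "\<And>x. x \<in> E \<Longrightarrow> \<exists>t>0. t *\<^sub>R x \<in> C"
    and repr: "\<forall>f c. linear_functional_on E f \<and> (\<forall>z\<in>C. \<bar>f z\<bar> \<le> c) \<longrightarrow>
      (\<exists>w\<in>F. \<forall>x\<in>E. f x = b x w)"
  defines "K \<equiv> {w \<in> F. \<forall>z\<in>C. \<bar>b z w\<bar> \<le> 1}"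
  shows "series_complete F K" "\<And>x. x \<in> E \<Longrightarrow> \<exists>B. \<forall>w\<in>K. \<bar>b x w\<bar> \<le> B" "\<And>w. w \<in> K \<Longrightarrow> - w \<in> K"
proof -
  show bounded: "\<exists>B. \<forall>w\<in>K. \<bar>b x w\<bar> \<le> B" if x: "x \<in> E" for x
  proof -
    obtain t where t: "t > 0" "t *\<^sub>R x \<in> C" using C(2)[OF x] by blast
    have "\<bar>b x w\<bar> \<le> 1 / t" if w: "w \<in> K" for w
    proof -
      have "\<bar>t * b x w\<bar> \<le> 1"
        using w t(2) linear_functional_onD(2)[OF lin_E x, of w t] by (auto simp: K_def)
      then show ?thesis using t(1) by (simp add: abs_mult field_simps)
    qed
    then show ?thesis by blast
  qed
  show "- w \<in> K" if "w \<in> K" for w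
    using that linear_functional_on_minus[OF lin_F] C(1) F by (auto simp: K_def subspace_neg)
  show "series_complete F K"
    unfolding series_complete_def
  proof (intro allI impI)
    fix \<xi> :: "nat \<Rightarrow> 'w" assume \<xi>: "\<forall>n. \<xi> n \<in> K"
    have \<xi>F: "\<xi> n \<in> F" for n using \<xi> by (auto simp: K_def)
    have summ: "summable (\<lambda>m. (1/3)^m * b z (\<xi> m))" if z: "z \<in> E" for z
    proof -
      obtain B where B: "\<And>w. w \<in> K \<Longrightarrow> \<bar>b z w\<bar> \<le> B" using bounded[OF z] by blast
      have "summable (\<lambda>m. (1/3::real)^m * B)" by (intro summable_mult2 summable_geometric) simp
      then show ?thesis
        by (rule summable_comparison_test'[where N = 0]) (use B \<xi> in \<open>auto simp: abs_mult\<close>)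
    qed
    define f where "f z = (\<Sum>m. (1/3)^m * b z (\<xi> m))" for z
    have f: "linear_functional_on E f"
    proof (unfold linear_functional_on_def, intro conjI ballI allI)
      fix x y assume xy: "x \<in> E" "y \<in> E"
      have "f (x + y) = (\<Sum>m. (1/3)^m * b x (\<xi> m) + (1/3)^m * b y (\<xi> m))"
        unfolding f_def using linear_functional_onD(1)[OF lin_E[OF \<xi>F] xy]
        by (simp add: distrib_left)
      then show "f (x + y) = f x + f y" unfolding f_def by (simp add: suminf_add summ xy)
    next
      fix a x assume x: "x \<in> E"
      have "f (a *\<^sub>R x) = (\<Sum>m. a * ((1/3)^m * b x (\<xi> m)))"
        unfolding f_def using linear_functional_onD(2)[OF lin_E[OF \<xi>F] x]
        by (simp add: mult.left_commute)
      then show "f (a *\<^sub>R x) = a * f x" unfolding f_def by (simp add: suminf_mult summ x)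
    qed
    have tail: "\<bar>f z - (\<Sum>m<n. (1/3)^m * b z (\<xi> m))\<bar> \<le> 3/2 * (1/3)^n" if z: "z \<in> C" for z n
    proof -
      have zE: "z \<in> E" using z C(1) by blast
      have s: "summable (\<lambda>m. (1/3)^(m + n) * b z (\<xi> (m + n)))"
        using summable_ignore_initial_segment[OF summ[OF zE], of n] by simp
      have le: "\<bar>(1/3)^(m + n) * b z (\<xi> (m + n))\<bar> \<le> (1/3)^(m + n)" for m
        using \<xi> z by (auto simp: abs_mult K_def mult_left_le)
      have "f z - (\<Sum>m<n. (1/3)^m * b z (\<xi> m)) = (\<Sum>m. (1/3)^(m + n) * b z (\<xi> (m + n)))"
        unfolding f_def using suminf_minus_initial_segment[OF summ[OF zE], of n] by simp
      also have "\<bar>\<dots>\<bar> \<le> (\<Sum>m. (1/3)^(m + n))"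
        using le sums_summable[OF sum_third_powers[of n]] unfolding real_norm_def[symmetric] by (intro norm_suminf_le) auto
      finally show ?thesis using sums_unique[OF sum_third_powers[of n]] by simp
    qed
    obtain x where x: "x \<in> F" "\<And>z. z \<in> E \<Longrightarrow> f z = b z x"
    proof -
      have "\<forall>z\<in>C. \<bar>f z\<bar> \<le> 3/2" using tail[of _ 0] by simp
      then show ?thesis using repr f that by blast
    qed
    have "\<exists>y\<in>K. x - (\<Sum>m<n. (1/3)^m *\<^sub>R \<xi> m) = (3/2 * (1/3)^n) *\<^sub>R y" for n
    proof -
      let ?d = "x - (\<Sum>m<n. (1/3)^m *\<^sub>R \<xi> m)" and ?c = "3/2 * (1/3::real)^n"
      have sF: "(\<Sum>m<n. (1/3)^m *\<^sub>R \<xi> m) \<in> F" and dF: "?d \<in> F"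
        using x(1) \<xi>F F by (auto intro!: subspace_diff subspace_sum subspace_scale)
      have bd: "b z ?d = f z - (\<Sum>m<n. (1/3)^m * b z (\<xi> m))" if z: "z \<in> C" for z
      proof -
        have zE: "z \<in> E" using z C(1) by blast
        have "b z (\<Sum>m<n. (1/3)^m *\<^sub>R \<xi> m) = (\<Sum>m<n. (1/3)^m * b z (\<xi> m))"
          using linear_functional_onD(2)[OF lin_F[OF zE] \<xi>F] F \<xi>F
          by (subst linear_functional_on_sum[OF F lin_F[OF zE]]) (auto intro: subspace_scale)
        then show ?thesis
          using linear_functional_on_diff[OF F lin_F[OF zE] x(1) sF] x(2)[OF zE] by simp
      qed
      have "\<bar>b z (inverse ?c *\<^sub>R ?d)\<bar> \<le> 1" if z: "z \<in> C" for z
      proof -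
        have eq: "b z (inverse ?c *\<^sub>R ?d) = inverse ?c * b z ?d"
          using z C(1) linear_functional_onD(2)[OF lin_F dF] by blast
        have "\<bar>b z (inverse ?c *\<^sub>R ?d)\<bar> = inverse ?c * \<bar>b z ?d\<bar>"
          by (subst eq) (simp add: abs_mult)
        also have "\<dots> \<le> inverse ?c * ?c"
          using tail[OF z, of n] bd[OF z] by (intro mult_left_mono) auto
        finally show ?thesis by simp
      qed
      then have "inverse ?c *\<^sub>R ?d \<in> K" using dF F by (auto simp: K_def subspace_scale)
      moreover have "?d = ?c *\<^sub>R (inverse ?c *\<^sub>R ?d)" by simp
      ultimately show ?thesis by blast
    qed
    then show "\<exists>x\<in>F. \<forall>n. \<exists>y\<in>K. x - (\<Sum>m<n. (1/3)^m *\<^sub>R \<xi> m) = (3/2 * (1/3)^n) *\<^sub>R y"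
      using x(1) by blast
  qed
qed

definition sup_on :: "('e \<Rightarrow> 'w \<Rightarrow> real) \<Rightarrow> 'w set \<Rightarrow> 'e \<Rightarrow> real"
  where "sup_on b D x = Sup (insert 0 ((\<lambda>w. \<bar>b x w\<bar>) ` D))"

lemma sup_on_le: "0 \<le> m \<Longrightarrow> (\<And>w. w \<in> D \<Longrightarrow> \<bar>b x w\<bar> \<le> m) \<Longrightarrow> sup_on b D x \<le> m"
  unfolding sup_on_def by (rule cSup_least) auto

lemma sup_on_upper:
  assumes "\<exists>C. \<forall>w\<in>D. \<bar>b x w\<bar> \<le> C"
  shows "w \<in> D \<Longrightarrow> \<bar>b x w\<bar> \<le> sup_on b D x" "0 \<le> sup_on b D x"
proof -
  obtain C where C: "\<And>w. w \<in> D \<Longrightarrow> \<bar>b x w\<bar> \<le> C" using assms by blast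
  have "bdd_above (insert 0 ((\<lambda>w. \<bar>b x w\<bar>) ` D))"
    by (rule bdd_aboveI[of _ "max 0 C"]) (use C in \<open>auto simp: le_max_iff_disj\<close>)
  then show "w \<in> D \<Longrightarrow> \<bar>b x w\<bar> \<le> sup_on b D x" "0 \<le> sup_on b D x"
    unfolding sup_on_def by (auto intro: cSup_upper)
qed

lemma seminorm_on_sup_on:
  assumes "\<And>x. x \<in> E \<Longrightarrow> \<exists>C. \<forall>w\<in>D. \<bar>b x w\<bar> \<le> C" and E: "subspace E"
    and lin: "\<And>w. w \<in> D \<Longrightarrow> linear_functional_on E (\<lambda>x. b x w)"
  shows "seminorm_on E (sup_on b D)"
proof (unfold seminorm_on_def, intro conjI ballI allI)
  note up = sup_on_upper[where b = b and D = D, OF assms(1)]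
  fix x y assume xy: "x \<in> E" "y \<in> E"
  show "sup_on b D (x + y) \<le> sup_on b D x + sup_on b D y"
    using up[OF xy(1)] up[OF xy(2)] linear_functional_onD(1)[OF lin xy]
    by (intro sup_on_le) (auto intro: order_trans[OF abs_triangle_ineq] add_mono)
next
  note up = sup_on_upper[where b = b and D = D, OF assms(1)]
  fix a x assume x: "x \<in> E"
  have le: "sup_on b D (a *\<^sub>R x) \<le> \<bar>a\<bar> * sup_on b D x" if x: "x \<in> E" for a x
    using up[OF x] linear_functional_onD(2)[OF lin x]
    by (intro sup_on_le) (auto simp: abs_mult mult_left_mono)
  show "sup_on b D (a *\<^sub>R x) = \<bar>a\<bar> * sup_on b D x"
  proof (cases "a = 0")
    case True
    then show ?thesis using le[OF x, of 0] up(2)[OF subspace_0[OF E]] by simp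
  next
    case False
    have "sup_on b D (inverse a *\<^sub>R (a *\<^sub>R x)) \<le> \<bar>inverse a\<bar> * sup_on b D (a *\<^sub>R x)"
      using x E by (intro le) (auto simp: subspace_scale)
    then have "\<bar>a\<bar> * sup_on b D x \<le> sup_on b D (a *\<^sub>R x)"
      using False by (simp add: field_simps)
    then show ?thesis using le[OF x, of a] by simp
  qed
qed

theorem is_mackey_topology_sup_on:
  fixes b :: "'e::real_vector \<Rightarrow> 'w::real_vector \<Rightarrow> real"
  assumes E: "subspace E" and F: "subspace F"
    and lin_F: "\<And>x. x \<in> E \<Longrightarrow> linear_functional_on F (b x)"
    and lin_E: "\<And>w. w \<in> F \<Longrightarrow> linear_functional_on E (\<lambda>x. b x w)"
    and BF: "\<And>D. D \<in> \<B> \<Longrightarrow> D \<subseteq> F"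
    and bdd: "\<And>D x. D \<in> \<B> \<Longrightarrow> x \<in> E \<Longrightarrow> \<exists>C. \<forall>w\<in>D. \<bar>b x w\<bar> \<le> C"
    and single: "\<And>w. w \<in> F \<Longrightarrow> {w} \<in> \<B>"
    and union: "\<And>D D'. D \<in> \<B> \<Longrightarrow> D' \<in> \<B> \<Longrightarrow> D \<union> D' \<in> \<B>"
    and repr: "\<And>D f c. D \<in> \<B> \<Longrightarrow> linear_functional_on E f \<Longrightarrow> c \<ge> 0 \<Longrightarrow>
      (\<And>x. x \<in> E \<Longrightarrow> \<bar>f x\<bar> \<le> c * sup_on b D x) \<Longrightarrow> \<exists>w\<in>F. \<forall>x\<in>E. f x = b x w"
    and polar: "\<And>K. K \<subseteq> F \<Longrightarrow> (\<And>w. w \<in> K \<Longrightarrow> - w \<in> K) \<Longrightarrow>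
      (\<And>x. x \<in> E \<Longrightarrow> \<exists>C. \<forall>w\<in>K. \<bar>b x w\<bar> \<le> C) \<Longrightarrow> series_complete F K \<Longrightarrow> K \<in> \<B>"
  shows "seminorm_family E (sup_on b ` \<B>)"
    and "is_mackey_topology E F b (seminorm_topology E (sup_on b ` \<B>))"
proof -
  have semi: "seminorm_on E (sup_on b D)" if "D \<in> \<B>" for D
    using BF[OF that] by (intro seminorm_on_sup_on E lin_E bdd that) auto
  show fam: "seminorm_family E (sup_on b ` \<B>)"
    using E semi single[OF subspace_0[OF F]] by unfold_locales auto
  interpret seminorm_family E "sup_on b ` \<B>" by (rule fam)
  have directed: "\<exists>D\<in>\<B>. \<forall>q\<in>Fs. \<forall>x\<in>E. q x \<le> sup_on b D x"
    if "finite Fs" "Fs \<subseteq> sup_on b ` \<B>" for Fs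
    using that
  proof induction
    case empty
    then show ?case using single[OF subspace_0[OF F]] by blast
  next
    case (insert q Fs)
    then obtain D where D: "D \<in> \<B>" "\<And>q x. q \<in> Fs \<Longrightarrow> x \<in> E \<Longrightarrow> q x \<le> sup_on b D x" by blast
    obtain D' where D': "D' \<in> \<B>" "q = sup_on b D'" using insert by blast
    note U = union[OF D(1) D'(1)]
    have "sup_on b D x \<le> sup_on b (D \<union> D') x" "sup_on b D' x \<le> sup_on b (D \<union> D') x" if "x \<in> E" for x
      using sup_on_upper[where b = b and x = x, OF bdd[OF U that]] by (auto intro!: sup_on_le)
    then have "q' x \<le> sup_on b (D \<union> D') x" if "q' \<in> insert q Fs" "x \<in> E" for q' x
      using D(2)[of q' x] D'(2) that by fastforce
    then show ?case using U by blast
  qed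
  have dual: "continuous_dual T = (\<lambda>w. functional_on E (\<lambda>x. b x w)) ` F"
  proof (intro equalityI subsetI)
    fix f assume "f \<in> continuous_dual T"
    then have f: "linear_functional_on E f" "continuous_map T euclideanreal f" "\<And>x. x \<notin> E \<Longrightarrow> f x = 0"
      by (auto simp: continuous_dual_def topspace_eq)
    obtain Fs c where Fs: "Fs \<subseteq> sup_on b ` \<B>" "finite Fs" "0 \<le> c"
      "\<And>x. x \<in> E \<Longrightarrow> \<bar>f x\<bar> \<le> c * (\<Sum>q\<in>Fs. q x)"
      using continuous_functional_bound[OF f(1,2)] by blast
    obtain D where D: "D \<in> \<B>" "\<And>q x. q \<in> Fs \<Longrightarrow> x \<in> E \<Longrightarrow> q x \<le> sup_on b D x"
      using directed[OF Fs(2,1)] by blast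
    have "\<bar>f x\<bar> \<le> (c * real (card Fs)) * sup_on b D x" if x: "x \<in> E" for x
    proof -
      have "(\<Sum>q\<in>Fs. q x) \<le> real (card Fs) * sup_on b D x"
        using D(2) x by (intro sum_bounded_above) auto
      then have "c * (\<Sum>q\<in>Fs. q x) \<le> c * (real (card Fs) * sup_on b D x)"
        using Fs(3) by (rule mult_left_mono)
      then show ?thesis using Fs(4)[OF x] by (simp add: mult.assoc)
    qed
    then obtain w where "w \<in> F" "\<And>x. x \<in> E \<Longrightarrow> f x = b x w"
      using repr[OF D(1) f(1), of "c * real (card Fs)"] Fs(3) by auto
    then show "f \<in> (\<lambda>w. functional_on E (\<lambda>x. b x w)) ` F"
      using f(3) by (intro image_eqI[of _ _ w]) (auto simp: functional_on_def)
  next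
    fix f assume "f \<in> (\<lambda>w. functional_on E (\<lambda>x. b x w)) ` F"
    then obtain w where w: "w \<in> F" "f = functional_on E (\<lambda>x. b x w)" by blast
    have lin: "linear_functional_on E f"
      using lin_E[OF w(1)] E by (auto simp: w(2) functional_on_def linear_functional_on_def
        subspace_add subspace_scale)
    moreover have "continuous_map T euclideanreal f"
    proof (rule continuous_functionalI[OF lin])
      show "sup_on b {w} \<in> sup_on b ` \<B>" using single[OF w(1)] by blast
      show "\<bar>f x\<bar> \<le> 1 * sup_on b {w} x" if "x \<in> E" for x
        using sup_on_upper(1)[of "{w}" b x w] that by (auto simp: w(2) functional_on_def)
    qed
    ultimately show "f \<in> continuous_dual T"
      by (simp add: continuous_dual_def topspace_eq w(2) functional_on_def)
  qed
  have finest: "openin T V" if T': "compatible_topology E F b T'" and V: "openin T' V" for T' V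
  proof -
    have lc: "locally_convex_topology_on E T'"
      and dual': "continuous_dual T' = (\<lambda>w. functional_on E (\<lambda>x. b x w)) ` F"
      using T' by (auto simp: compatible_topology_def)
    have top: "topspace T' = E" using lc by (simp add: locally_convex_topology_on_def)
    have nbhds: "\<exists>W C. openin T' W \<and> 0 \<in> W \<and> W \<subseteq> C \<and> C \<subseteq> V \<and> convex C"
      if "openin T' V" "0 \<in> V" for V
      using lc that by (simp add: locally_convex_topology_on_def)
    have VE: "V \<subseteq> E" using openin_subset[OF V] top by simp
    have "\<exists>Fs e. Fs \<subseteq> sup_on b ` \<B> \<and> finite Fs \<and> 0 < e \<and> seminorm_ball E Fs x e \<subseteq> V"
      if x: "x \<in> V" for x
    proof -
      have xE: "x \<in> E" using x VE by blast
      have N: "openin T' {y \<in> E. 1 *\<^sub>R y + x \<in> V}"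
        by (rule locally_convex_affine_openin[OF lc xE V])
      have "0 \<in> {y \<in> E. 1 *\<^sub>R y + x \<in> V}" using x E by (simp add: subspace_0)
      from nbhds[OF N this] obtain W C where W: "openin T' W" "0 \<in> W" and WC: "W \<subseteq> C"
        and CN: "C \<subseteq> {y \<in> E. 1 *\<^sub>R y + x \<in> V}" and C: "convex C"
        by blast
      define C' where "C' = C \<inter> uminus ` C"
      define W' where "W' = W \<inter> {y \<in> E. (-1) *\<^sub>R y + 0 \<in> W}"
      have W': "openin T' W'" "0 \<in> W'"
        unfolding W'_def
        using W locally_convex_affine_openin[OF lc subspace_0[OF E] W(1), of "-1"] E
        by (auto simp: subspace_0)
      have W'C': "W' \<subseteq> C'"
      proof
        fix y assume "y \<in> W'"
        then have "y \<in> C" "- y \<in> C" using WC by (auto simp: W'_def)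
        then show "y \<in> C'" unfolding C'_def by (metis IntI image_eqI minus_minus)
      qed
      have C'_sym: "- y \<in> C'" if "y \<in> C'" for y using that by (auto simp: C'_def)
      have C': "convex C'" unfolding C'_def by (intro convex_Int convex_negations C)
      have C'E: "C' \<subseteq> E" using CN by (auto simp: C'_def)
      have absorb: "\<exists>t>0. t *\<^sub>R y \<in> C'" if "y \<in> E" for y
      proof -
        obtain t where "t > 0" "\<And>s. \<bar>s\<bar> \<le> t \<Longrightarrow> s *\<^sub>R y \<in> W'"
          by (rule locally_convex_absorbing[OF lc W' \<open>y \<in> E\<close>]) blast
        then have "t > 0" "t *\<^sub>R y \<in> C'" using W'C' by auto
        then show ?thesis by blast
      qed
      interpret A: absorbing_convex E C'
        using E C'E absorb W' W'C' C'
        by unfold_locales auto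
      have repr': "\<exists>w\<in>F. \<forall>x\<in>E. f x = b x w"
        if f: "linear_functional_on E f" and le: "\<forall>z\<in>C'. \<bar>f z\<bar> \<le> c" for f c
      proof -
        have "continuous_map T' euclideanreal f"
          using le W'C' by (intro locally_convex_functional_continuous[OF lc f W']) auto
        then have "continuous_map T' euclideanreal (functional_on E f)"
          by (rule continuous_map_eq) (simp add: functional_on_def top)
        moreover have "linear_functional_on E (functional_on E f)"
          using f E by (auto simp: functional_on_def linear_functional_on_def
            subspace_add subspace_scale)
        ultimately have "functional_on E f \<in> continuous_dual T'"
          by (simp add: continuous_dual_def top functional_on_def)
        then obtain w where "w \<in> F" "functional_on E f = functional_on E (\<lambda>x. b x w)"
          unfolding dual' by blast
        then show ?thesis unfolding functional_on_def by metis
      qed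
      have repr'': "\<forall>f c. linear_functional_on E f \<and> (\<forall>z\<in>C'. \<bar>f z\<bar> \<le> c) \<longrightarrow>
          (\<exists>w\<in>F. \<forall>x\<in>E. f x = b x w)"
        using repr' by blast
      define K where "K = {w \<in> F. \<forall>z\<in>C'. \<bar>b z w\<bar> \<le> 1}"
      have K: "series_complete F K" "\<And>x. x \<in> E \<Longrightarrow> \<exists>B. \<forall>w\<in>K. \<bar>b x w\<bar> \<le> B" "\<And>w. w \<in> K \<Longrightarrow> - w \<in> K"
        by (rule polar_series_complete[OF E F lin_F lin_E C'E absorb repr'', folded K_def]; assumption)+
      have KB: "K \<in> \<B>"
        using K by (intro polar) (auto simp: K_def)
      have "y \<in> V" if y: "y \<in> seminorm_ball E {sup_on b K} x 1" for y
      proof (rule ccontr)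
        assume "y \<notin> V"
        moreover have "1 *\<^sub>R (y - x) + x = y" by simp
        moreover have "C' \<subseteq> {y \<in> E. 1 *\<^sub>R y + x \<in> V}" using CN by (auto simp: C'_def)
        ultimately have nC: "y - x \<notin> C'" by force
        have yE: "y \<in> E" and "sup_on b K (y - x) < 1"
          using y by (auto simp: seminorm_ball_def)
        have yx: "y - x \<in> E" using yE xE E by (simp add: subspace_diff)
        obtain f where f: "linear_functional_on E f" "1 \<le> f (y - x)" "\<And>z. z \<in> C' \<Longrightarrow> f z \<le> 1"
          using A.separating_functional[OF yx nC] by blast
        have "\<bar>f z\<bar> \<le> 1" if "z \<in> C'" for z
          using f(3)[OF that] f(3)[OF C'_sym[OF that]] linear_functional_on_minus[OF f(1), of z] that C'E
          by auto
        then have le: "\<forall>z\<in>C'. \<bar>f z\<bar> \<le> 1" by blast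
        obtain w where w: "w \<in> F" "\<And>z. z \<in> E \<Longrightarrow> f z = b z w" using repr'[OF f(1) le] by blast
        have "\<bar>b z w\<bar> \<le> 1" if "z \<in> C'" for z using bspec[OF le that] w(2)[OF subsetD[OF C'E that]] by simp
        then have "w \<in> K" using w(1) by (auto simp: K_def)
        then have "1 \<le> sup_on b K (y - x)"
          using sup_on_upper(1)[where b = b, OF K(2)[OF yx], of w] f(2) w(2)[OF yx] by linarith
        then show False using \<open>sup_on b K (y - x) < 1\<close> by simp
      qed
      then show ?thesis using KB by (intro exI[of _ "{sup_on b K}"] exI[of _ 1]) auto
    qed
    then show ?thesis using VE openin_iff by auto
  qed
  show "is_mackey_topology E F b T"
    using locally_convex dual finest
    by (simp add: is_mackey_topology_def compatible_topology_def)
qed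

section \<open>Calculus in a chart\<close>

lemma openin_Euclidean_space_cube:
  assumes "openin (Euclidean_space n) S" "y \<in> S"
  obtains \<delta> where "\<delta> > 0" "\<And>z. \<lbrakk>\<And>i. i \<ge> n \<Longrightarrow> z i = 0; \<And>i. i < n \<Longrightarrow> \<bar>z i - y i\<bar> < \<delta>\<rbrakk> \<Longrightarrow> z \<in> S"
proof -
  obtain T where T: "openin (powertop_real UNIV) T" "S = T \<inter> {x. \<forall>i\<ge>n. x i = 0}"
    using assms(1) by (auto simp: Euclidean_space_def openin_subtopology)
  then obtain U where U: "\<And>i. open (U i)" "y \<in> Pi\<^sub>E UNIV U" "Pi\<^sub>E UNIV U \<subseteq> T"
    using assms(2) by (auto simp: openin_product_topology_alt) metis
  have "\<exists>d>0. ball (y i) d \<subseteq> U i" for i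
    using U(1)[of i] U(2) by (auto simp: open_contains_ball PiE_iff)
  then obtain d where d: "\<And>i. d i > 0" "\<And>i. ball (y i) (d i) \<subseteq> U i" by metis
  define \<delta> where "\<delta> = Min (insert 1 (d ` {..<n}))"
  have y0: "y i = 0" if "i \<ge> n" for i using assms(2) T(2) that by simp
  show ?thesis
  proof (rule that[of \<delta>])
    show "\<delta> > 0" using d(1) by (auto simp: \<delta>_def)
    fix z :: "nat \<Rightarrow> real"
    assume z: "\<And>i. i \<ge> n \<Longrightarrow> z i = 0" "\<And>i. i < n \<Longrightarrow> \<bar>z i - y i\<bar> < \<delta>"
    have "z i \<in> U i" for i
    proof (cases "i < n")
      case True
      then have "\<delta> \<le> d i" unfolding \<delta>_def by (intro Min_le) auto
      then have "z i \<in> ball (y i) (d i)"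
        using z(2)[OF True] by (auto simp: dist_real_def abs_minus_commute)
      then show ?thesis using d(2) by blast
    next
      case False
      then show ?thesis using z(1) y0 U(2) by (metis PiE_mem UNIV_I not_less)
    qed
    then have "z \<in> T" using U(3) by (auto simp: PiE_iff subset_iff)
    then show "z \<in> S" using T(2) z(1) by simp
  qed
qed

abbreviation chart_line :: "'m chart \<Rightarrow> nat \<Rightarrow> 'm \<Rightarrow> real \<Rightarrow> 'm"
  where "chart_line c j p t \<equiv> chart_inv c ((coord c p)(j := t))"

abbreviation chart_differentiable :: "'m chart \<Rightarrow> nat \<Rightarrow> ('m \<Rightarrow> real) \<Rightarrow> 'm \<Rightarrow> bool"
  where "chart_differentiable c j f p \<equiv> (\<lambda>t. f (chart_line c j p t)) differentiable at (coord c p j)"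

lemma chart_differentiable_iff:
  "chart_differentiable c j f p \<longleftrightarrow>
    ((\<lambda>t. f (chart_line c j p t)) has_real_derivative chart_partial c j f p) (at (coord c p j))"
  by (simp add: chart_partial_def DERIV_deriv_iff_real_differentiable)

lemma chart_partialI:
  "((\<lambda>t. f (chart_line c j p t)) has_real_derivative D) (at (coord c p j)) \<Longrightarrow> chart_partial c j f p = D"
  unfolding chart_partial_def by (rule DERIV_imp_deriv)

lemma chart_differentiableI:
  "((\<lambda>t. f (chart_line c j p t)) has_real_derivative D) (at (coord c p j)) \<Longrightarrow> chart_differentiable c j f p"
  by (auto simp: real_differentiable_def)

locale chart_domain =
  fixes X :: "'m topology" and n :: nat and c :: "'m chart" and W :: "'m set"
  assumes chart: "is_chart X n c" and W: "openin X W" and W_dom: "W \<subseteq> dom_of c"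
begin

lemma homeo: "homeomorphic_map (subtopology X (dom_of c))
    (subtopology (Euclidean_space n) (coord c ` dom_of c)) (coord c)"
  and open_image: "openin (Euclidean_space n) (coord c ` dom_of c)"
  and open_dom: "openin X (dom_of c)"
  using chart by (auto simp: is_chart_def)

lemma inj: "inj_on (coord c) (dom_of c)"
  using homeomorphic_imp_injective_map[OF homeo] open_dom openin_subset
  by (metis topspace_subtopology_subset)

lemma chart_inv_coord: "p \<in> dom_of c \<Longrightarrow> chart_inv c (coord c p) = p"
  unfolding chart_inv_def using inj by simp

lemma coord_outside: "p \<in> dom_of c \<Longrightarrow> n \<le> i \<Longrightarrow> coord c p i = 0"
  using openin_subset[OF open_image] by (auto simp: topspace_Euclidean_space)

lemma cube:
  assumes p: "p \<in> W"
  obtains \<delta> where "\<delta> > 0" "\<And>z. \<lbrakk>\<And>i. i \<ge> n \<Longrightarrow> z i = 0; \<And>i. i < n \<Longrightarrow> \<bar>z i - coord c p i\<bar> < \<delta>\<rbrakk> \<Longrightarrow>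
    chart_inv c z \<in> W \<and> coord c (chart_inv c z) = z"
proof -
  have "openin (subtopology X (dom_of c)) W"
    using W W_dom by (simp add: openin_open_subtopology[OF open_dom])
  then have "openin (subtopology (Euclidean_space n) (coord c ` dom_of c)) (coord c ` W)"
    using homeomorphic_imp_open_map[OF homeo] by (simp add: open_map_def)
  then have "openin (Euclidean_space n) (coord c ` W)"
    by (simp add: openin_open_subtopology[OF open_image])
  then obtain \<delta> where \<delta>: "\<delta> > 0"
    "\<And>z. \<lbrakk>\<And>i. i \<ge> n \<Longrightarrow> z i = 0; \<And>i. i < n \<Longrightarrow> \<bar>z i - coord c p i\<bar> < \<delta>\<rbrakk> \<Longrightarrow> z \<in> coord c ` W"
    using openin_Euclidean_space_cube[of n "coord c ` W" "coord c p"] imageI[OF p] by metis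
  show ?thesis
  proof (rule that[OF \<delta>(1)])
    fix z :: "nat \<Rightarrow> real"
    assume "\<And>i. i \<ge> n \<Longrightarrow> z i = 0" "\<And>i. i < n \<Longrightarrow> \<bar>z i - coord c p i\<bar> < \<delta>"
    then have "z \<in> coord c ` W" by (rule \<delta>(2))
    then show "chart_inv c z \<in> W \<and> coord c (chart_inv c z) = z"
      using chart_inv_coord W_dom by auto
  qed
qed

lemma continuous_coord:
  assumes "i < n"
  shows "continuous_map (subtopology X W) euclideanreal (\<lambda>q. coord c q i)"
proof -
  have "continuous_map (subtopology X (dom_of c)) (Euclidean_space n) (coord c)"
    using homeomorphic_imp_continuous_map[OF homeo] by (simp add: continuous_map_in_subtopology)
  then have "continuous_map (subtopology X W) (Euclidean_space n) (coord c)"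
    using W_dom continuous_map_from_subtopology_mono by blast
  then show ?thesis
    by (auto simp: Euclidean_space_def continuous_map_in_subtopology continuous_map_componentwise_UNIV)
qed

lemma openin_box:
  "openin X {q \<in> W. \<forall>i<n. \<bar>coord c q i - a i\<bar> < \<delta>}"
proof -
  have "openin X {q \<in> W. \<forall>i\<in>{..<m}. \<bar>coord c q i - a i\<bar> < \<delta>}" if "m \<le> n" for m
    using that
  proof (induction m)
    case (Suc m)
    have "openin (subtopology X W) {q \<in> topspace (subtopology X W). coord c q m \<in> ball (a m) \<delta>}"
      using Suc by (intro openin_continuous_map_preimage[OF continuous_coord]) auto
    then have "openin X {q \<in> topspace (subtopology X W). coord c q m \<in> ball (a m) \<delta>}"
      by (simp add: openin_open_subtopology[OF W])
    also have "{q \<in> topspace (subtopology X W). coord c q m \<in> ball (a m) \<delta>} =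
        {q \<in> W. \<bar>coord c q m - a m\<bar> < \<delta>}"
      using openin_subset[OF W] by (auto simp: dist_real_def abs_minus_commute)
    finally have "openin X ({q \<in> W. \<bar>coord c q m - a m\<bar> < \<delta>} \<inter> {q \<in> W. \<forall>i\<in>{..<m}. \<bar>coord c q i - a i\<bar> < \<delta>})"
      using Suc by (intro openin_Int) auto
    also have "{q \<in> W. \<bar>coord c q m - a m\<bar> < \<delta>} \<inter> {q \<in> W. \<forall>i\<in>{..<m}. \<bar>coord c q i - a i\<bar> < \<delta>} =
        {q \<in> W. \<forall>i\<in>{..<Suc m}. \<bar>coord c q i - a i\<bar> < \<delta>}"
      by (auto simp: less_Suc_eq)
    finally show ?case .
  qed (use W in simp)
  from this[of n] show ?thesis by (simp add: Ball_def)
qed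

lemma chart_line_nhds:
  assumes p: "p \<in> W" and j: "j < n"
  shows "\<forall>\<^sub>F t in nhds (coord c p j). chart_line c j p t \<in> W \<and>
    coord c (chart_line c j p t) = (coord c p)(j := t)"
proof -
  obtain \<delta> where \<delta>: "\<delta> > 0" "\<And>z. \<lbrakk>\<And>i. i \<ge> n \<Longrightarrow> z i = 0; \<And>i. i < n \<Longrightarrow> \<bar>z i - coord c p i\<bar> < \<delta>\<rbrakk> \<Longrightarrow>
      chart_inv c z \<in> W \<and> coord c (chart_inv c z) = z"
    using cube[OF p] by blast
  have "chart_line c j p t \<in> W \<and> coord c (chart_line c j p t) = (coord c p)(j := t)"
    if "dist t (coord c p j) < \<delta>" for t
    using that j \<delta>(1) coord_outside[of p] p W_dom by (intro \<delta>(2)) (auto simp: dist_real_def)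
  then show ?thesis using \<delta>(1) by (auto simp: eventually_nhds_metric)
qed

lemma chart_line_same: "p \<in> W \<Longrightarrow> chart_line c j p (coord c p j) = p"
  using chart_inv_coord W_dom by auto

lemma nhds_cong:
  assumes "p \<in> W" "j < n" and eq: "\<And>q. q \<in> W \<Longrightarrow> f q = g q"
  shows "\<forall>\<^sub>F t in nhds (coord c p j). f (chart_line c j p t) = g (chart_line c j p t)"
  using chart_line_nhds[OF assms(1,2)] by (rule eventually_mono) (simp add: eq)

lemma chart_partial_cong:
  assumes "p \<in> W" "j < n" "\<And>q. q \<in> W \<Longrightarrow> f q = g q"
  shows "chart_partial c j f p = chart_partial c j g p"
    and "chart_differentiable c j f p \<longleftrightarrow> chart_differentiable c j g p"
proof -
  have ev: "\<forall>\<^sub>F t in nhds (coord c p j). f (chart_line c j p t) = g (chart_line c j p t)"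
    using assms by (rule nhds_cong)
  show "chart_partial c j f p = chart_partial c j g p"
    unfolding chart_partial_def by (rule deriv_cong_ev[OF ev refl])
  show "chart_differentiable c j f p \<longleftrightarrow> chart_differentiable c j g p"
    unfolding real_differentiable_def using DERIV_cong_ev[OF refl ev refl] by simp
qed

lemma chart_partial_add:
  assumes "chart_differentiable c j f p" "chart_differentiable c j g p"
  shows "chart_differentiable c j (\<lambda>q. f q + g q) p"
    and "chart_partial c j (\<lambda>q. f q + g q) p = chart_partial c j f p + chart_partial c j g p"
proof -
  have "((\<lambda>t. f (chart_line c j p t) + g (chart_line c j p t)) has_real_derivative
      chart_partial c j f p + chart_partial c j g p) (at (coord c p j))"
    using DERIV_add[OF assms[unfolded chart_differentiable_iff]] .
  then show "chart_differentiable c j (\<lambda>q. f q + g q) p"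
    "chart_partial c j (\<lambda>q. f q + g q) p = chart_partial c j f p + chart_partial c j g p"
    by (rule chart_differentiableI, rule chart_partialI)
qed

lemma chart_partial_mult:
  assumes "chart_differentiable c j f p" "chart_differentiable c j g p" "p \<in> W"
  shows "chart_differentiable c j (\<lambda>q. f q * g q) p"
    and "chart_partial c j (\<lambda>q. f q * g q) p = chart_partial c j f p * g p + f p * chart_partial c j g p"
proof -
  have "((\<lambda>t. f (chart_line c j p t) * g (chart_line c j p t)) has_real_derivative
      chart_partial c j f p * g p + f p * chart_partial c j g p) (at (coord c p j))"
    using DERIV_mult[OF assms(1,2)[unfolded chart_differentiable_iff]] chart_line_same[OF assms(3)]
    by (simp add: ac_simps)
  then show "chart_differentiable c j (\<lambda>q. f q * g q) p"
    "chart_partial c j (\<lambda>q. f q * g q) p = chart_partial c j f p * g p + f p * chart_partial c j g p"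
    by (rule chart_differentiableI, rule chart_partialI)
qed

lemma chart_partial_inverse:
  assumes "chart_differentiable c j f p" "p \<in> W" "f p \<noteq> 0"
  shows "chart_differentiable c j (\<lambda>q. inverse (f q)) p"
    and "chart_partial c j (\<lambda>q. inverse (f q)) p =
      - 1 * (chart_partial c j f p * (inverse (f p) * inverse (f p)))"
proof -
  have "((\<lambda>t. inverse (f (chart_line c j p t))) has_real_derivative
      - 1 * (chart_partial c j f p * (inverse (f p) * inverse (f p)))) (at (coord c p j))"
    using DERIV_inverse'[OF assms(1)[unfolded chart_differentiable_iff]] chart_line_same[OF assms(2)]
      assms(3) by (simp add: ac_simps)
  then show "chart_differentiable c j (\<lambda>q. inverse (f q)) p"
    "chart_partial c j (\<lambda>q. inverse (f q)) p =
      - 1 * (chart_partial c j f p * (inverse (f p) * inverse (f p)))"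
    by (rule chart_differentiableI, rule chart_partialI)
qed

lemma chart_partial_const:
  "chart_differentiable c j (\<lambda>q. k) p" "chart_partial c j (\<lambda>q. k) p = 0"
  using chart_partialI[where f = "\<lambda>q. k" and c = c and j = j and p = p and D = 0] by auto

lemma chart_partial_coord:
  assumes "p \<in> W" "j < n"
  shows "chart_partial c j (\<lambda>q. coord c q i) p = (if i = j then 1 else 0)"
proof -
  have "\<forall>\<^sub>F t in nhds (coord c p j). coord c (chart_line c j p t) i = (if i = j then t else coord c p i)"
    using chart_line_nhds[OF assms] by (rule eventually_mono) auto
  moreover have "((\<lambda>t. if i = j then t else coord c p i) has_real_derivative
      (if i = j then 1 else 0)) (at (coord c p j))" by auto
  ultimately show ?thesis
    by (intro chart_partialI) (simp add: DERIV_cong_ev)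
qed

text \<open>The mean value theorem, used along the \<open>n\<close> edges of a path parallel to the axes.\<close>

lemma cube_mean_value:
  assumes cube: "\<And>z. \<lbrakk>\<And>i. i \<ge> n \<Longrightarrow> z i = 0; \<And>i. i < n \<Longrightarrow> \<bar>z i - coord c p i\<bar> < \<delta>\<rbrakk> \<Longrightarrow>
      chart_inv c z \<in> W \<and> coord c (chart_inv c z) = z"
    and diff: "\<And>j q. j < n \<Longrightarrow> q \<in> W \<Longrightarrow> chart_differentiable c j f q"
    and near: "\<And>j q. j < n \<Longrightarrow> q \<in> W \<Longrightarrow> (\<And>i. i < n \<Longrightarrow> \<bar>coord c q i - coord c p i\<bar> < \<delta>) \<Longrightarrow>
      \<bar>chart_partial c j f q - a j\<bar> \<le> \<epsilon>"
    and p: "p \<in> W" and q: "q \<in> W" "\<And>i. i < n \<Longrightarrow> \<bar>coord c q i - coord c p i\<bar> < \<delta>"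
  shows "\<bar>f q - f p - (\<Sum>j<n. a j * (coord c q j - coord c p j))\<bar> \<le>
    \<epsilon> * (\<Sum>j<n. \<bar>coord c q j - coord c p j\<bar>)"
proof -
  let ?x = "coord c p" and ?y = "coord c q"
  define z where "z m i = (if i < m then ?y i else ?x i)" for m i
  have out: "?x i = 0" "?y i = 0" if "i \<ge> n" for i
    using coord_outside that p q W_dom by auto
  define h where "h m = f (chart_inv c (z m))" for m
  have step: "\<bar>h (Suc m) - h m - a m * (?y m - ?x m)\<bar> \<le> \<epsilon> * \<bar>?y m - ?x m\<bar>" if m: "m < n" for m
  proof -
    let ?g = "\<lambda>t. f (chart_inv c ((z m)(m := t))) - a m * t"
    let ?S = "closed_segment (?x m) (?y m)"
    let ?q = "\<lambda>t. chart_inv c ((z m)(m := t))"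
    have inq: "?q t \<in> W \<and> coord c (?q t) = (z m)(m := t)" and
      nearq: "\<And>i. i < n \<Longrightarrow> \<bar>coord c (?q t) i - ?x i\<bar> < \<delta>" if t: "t \<in> ?S" for t
    proof -
      have tm: "\<bar>t - ?x m\<bar> < \<delta>"
        using t q(2)[OF m] by (auto simp: closed_segment_eq_real_ivl split: if_splits)
      have lt: "\<bar>((z m)(m := t)) i - ?x i\<bar> < \<delta>" if "i < n" for i
        using tm q(2)[OF that] by (auto simp: z_def)
      show 1: "?q t \<in> W \<and> coord c (?q t) = (z m)(m := t)"
        using lt out m by (intro cube) (auto simp: z_def)
      show "\<bar>coord c (?q t) i - ?x i\<bar> < \<delta>" if "i < n" for i
        using 1 lt[OF that] by simp
    qed
    have "norm (?g (?y m) - ?g (?x m)) \<le> \<epsilon> * norm (?y m - ?x m)"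
    proof (rule field_differentiable_bound[where S = ?S])
      fix t assume t: "t \<in> ?S"
      have "chart_differentiable c m f (?q t)" using diff[OF m] inq[OF t] by blast
      then have "((\<lambda>s. f (chart_line c m (?q t) s)) has_real_derivative chart_partial c m f (?q t))
          (at (coord c (?q t) m))"
        by (simp only: chart_differentiable_iff)
      then have "((\<lambda>s. f (chart_inv c ((z m)(m := s)))) has_real_derivative chart_partial c m f (?q t)) (at t)"
        using inq[OF t] by simp
      then have "(?g has_real_derivative chart_partial c m f (?q t) - a m) (at t)"
        by (auto intro!: derivative_eq_intros)
      then show "(?g has_real_derivative chart_partial c m f (?q t) - a m) (at t within ?S)"
        by (rule has_field_derivative_at_within)
      show "norm (chart_partial c m f (?q t) - a m) \<le> \<epsilon>"
        using near[OF m, of "?q t"] inq[OF t] nearq[OF t] by simp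
    qed auto
    moreover have "(z m)(m := ?y m) = z (Suc m)" "(z m)(m := ?x m) = z m"
      by (auto simp: z_def fun_eq_iff less_Suc_eq)
    ultimately show ?thesis by (simp add: h_def algebra_simps)
  qed
  have "z 0 = ?x" "z n = ?y" using out by (auto simp: z_def fun_eq_iff not_less)
  then have "h 0 = f p" "h n = f q" using chart_inv_coord p q W_dom by (auto simp: h_def)
  then have "f q - f p - (\<Sum>j<n. a j * (?y j - ?x j)) = (\<Sum>m<n. h (Suc m) - h m - a m * (?y m - ?x m))"
    using sum_lessThan_telescope[of h n] by (simp add: sum_subtractf)
  also have "\<bar>\<dots>\<bar> \<le> (\<Sum>m<n. \<epsilon> * \<bar>?y m - ?x m\<bar>)"
    using step by (intro order_trans[OF sum_abs] sum_mono) auto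
  finally show ?thesis by (simp add: sum_distrib_left)
qed

end

lemma chart_partials_append: "chart_partials c (js @ [j]) f = chart_partials c js (chart_partial c j f)"
  by (induction js) auto

context chart_domain
begin

lemma topspace_W: "topspace (subtopology X W) = W"
  using openin_subset[OF W] by auto

lemma box_subset_open:
  assumes "openin X N" "p \<in> N" "p \<in> W"
  obtains \<delta> where "\<delta> > 0" "\<And>q. q \<in> W \<Longrightarrow> (\<And>i. i < n \<Longrightarrow> \<bar>coord c q i - coord c p i\<bar> < \<delta>) \<Longrightarrow> q \<in> N"
proof -
  interpret N: chart_domain X n c "N \<inter> W"
    using chart W W_dom assms(1) by unfold_locales auto
  obtain \<delta> where \<delta>: "\<delta> > 0" "\<And>z. \<lbrakk>\<And>i. i \<ge> n \<Longrightarrow> z i = 0; \<And>i. i < n \<Longrightarrow> \<bar>z i - coord c p i\<bar> < \<delta>\<rbrakk> \<Longrightarrow>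
      chart_inv c z \<in> N \<inter> W \<and> coord c (chart_inv c z) = z"
    using N.cube[of p] assms by blast
  show ?thesis
  proof (rule that[OF \<delta>(1)])
    fix q assume q: "q \<in> W" "\<And>i. i < n \<Longrightarrow> \<bar>coord c q i - coord c p i\<bar> < \<delta>"
    have "chart_inv c (coord c q) \<in> N \<inter> W"
      using \<delta>(2)[of "coord c q"] q coord_outside[of q] W_dom by auto
    then show "q \<in> N" using chart_inv_coord q W_dom by auto
  qed
qed

definition locally_bounded :: "'i set \<Rightarrow> ('i \<Rightarrow> 'm \<Rightarrow> real) \<Rightarrow> bool"
  where "locally_bounded D F \<longleftrightarrow>
    (\<forall>p\<in>W. \<exists>N B. openin X N \<and> p \<in> N \<and> (\<forall>d\<in>D. \<forall>q\<in>N \<inter> W. \<bar>F d q\<bar> \<le> B))"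

definition C0_family :: "'i set \<Rightarrow> ('i \<Rightarrow> 'm \<Rightarrow> real) \<Rightarrow> bool"
  where "C0_family D F \<longleftrightarrow>
    (\<forall>d\<in>D. continuous_map (subtopology X W) euclideanreal (F d)) \<and> locally_bounded D F"

text \<open>Functions indexed by \<open>D\<close> of class \<open>C\<^sup>r\<close> on \<open>W\<close>, with partial derivatives bounded locally uniformly
  in \<open>W\<close> and uniformly in \<open>D\<close>.\<close>

primrec Cr_family :: "nat \<Rightarrow> 'i set \<Rightarrow> ('i \<Rightarrow> 'm \<Rightarrow> real) \<Rightarrow> bool"
  where
    "Cr_family 0 D F \<longleftrightarrow> C0_family D F"
  | "Cr_family (Suc r) D F \<longleftrightarrow> C0_family D F \<and>
      (\<forall>j<n. (\<forall>d\<in>D. \<forall>p\<in>W. chart_differentiable c j (F d) p) \<and> Cr_family r D (\<lambda>d. chart_partial c j (F d)))"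

lemma C0_family_if_Cr: "Cr_family r D F \<Longrightarrow> C0_family D F"
  by (cases r) auto

lemma Cr_family_SucD: "Cr_family (Suc r) D F \<Longrightarrow> Cr_family r D F"
  by (induction r arbitrary: F) auto

lemma C0_family_cong:
  assumes "C0_family D F" "\<And>d p. d \<in> D \<Longrightarrow> p \<in> W \<Longrightarrow> F d p = G d p"
  shows "C0_family D G"
proof -
  have "continuous_map (subtopology X W) euclideanreal (G d)" if "d \<in> D" for d
  proof (rule continuous_map_eq)
    show "continuous_map (subtopology X W) euclideanreal (F d)"
      using assms(1) that by (simp add: C0_family_def)
    show "F d p = G d p" if "p \<in> topspace (subtopology X W)" for p
      using assms(2)[OF \<open>d \<in> D\<close>] that by (simp only: topspace_W)
  qed
  moreover have "locally_bounded D G"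
    unfolding locally_bounded_def
  proof
    fix p assume "p \<in> W"
    then obtain N B where "openin X N" "p \<in> N" "\<forall>d\<in>D. \<forall>q\<in>N \<inter> W. \<bar>F d q\<bar> \<le> B"
      using assms(1) unfolding C0_family_def locally_bounded_def by blast
    then show "\<exists>N B. openin X N \<and> p \<in> N \<and> (\<forall>d\<in>D. \<forall>q\<in>N \<inter> W. \<bar>G d q\<bar> \<le> B)"
      using assms(2) by (intro exI[of _ N] exI[of _ B]) auto
  qed
  ultimately show ?thesis by (simp add: C0_family_def)
qed

lemma Cr_family_cong:
  assumes "Cr_family r D F" "\<And>d p. d \<in> D \<Longrightarrow> p \<in> W \<Longrightarrow> F d p = G d p"
  shows "Cr_family r D G"
  using assms
proof (induction r arbitrary: F G)
  case 0
  then show ?case using C0_family_cong[of D F G] by simp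
next
  case (Suc r)
  have "(\<forall>d\<in>D. \<forall>p\<in>W. chart_differentiable c j (G d) p) \<and> Cr_family r D (\<lambda>d. chart_partial c j (G d))"
    if j: "j < n" for j
  proof
    have eq: "F d q = G d q" if "d \<in> D" "q \<in> W" for d q using Suc.prems(2) that .
    show "\<forall>d\<in>D. \<forall>p\<in>W. chart_differentiable c j (G d) p"
    proof (intro ballI)
      fix d p assume "d \<in> D" "p \<in> W"
      then show "chart_differentiable c j (G d) p"
        using Suc.prems(1) j chart_partial_cong(2)[OF \<open>p \<in> W\<close> j, of "F d" "G d"] eq by simp
    qed
    show "Cr_family r D (\<lambda>d. chart_partial c j (G d))"
    proof (rule Suc.IH)
      show "Cr_family r D (\<lambda>d. chart_partial c j (F d))" using Suc.prems(1) j by simp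
      show "chart_partial c j (F d) p = chart_partial c j (G d) p" if "d \<in> D" "p \<in> W" for d p
        using chart_partial_cong(1)[OF that(2) j] eq that(1) by blast
    qed
  qed
  then show ?case using C0_family_cong[of D F G] Suc.prems by simp
qed

lemma C0_family_reindex:
  assumes "C0_family D F" and h: "\<And>d. d \<in> D' \<Longrightarrow> h d \<in> D"
  shows "C0_family D' (\<lambda>d. F (h d))"
  unfolding C0_family_def locally_bounded_def
proof (intro conjI ballI)
  fix p assume "p \<in> W"
  then obtain N B where "openin X N" "p \<in> N" "\<forall>d\<in>D. \<forall>q\<in>N \<inter> W. \<bar>F d q\<bar> \<le> B"
    using assms(1) unfolding C0_family_def locally_bounded_def by blast
  then show "\<exists>N B. openin X N \<and> p \<in> N \<and> (\<forall>d\<in>D'. \<forall>q\<in>N \<inter> W. \<bar>F (h d) q\<bar> \<le> B)"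
    using h by blast
qed (use assms in \<open>simp add: C0_family_def\<close>)

lemma Cr_family_reindex:
  assumes "Cr_family r D F" "\<And>d. d \<in> D' \<Longrightarrow> h d \<in> D"
  shows "Cr_family r D' (\<lambda>d. F (h d))"
  using assms
proof (induction r arbitrary: F)
  case 0
  then show ?case by (simp add: C0_family_reindex)
next
  case (Suc r)
  have "Cr_family r D' (\<lambda>d. chart_partial c j (F (h d)))" if "j < n" for j
    using Suc.IH[of "\<lambda>d. chart_partial c j (F d)"] Suc.prems that by simp
  moreover have "C0_family D' (\<lambda>d. F (h d))"
    by (rule C0_family_reindex[of D F D' h]) (use Suc.prems in simp_all)
  ultimately show ?case using Suc.prems by simp
qed

lemma locally_bounded_binary:
  assumes "locally_bounded D F" "locally_bounded D G"
    and H: "\<And>d q A B. d \<in> D \<Longrightarrow> q \<in> W \<Longrightarrow> \<bar>F d q\<bar> \<le> A \<Longrightarrow> \<bar>G d q\<bar> \<le> B \<Longrightarrow> \<bar>H d q\<bar> \<le> h A B"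
  shows "locally_bounded D H"
  unfolding locally_bounded_def
proof
  fix p assume p: "p \<in> W"
  obtain N A where N: "openin X N" "p \<in> N" "\<forall>d\<in>D. \<forall>q\<in>N \<inter> W. \<bar>F d q\<bar> \<le> A"
    using assms(1) p unfolding locally_bounded_def by blast
  obtain N' B where N': "openin X N'" "p \<in> N'" "\<forall>d\<in>D. \<forall>q\<in>N' \<inter> W. \<bar>G d q\<bar> \<le> B"
    using assms(2) p unfolding locally_bounded_def by blast
  have "\<bar>H d q\<bar> \<le> h A B" if "d \<in> D" "q \<in> N \<inter> N' \<inter> W" for d q
    using that N(3) N'(3) by (intro H) auto
  then show "\<exists>N B. openin X N \<and> p \<in> N \<and> (\<forall>d\<in>D. \<forall>q\<in>N \<inter> W. \<bar>H d q\<bar> \<le> B)"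
    using N N' by (intro exI[of _ "N \<inter> N'"] exI[of _ "h A B"]) auto
qed

lemma C0_family_add:
  assumes "C0_family D F" "C0_family D G"
  shows "C0_family D (\<lambda>d p. F d p + G d p)"
proof -
  have "locally_bounded D (\<lambda>d p. F d p + G d p)"
  proof (rule locally_bounded_binary[of D F G _ "\<lambda>a b. a + b"])
    show "\<bar>F d q + G d q\<bar> \<le> A + B" if "\<bar>F d q\<bar> \<le> A" "\<bar>G d q\<bar> \<le> B" for d q A B
      using that by linarith
  qed (use assms in \<open>auto simp: C0_family_def\<close>)
  then show ?thesis using assms by (auto simp: C0_family_def intro: continuous_map_add)
qed

lemma C0_family_mult:
  assumes "C0_family D F" "C0_family D G"
  shows "C0_family D (\<lambda>d p. F d p * G d p)"
proof -
  have "locally_bounded D (\<lambda>d p. F d p * G d p)"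
  proof (rule locally_bounded_binary[of D F G _ "\<lambda>a b. a * b"])
    show "\<bar>F d q * G d q\<bar> \<le> A * B" if "\<bar>F d q\<bar> \<le> A" "\<bar>G d q\<bar> \<le> B" for d q A B
      unfolding abs_mult using that by (intro mult_mono) auto
  qed (use assms in \<open>auto simp: C0_family_def\<close>)
  then show ?thesis using assms by (auto simp: C0_family_def intro: continuous_map_real_mult)
qed

lemma Cr_family_add:
  assumes "Cr_family r D F" "Cr_family r D G"
  shows "Cr_family r D (\<lambda>d p. F d p + G d p)"
  using assms
proof (induction r arbitrary: F G)
  case (Suc r)
  have "(\<forall>d\<in>D. \<forall>p\<in>W. chart_differentiable c j (\<lambda>p. F d p + G d p) p) \<and>
      Cr_family r D (\<lambda>d. chart_partial c j (\<lambda>p. F d p + G d p))" if j: "j < n" for j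
  proof
    have diff: "chart_differentiable c j (F d) p" "chart_differentiable c j (G d) p"
      if "d \<in> D" "p \<in> W" for d p using Suc.prems that j by auto
    show "\<forall>d\<in>D. \<forall>p\<in>W. chart_differentiable c j (\<lambda>p. F d p + G d p) p"
      using chart_partial_add(1)[OF diff] by blast
    have "Cr_family r D (\<lambda>d p. chart_partial c j (F d) p + chart_partial c j (G d) p)"
      using Suc.prems j by (intro Suc.IH) auto
    then show "Cr_family r D (\<lambda>d. chart_partial c j (\<lambda>p. F d p + G d p))"
      by (rule Cr_family_cong) (simp add: chart_partial_add(2)[OF diff])
  qed
  then show ?case using Suc.prems by (simp add: C0_family_add)
qed (simp add: C0_family_add)

lemma Cr_family_mult:
  assumes "Cr_family r D F" "Cr_family r D G"
  shows "Cr_family r D (\<lambda>d p. F d p * G d p)"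
  using assms
proof (induction r arbitrary: F G)
  case (Suc r)
  have "(\<forall>d\<in>D. \<forall>p\<in>W. chart_differentiable c j (\<lambda>p. F d p * G d p) p) \<and>
      Cr_family r D (\<lambda>d. chart_partial c j (\<lambda>p. F d p * G d p))" if j: "j < n" for j
  proof
    have diff: "chart_differentiable c j (F d) p" "chart_differentiable c j (G d) p"
      if "d \<in> D" "p \<in> W" for d p using Suc.prems that j by auto
    show "\<forall>d\<in>D. \<forall>p\<in>W. chart_differentiable c j (\<lambda>p. F d p * G d p) p"
      using chart_partial_mult(1)[OF diff] by blast
    have "Cr_family r D (\<lambda>d p. chart_partial c j (F d) p * G d p + F d p * chart_partial c j (G d) p)"
      using Suc.prems j Cr_family_SucD[OF Suc.prems(1)] Cr_family_SucD[OF Suc.prems(2)]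
      by (intro Cr_family_add Suc.IH) auto
    then show "Cr_family r D (\<lambda>d. chart_partial c j (\<lambda>p. F d p * G d p))"
      by (rule Cr_family_cong) (simp add: chart_partial_mult(2)[OF diff])
  qed
  then show ?case using Suc.prems by (simp add: C0_family_mult)
qed (simp add: C0_family_mult)

lemma C0_family_const: "C0_family D (\<lambda>d p. k)"
proof -
  have "locally_bounded D (\<lambda>d p. k)"
    unfolding locally_bounded_def using W by blast
  then show ?thesis by (simp add: C0_family_def)
qed

lemma Cr_family_const: "Cr_family r D (\<lambda>d p. k)"
proof (induction r arbitrary: k)
  case 0
  show ?case by (simp add: C0_family_const)
next
  case (Suc r)
  have "Cr_family r D (\<lambda>d. chart_partial c j (\<lambda>p. k))" for j
    by (rule Cr_family_cong[OF Suc[of 0]]) (simp add: chart_partial_const)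
  then show ?case by (simp add: chart_partial_const C0_family_const)
qed

lemma Cr_family_cmult: "Cr_family r D F \<Longrightarrow> Cr_family r D (\<lambda>d p. k * F d p)"
  by (rule Cr_family_mult[OF Cr_family_const])

lemma Cr_family_diff:
  assumes "Cr_family r D F" "Cr_family r D G"
  shows "Cr_family r D (\<lambda>d p. F d p - G d p)"
  using Cr_family_add[OF assms(1) Cr_family_cmult[OF assms(2), of "-1"]] by simp

lemma Cr_family_sum:
  "(\<And>i. i \<in> A \<Longrightarrow> Cr_family r D (\<lambda>d. F i d)) \<Longrightarrow> Cr_family r D (\<lambda>d p. \<Sum>i\<in>A. F i d p)"
  by (induction A rule: infinite_finite_induct) (auto simp: Cr_family_const Cr_family_add)

definition smooth :: "('m \<Rightarrow> real) \<Rightarrow> bool"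
  where "smooth f \<longleftrightarrow> (\<forall>r. Cr_family r {()} (\<lambda>_. f))"

lemma C0_family_single:
  "C0_family {()} (\<lambda>_. f) \<longleftrightarrow> continuous_map (subtopology X W) euclideanreal f"
proof -
  have "locally_bounded {()} (\<lambda>_. f)" if f: "continuous_map (subtopology X W) euclideanreal f"
    unfolding locally_bounded_def
  proof
    fix p assume p: "p \<in> W"
    let ?N = "{q \<in> W. f q \<in> ball (f p) 1}"
    have "openin (subtopology X W) {q \<in> topspace (subtopology X W). f q \<in> ball (f p) 1}"
      by (intro openin_continuous_map_preimage[OF f]) auto
    then have "openin X ?N"
      unfolding openin_open_subtopology[OF W] topspace_W by blast
    moreover have "\<bar>f q\<bar> \<le> \<bar>f p\<bar> + 1" if "q \<in> ?N" for q using that by (auto simp: dist_real_def)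
    ultimately show "\<exists>N B. openin X N \<and> p \<in> N \<and> (\<forall>d\<in>{()}. \<forall>q\<in>N \<inter> W. \<bar>f q\<bar> \<le> B)"
      using p by (intro exI[of _ ?N] exI[of _ "\<bar>f p\<bar> + 1"]) simp
  qed
  then show ?thesis by (auto simp: C0_family_def)
qed

lemma chart_Cr_Suc:
  "chart_Cr X n c (Suc r) W f \<longleftrightarrow> continuous_map (subtopology X W) euclideanreal f \<and>
    (\<forall>j<n. (\<forall>p\<in>W. chart_differentiable c j f p) \<and> chart_Cr X n c r W (chart_partial c j f))"
  (is "?L \<longleftrightarrow> ?R")
proof
  assume L: ?L
  have c1: "continuous_map (subtopology X W) euclideanreal (chart_partials c js f)"
    if "set js \<subseteq> {..<n}" "length js \<le> Suc r" for js
    using L that by (auto simp: chart_Cr_def)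
  have d1: "chart_differentiable c j (chart_partials c js f) p"
    if "set js \<subseteq> {..<n}" "length js < Suc r" "j < n" "p \<in> W" for js j p
    using L that unfolding chart_Cr_def by blast
  show ?R
  proof (intro conjI allI impI)
    show "continuous_map (subtopology X W) euclideanreal f" using c1[of "[]"] by simp
  next
    fix j assume j: "j < n"
    show "\<forall>p\<in>W. chart_differentiable c j f p" using d1[of "[]"] j by simp
    show "chart_Cr X n c r W (chart_partial c j f)"
      unfolding chart_Cr_def
      using c1[of "js @ [j]" for js] d1[of "js @ [j]" for js] j by (simp add: chart_partials_append)
  qed
next
  assume R: ?R
  have r: "chart_Cr X n c r W (chart_partial c j f)" if "j < n" for j using R that by blast
  show ?L
    unfolding chart_Cr_def
  proof (intro conjI allI impI ballI)
    fix js assume js: "set js \<subseteq> {..<n} \<and> length js \<le> Suc r"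
    show "continuous_map (subtopology X W) euclideanreal (chart_partials c js f)"
    proof (cases js rule: rev_cases)
      case (snoc js' i)
      then show ?thesis using r[of i] js by (simp add: chart_Cr_def chart_partials_append)
    qed (use R in simp)
  next
    fix js j p assume js: "set js \<subseteq> {..<n} \<and> length js < Suc r" and jp: "j < n" "p \<in> W"
    show "chart_differentiable c j (chart_partials c js f) p"
    proof (cases js rule: rev_cases)
      case (snoc js' i)
      then show ?thesis using r[of i] js jp by (simp add: chart_Cr_def chart_partials_append)
    qed (use R jp in simp)
  qed
qed

lemma chart_Cr_iff: "chart_Cr X n c r W f \<longleftrightarrow> Cr_family r {()} (\<lambda>_. f)"
proof (induction r arbitrary: f)
  case 0
  show ?case by (simp add: chart_Cr_def C0_family_single)
next
  case (Suc r)
  show ?case unfolding chart_Cr_Suc by (simp add: Suc C0_family_single)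
qed

lemma smooth_iff: "smooth f \<longleftrightarrow> (\<forall>r. chart_Cr X n c r W f)"
  by (simp add: smooth_def chart_Cr_iff)

lemma smooth_family: "smooth f \<Longrightarrow> Cr_family r D (\<lambda>_. f)"
  using Cr_family_reindex[of r "{()}" "\<lambda>_. f" D "\<lambda>_. ()"] by (auto simp: smooth_def)

lemma smooth_cong: "smooth f \<Longrightarrow> (\<And>p. p \<in> W \<Longrightarrow> f p = g p) \<Longrightarrow> smooth g"
  unfolding smooth_def by (blast intro: Cr_family_cong[of _ "{()}" "\<lambda>_. f" "\<lambda>_. g"])

lemma smooth_const: "smooth (\<lambda>p. k)"
  by (simp add: smooth_def Cr_family_const)

lemma smooth_add: "smooth f \<Longrightarrow> smooth g \<Longrightarrow> smooth (\<lambda>p. f p + g p)"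
  by (simp add: smooth_def Cr_family_add)

lemma smooth_diff: "smooth f \<Longrightarrow> smooth g \<Longrightarrow> smooth (\<lambda>p. f p - g p)"
  by (simp add: smooth_def Cr_family_diff)

lemma smooth_mult: "smooth f \<Longrightarrow> smooth g \<Longrightarrow> smooth (\<lambda>p. f p * g p)"
  by (simp add: smooth_def Cr_family_mult)

lemma smooth_sum: "(\<And>i. i \<in> A \<Longrightarrow> smooth (f i)) \<Longrightarrow> smooth (\<lambda>p. \<Sum>i\<in>A. f i p)"
  by (simp add: smooth_def Cr_family_sum)

lemma smooth_continuous: "smooth f \<Longrightarrow> continuous_map (subtopology X W) euclideanreal f"
  using C0_family_if_Cr C0_family_single unfolding smooth_def by blast

lemma smooth_differentiable: "smooth f \<Longrightarrow> j < n \<Longrightarrow> p \<in> W \<Longrightarrow> chart_differentiable c j f p"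
  unfolding smooth_def by (drule spec[of _ "Suc 0"]) simp

lemma smooth_partial: "smooth f \<Longrightarrow> j < n \<Longrightarrow> smooth (chart_partial c j f)"
proof -
  assume "smooth f" "j < n"
  then have "Cr_family (Suc r) {()} (\<lambda>_. f)" for r by (simp add: smooth_def)
  then show ?thesis using \<open>j < n\<close> by (simp add: smooth_def)
qed

lemma smooth_inverse:
  assumes f: "smooth f" and nz: "\<And>p. p \<in> W \<Longrightarrow> f p \<noteq> 0"
  shows "smooth (\<lambda>p. inverse (f p))"
proof -
  have C0: "C0_family {()} (\<lambda>_ p. inverse (f p))"
    unfolding C0_family_single using smooth_continuous[OF f] nz
    by (intro continuous_map_real_inverse) (auto simp: topspace_W)
  have "Cr_family r {()} (\<lambda>_ p. inverse (f p))" for r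
  proof (induction r)
    case (Suc r)
    have "Cr_family r {()} (\<lambda>_. chart_partial c j (\<lambda>p. inverse (f p)))" if j: "j < n" for j
    proof -
      have "Cr_family r {()} (\<lambda>_ p. - 1 * (chart_partial c j f p * (inverse (f p) * inverse (f p))))"
        using Suc smooth_partial[OF f j]
        by (intro Cr_family_mult Cr_family_const) (auto simp: smooth_def)
      then show ?thesis
        by (rule Cr_family_cong)
          (simp add: chart_partial_inverse(2)[OF smooth_differentiable[OF f j]] nz)
    qed
    then show ?case
      using C0 chart_partial_inverse(1)[OF smooth_differentiable[OF f]] nz by simp
  qed (use C0 in simp)
  then show ?thesis by (simp add: smooth_def)
qed

end

section \<open>Inverse metrics\<close>

definition quadratic_form :: "nat \<Rightarrow> (nat \<Rightarrow> nat \<Rightarrow> real) \<Rightarrow> (nat \<Rightarrow> real) \<Rightarrow> (nat \<Rightarrow> real) \<Rightarrow> real"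
  where "quadratic_form m G v w = (\<Sum>i<m. \<Sum>j<m. G i j * v i * w j)"

definition positive_definite :: "nat \<Rightarrow> (nat \<Rightarrow> nat \<Rightarrow> real) \<Rightarrow> bool"
  where "positive_definite m G \<longleftrightarrow> (\<forall>v. (\<exists>i<m. v i \<noteq> 0) \<longrightarrow> 0 < quadratic_form m G v v)"

definition left_inverse :: "nat \<Rightarrow> (nat \<Rightarrow> nat \<Rightarrow> real) \<Rightarrow> (nat \<Rightarrow> nat \<Rightarrow> real) \<Rightarrow> bool"
  where "left_inverse m H G \<longleftrightarrow> (\<forall>i<m. \<forall>k<m. (\<Sum>j<m. H i j * G j k) = (if i = k then 1 else 0))"

lemma positive_definite_left_kernel:
  assumes G: "positive_definite m G" and y: "\<And>k. k < m \<Longrightarrow> (\<Sum>j<m. y j * G j k) = 0" and i: "i < m"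
  shows "y i = 0"
proof (rule ccontr)
  assume "y i \<noteq> 0"
  then have "0 < quadratic_form m G y y" using G i by (auto simp: positive_definite_def)
  also have "quadratic_form m G y y = (\<Sum>k<m. (\<Sum>j<m. y j * G j k) * y k)"
    unfolding quadratic_form_def by (subst sum.swap) (simp add: sum_distrib_left sum_distrib_right mult_ac)
  also have "\<dots> = 0" using y by simp
  finally show False by simp
qed

lemma left_inverse_unique:
  assumes "positive_definite m G" "left_inverse m H G" "left_inverse m H' G" "i < m" "j < m"
  shows "H i j = H' i j"
proof -
  have "(\<lambda>j. H i j - H' i j) j = 0"
    by (rule positive_definite_left_kernel[OF assms(1) _ assms(5)])
      (use assms in \<open>simp add: left_inverse_def left_diff_distrib sum_subtractf\<close>)
  then show ?thesis by simp
qed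

definition schur_complement :: "nat \<Rightarrow> (nat \<Rightarrow> nat \<Rightarrow> real) \<Rightarrow> nat \<Rightarrow> nat \<Rightarrow> real"
  where "schur_complement m G i j = G i j - G i m * G m j * inverse (G m m)"

lemma positive_definite_diag: "positive_definite (Suc m) G \<Longrightarrow> 0 < G m m"
  unfolding positive_definite_def
  by (drule spec[of _ "\<lambda>i. if i = m then 1 else 0"])
    (auto simp: quadratic_form_def if_distrib[of "\<lambda>x. _ * x"] cong: if_cong)

lemma quadratic_form_Suc:
  "quadratic_form (Suc m) G v v = quadratic_form m G v v + (\<Sum>i<m. G i m * v i) * v m +
    (\<Sum>j<m. G m j * v j) * v m + G m m * v m * v m"
proof -
  have "(\<Sum>i<m. G i m * v i) * v m = (\<Sum>i<m. G i m * v i * v m)"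
    "(\<Sum>j<m. G m j * v j) * v m = (\<Sum>j<m. G m j * v m * v j)"
    by (simp_all add: sum_distrib_right mult.assoc mult.commute[of "v m"])
  then show ?thesis by (simp add: quadratic_form_def sum.distrib)
qed

lemma positive_definite_schur:
  assumes G: "positive_definite (Suc m) G"
  shows "positive_definite m (schur_complement m G)"
  unfolding positive_definite_def
proof (intro allI impI)
  fix v :: "nat \<Rightarrow> real" assume v: "\<exists>i<m. v i \<noteq> 0"
  have d: "0 < G m m" using G by (rule positive_definite_diag)
  let ?b = "\<Sum>i<m. G i m * v i" and ?c = "\<Sum>j<m. G m j * v j"
  let ?w = "v(m := - ?c / G m m)"
  have "quadratic_form m (schur_complement m G) v v =
      quadratic_form m G v v - (\<Sum>i<m. \<Sum>j<m. (G i m * v i) * (G m j * v j)) * inverse (G m m)"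
    by (simp add: quadratic_form_def schur_complement_def sum_distrib_right left_diff_distrib
      right_diff_distrib sum_subtractf sum_distrib_left mult_ac)
  also have "(\<Sum>i<m. \<Sum>j<m. (G i m * v i) * (G m j * v j)) = ?b * ?c"
    by (simp add: sum_product)
  also have "quadratic_form m G v v - ?b * ?c * inverse (G m m) = quadratic_form (Suc m) G ?w ?w"
  proof -
    have "quadratic_form m G ?w ?w = quadratic_form m G v v" by (simp add: quadratic_form_def)
    then show ?thesis unfolding quadratic_form_Suc using d by (simp add: field_simps)
  qed
  also have "\<dots> > 0"
  proof -
    obtain i where "i < m" "v i \<noteq> 0" using v by blast
    then have "i < Suc m \<and> ?w i \<noteq> 0" by auto
    then show ?thesis using G unfolding positive_definite_def by blast
  qed
  finally show "0 < quadratic_form m (schur_complement m G) v v" .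
qed

text \<open>Block inversion: given a left inverse \<open>K\<close> of the Schur complement of the last diagonal entry.\<close>

definition extend_inverse :: "nat \<Rightarrow> (nat \<Rightarrow> nat \<Rightarrow> real) \<Rightarrow> (nat \<Rightarrow> nat \<Rightarrow> real) \<Rightarrow> nat \<Rightarrow> nat \<Rightarrow> real"
  where "extend_inverse m G K =
    (let R = (\<lambda>i j. if j = m then - 1 * ((\<Sum>l<m. K i l * G l m) * inverse (G m m)) else K i j)
     in (\<lambda>i j. if i = m then ((if j = m then 1 else 0) - (\<Sum>l<m. G m l * R l j)) * inverse (G m m)
       else R i j))"

lemma left_inverse_extend:
  assumes d: "G m m \<noteq> 0" and K: "left_inverse m K (schur_complement m G)"
  shows "left_inverse (Suc m) (extend_inverse m G K) G"
proof -
  define R where "R i j = (if j = m then - 1 * ((\<Sum>l<m. K i l * G l m) * inverse (G m m)) else K i j)" for i j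
  have R: "(\<Sum>j<Suc m. R i j * G j k) = (if i = k then 1 else 0)" if i: "i < m" and k: "k < Suc m" for i k
  proof (cases "k = m")
    case True
    then show ?thesis using d i by (simp add: R_def)
  next
    case False
    have "(\<Sum>j<Suc m. R i j * G j k) = (\<Sum>j<m. K i j * G j k) -
        (\<Sum>l<m. K i l * G l m) * inverse (G m m) * G m k"
      by (simp add: R_def)
    also have "\<dots> = (\<Sum>j<m. K i j * schur_complement m G j k)"
      by (simp add: schur_complement_def right_diff_distrib sum_subtractf sum_distrib_left sum_distrib_right mult_ac)
    finally show ?thesis using K i k False by (simp add: left_inverse_def)
  qed
  let ?H = "extend_inverse m G K"
  have H: "?H i j = (if i = m then ((if j = m then 1 else 0) - (\<Sum>l<m. G m l * R l j)) * inverse (G m m)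
      else R i j)" for i j
    by (simp add: extend_inverse_def R_def)
  have "(\<Sum>j<Suc m. ?H m j * G j k) = (if m = k then 1 else 0)" if k: "k < Suc m" for k
  proof -
    have "(\<Sum>j<Suc m. ?H m j * G j k) =
        (\<Sum>j<Suc m. ((if j = m then G j k else 0) - (\<Sum>l<m. G m l * (R l j * G j k)))) * inverse (G m m)"
      unfolding H sum_distrib_right
      by (intro sum.cong)
        (auto simp: left_diff_distrib right_diff_distrib sum_distrib_left sum_distrib_right mult_ac)
    also have "(\<Sum>j<Suc m. ((if j = m then G j k else 0) - (\<Sum>l<m. G m l * (R l j * G j k)))) =
        G m k - (\<Sum>j<Suc m. \<Sum>l<m. G m l * (R l j * G j k))"
      unfolding sum_subtractf by simp
    also have "(\<Sum>j<Suc m. \<Sum>l<m. G m l * (R l j * G j k)) = (\<Sum>l<m. G m l * (\<Sum>j<Suc m. R l j * G j k))"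
      unfolding sum_distrib_left by (rule sum.swap)
    also have "\<dots> = (\<Sum>l<m. G m l * (if l = k then 1 else 0))"
      using R k by (intro sum.cong) auto
    also have "\<dots> = (if k < m then G m k else 0)"
      by (simp add: if_distrib[of "\<lambda>x. _ * x"] cong: if_cong)
    finally show ?thesis using d k by (auto simp: less_Suc_eq)
  qed
  moreover have "(\<Sum>j<Suc m. ?H i j * G j k) = (if i = k then 1 else 0)" if "i < m" "k < Suc m" for i k
    using R[OF that] that unfolding H by simp
  ultimately show ?thesis by (auto simp: left_inverse_def less_Suc_eq)
qed

lemma (in chart_domain) smooth_left_inverse:
  assumes "\<And>i j. i < m \<Longrightarrow> j < m \<Longrightarrow> smooth (\<lambda>p. G p i j)"
    and "\<And>p. p \<in> W \<Longrightarrow> positive_definite m (G p)"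
  shows "\<exists>H. (\<forall>i<m. \<forall>j<m. smooth (\<lambda>p. H p i j)) \<and> (\<forall>p\<in>W. left_inverse m (H p) (G p))"
  using assms
proof (induction m arbitrary: G)
  case 0
  show ?case by (simp add: left_inverse_def)
next
  case (Suc m)
  have d: "0 < G p m m" if "p \<in> W" for p using Suc.prems(2)[OF that] by (rule positive_definite_diag)
  have dn: "G p m m \<noteq> 0" if "p \<in> W" for p using d[OF that] by simp
  have sd: "smooth (\<lambda>p. inverse (G p m m))"
    using Suc.prems(1) dn by (intro smooth_inverse) auto
  have "\<exists>K. (\<forall>i<m. \<forall>j<m. smooth (\<lambda>p. K p i j)) \<and>
      (\<forall>p\<in>W. left_inverse m (K p) (schur_complement m (G p)))"
  proof (rule Suc.IH)
    show "smooth (\<lambda>p. schur_complement m (G p) i j)" if "i < m" "j < m" for i j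
      unfolding schur_complement_def
      using that Suc.prems(1) by (intro smooth_diff smooth_mult sd) auto
    show "positive_definite m (schur_complement m (G p))" if "p \<in> W" for p
      using Suc.prems(2)[OF that] by (rule positive_definite_schur)
  qed
  then obtain K where K: "\<And>i j. i < m \<Longrightarrow> j < m \<Longrightarrow> smooth (\<lambda>p. K p i j)"
    "\<And>p. p \<in> W \<Longrightarrow> left_inverse m (K p) (schur_complement m (G p))" by blast
  have R: "smooth (\<lambda>p. if j = m then - 1 * ((\<Sum>l<m. K p i l * G p l m) * inverse (G p m m)) else K p i j)"
    if "i < m" "j < Suc m" for i j
  proof (cases "j = m")
    case True
    have "smooth (\<lambda>p. - 1 * ((\<Sum>l<m. K p i l * G p l m) * inverse (G p m m)))"
      using that K(1) Suc.prems(1) by (intro smooth_mult smooth_const smooth_sum sd) auto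
    then show ?thesis using True by simp
  qed (use K(1) that in simp)
  have "smooth (\<lambda>p. extend_inverse m (G p) (K p) i j)" if ij: "i < Suc m" "j < Suc m" for i j
  proof (cases "i = m")
    case True
    then show ?thesis
      unfolding extend_inverse_def Let_def
      using ij R Suc.prems(1)
      by (simp only: simp_thms if_True) (intro smooth_mult smooth_diff smooth_const smooth_sum sd; auto)
  next
    case False
    then show ?thesis
      unfolding extend_inverse_def Let_def using R[of i j] ij by (simp only: simp_thms if_False)
  qed
  then show ?case
    using left_inverse_extend[OF dn K(2)]
    by (intro exI[of _ "\<lambda>p. extend_inverse m (G p) (K p)"]) auto
qed

lemma quadratic_form_add_scaled:
  "quadratic_form m G (\<lambda>i. v i + t * w i) (\<lambda>i. v i + t * w i) =
    quadratic_form m G v v + t * (quadratic_form m G v w + quadratic_form m G w v) +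
    t * t * quadratic_form m G w w"
  by (simp add: quadratic_form_def sum.distrib[symmetric] sum_distrib_left algebra_simps)

lemma quadratic_form_sym:
  assumes "\<And>i j. i < m \<Longrightarrow> j < m \<Longrightarrow> G i j = G j i"
  shows "quadratic_form m G v w = quadratic_form m G w v"
  unfolding quadratic_form_def
proof (subst sum.swap, intro sum.cong refl)
  fix i j assume "i \<in> {..<m}" "j \<in> {..<m}"
  then show "G j i * v j * w i = G i j * w i * v j" using assms[of i j] by simp
qed

lemma quadratic_form_nonneg: "positive_definite m G \<Longrightarrow> 0 \<le> quadratic_form m G v v"
  by (cases "\<exists>i<m. v i \<noteq> 0") (auto simp: positive_definite_def quadratic_form_def less_imp_le)

lemma quadratic_form_Cauchy_Schwarz:
  assumes G: "positive_definite m G" and sym: "\<And>i j. i < m \<Longrightarrow> j < m \<Longrightarrow> G i j = G j i"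
  shows "(quadratic_form m G v w)\<^sup>2 \<le> quadratic_form m G v v * quadratic_form m G w w"
proof (cases "\<exists>i<m. w i \<noteq> 0")
  case False
  then have "quadratic_form m G v w = 0" by (simp add: quadratic_form_def)
  then show ?thesis using quadratic_form_nonneg[OF G] by simp
next
  case True
  let ?a = "quadratic_form m G v v" and ?b = "quadratic_form m G v w" and ?c = "quadratic_form m G w w"
  have c: "?c > 0" using G True by (simp add: positive_definite_def)
  define t where "t = - ?b / ?c"
  have "0 \<le> ?a + t * (?b + ?b) + t * t * ?c"
    using quadratic_form_nonneg[OF G, of "\<lambda>i. v i + t * w i"]
      quadratic_form_add_scaled[of m G v t w] quadratic_form_sym[of m G w v] sym by simp
  also have "\<dots> = ?a - ?b * ?b / ?c" using c by (simp add: t_def field_simps)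
  finally show ?thesis using c by (simp add: field_simps power2_eq_square)
qed

lemma positive_definite_component_bound:
  assumes G: "positive_definite m G" and sym: "\<And>i j. i < m \<Longrightarrow> j < m \<Longrightarrow> G i j = G j i"
    and H: "left_inverse m H G" and v: "quadratic_form m G v v \<le> 1" and i: "i < m"
  shows "\<bar>v i\<bar> \<le> sqrt (quadratic_form m G (H i) (H i))"
proof -
  have "quadratic_form m G (H i) v = (\<Sum>k<m. (\<Sum>j<m. H i j * G j k) * v k)"
    unfolding quadratic_form_def by (subst sum.swap) (simp add: sum_distrib_left sum_distrib_right mult_ac)
  also have "\<dots> = (\<Sum>k<m. (if i = k then v k else 0))"
    using H i by (intro sum.cong) (auto simp: left_inverse_def)
  also have "\<dots> = v i" using i by simp
  finally have "(v i)\<^sup>2 \<le> quadratic_form m G (H i) (H i) * quadratic_form m G v v"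
    using quadratic_form_Cauchy_Schwarz[OF G sym, of "H i" v] by simp
  also have "\<dots> \<le> quadratic_form m G (H i) (H i) * 1"
    using v quadratic_form_nonneg[OF G] by (intro mult_left_mono) auto
  finally show ?thesis by (simp add: real_le_rsqrt)
qed

text \<open>A functional that is continuous for the supremum norm on \<open>D\<close> commutes with partial derivatives,
  because difference quotients converge uniformly on \<open>D\<close>.\<close>

locale sup_continuous_functional =
  fixes D :: "'i set" and \<Phi> :: "('i \<Rightarrow> real) \<Rightarrow> real"
  assumes lin: "linear_functional_on {l. \<exists>B. \<forall>d\<in>D. \<bar>l d\<bar> \<le> B} \<Phi>"
    and cont: "\<exists>C\<ge>0. \<forall>l B. B \<ge> 0 \<longrightarrow> (\<forall>d\<in>D. \<bar>l d\<bar> \<le> B) \<longrightarrow> \<bar>\<Phi> l\<bar> \<le> C * B"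
begin

lemma functional_add:
  assumes "\<And>d. d \<in> D \<Longrightarrow> \<bar>l d\<bar> \<le> A" "\<And>d. d \<in> D \<Longrightarrow> \<bar>m d\<bar> \<le> B"
  shows "\<Phi> (\<lambda>d. l d + m d) = \<Phi> l + \<Phi> m"
  using linear_functional_onD(1)[OF lin, of l m] assms by (auto simp: plus_fun_def)

lemma functional_scale:
  assumes "\<And>d. d \<in> D \<Longrightarrow> \<bar>l d\<bar> \<le> A"
  shows "\<Phi> (\<lambda>d. a * l d) = a * \<Phi> l"
  using linear_functional_onD(2)[OF lin, of l a] assms by (auto simp: scaleR_fun_def)

lemma functional_cong:
  assumes "\<And>d. d \<in> D \<Longrightarrow> l d = m d" "\<And>d. d \<in> D \<Longrightarrow> \<bar>l d\<bar> \<le> A"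
  shows "\<Phi> l = \<Phi> m"
proof -
  obtain C where C: "\<And>l B. B \<ge> 0 \<Longrightarrow> (\<forall>d\<in>D. \<bar>l d\<bar> \<le> B) \<Longrightarrow> \<bar>\<Phi> l\<bar> \<le> C * B"
    using cont by blast
  have "\<bar>\<Phi> (\<lambda>d. m d - l d)\<bar> \<le> C * 0" using assms by (intro C) auto
  moreover have "\<Phi> (\<lambda>d. l d + (m d - l d)) = \<Phi> l + \<Phi> (\<lambda>d. m d - l d)"
    by (rule functional_add[of _ A _ 0]) (use assms in auto)
  ultimately show ?thesis by simp
qed

lemma functional_sum:
  assumes "finite A" "\<And>i d. i \<in> A \<Longrightarrow> d \<in> D \<Longrightarrow> \<bar>l i d\<bar> \<le> B i"
  shows "\<Phi> (\<lambda>d. \<Sum>i\<in>A. a i * l i d) = (\<Sum>i\<in>A. a i * \<Phi> (l i))"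
  using assms
proof (induction A rule: finite_induct)
  case empty
  show ?case using functional_scale[of "\<lambda>_. 0" 0 0] by simp
next
  case (insert i A)
  have "\<Phi> (\<lambda>d. a i * l i d + (\<Sum>i\<in>A. a i * l i d)) =
      \<Phi> (\<lambda>d. a i * l i d) + \<Phi> (\<lambda>d. \<Sum>i\<in>A. a i * l i d)"
  proof (rule functional_add)
    show "\<bar>a i * l i d\<bar> \<le> \<bar>a i\<bar> * B i" if "d \<in> D" for d
      using insert.prems[of i d] that by (auto simp: abs_mult intro: mult_left_mono)
    show "\<bar>\<Sum>i\<in>A. a i * l i d\<bar> \<le> (\<Sum>i\<in>A. \<bar>a i\<bar> * B i)" if "d \<in> D" for d
      using insert.prems that
      by (intro order_trans[OF sum_abs] sum_mono) (auto simp: abs_mult intro: mult_left_mono)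
  qed
  moreover have "\<Phi> (\<lambda>d. a i * l i d) = a i * \<Phi> (l i)"
    by (rule functional_scale[of _ "B i"]) (use insert.prems in auto)
  ultimately show ?case using insert by simp
qed

end

lemma (in chart_domain) uniform_box:
  assumes "\<And>j. j < n \<Longrightarrow> locally_bounded D (\<lambda>d. chart_partial c j (F d))" and p: "p \<in> W"
  obtains \<delta> B where "\<delta> > 0" "B \<ge> 0"
    "\<And>z. \<lbrakk>\<And>i. i \<ge> n \<Longrightarrow> z i = 0; \<And>i. i < n \<Longrightarrow> \<bar>z i - coord c p i\<bar> < \<delta>\<rbrakk> \<Longrightarrow>
      chart_inv c z \<in> W \<and> coord c (chart_inv c z) = z"
    "\<And>j d q. j < n \<Longrightarrow> d \<in> D \<Longrightarrow> q \<in> W \<Longrightarrow> (\<And>i. i < n \<Longrightarrow> \<bar>coord c q i - coord c p i\<bar> < \<delta>) \<Longrightarrow>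
      \<bar>chart_partial c j (F d) q\<bar> \<le> B"
proof -
  obtain \<delta>\<^sub>0 where \<delta>\<^sub>0: "\<delta>\<^sub>0 > 0" "\<And>z. \<lbrakk>\<And>i. i \<ge> n \<Longrightarrow> z i = 0; \<And>i. i < n \<Longrightarrow> \<bar>z i - coord c p i\<bar> < \<delta>\<^sub>0\<rbrakk> \<Longrightarrow>
      chart_inv c z \<in> W \<and> coord c (chart_inv c z) = z"
    using cube[OF p] by blast
  define P where "P j \<delta> B \<longleftrightarrow> \<delta> > 0 \<and> (\<forall>d\<in>D. \<forall>q\<in>W. (\<forall>i<n. \<bar>coord c q i - coord c p i\<bar> < \<delta>) \<longrightarrow>
      \<bar>chart_partial c j (F d) q\<bar> \<le> B)" for j \<delta> B
  have "\<exists>\<delta> B. P j \<delta> B" if j: "j < n" for j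
  proof -
    obtain N B where N: "openin X N" "p \<in> N" "\<forall>d\<in>D. \<forall>q\<in>N \<inter> W. \<bar>chart_partial c j (F d) q\<bar> \<le> B"
      using assms(1)[OF j] p unfolding locally_bounded_def by blast
    obtain \<delta> where "\<delta> > 0" "\<And>q. q \<in> W \<Longrightarrow> (\<And>i. i < n \<Longrightarrow> \<bar>coord c q i - coord c p i\<bar> < \<delta>) \<Longrightarrow> q \<in> N"
      using box_subset_open[OF N(1,2) p] by blast
    then have "P j \<delta> B" unfolding P_def using N(3) by blast
    then show ?thesis by blast
  qed
  then obtain \<delta> B where "\<And>j. j < n \<Longrightarrow> P j (\<delta> j) (B j)" by metis
  then have \<delta>: "\<And>j. j < n \<Longrightarrow> \<delta> j > (0::real)" and
    B: "\<And>j d q. j < n \<Longrightarrow> d \<in> D \<Longrightarrow> q \<in> W \<Longrightarrow> (\<forall>i<n. \<bar>coord c q i - coord c p i\<bar> < \<delta> j) \<Longrightarrow>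
      \<bar>chart_partial c j (F d) q\<bar> \<le> B j"
    unfolding P_def by blast+
  define \<delta>' where "\<delta>' = Min (insert \<delta>\<^sub>0 (\<delta> ` {..<n}))"
  define B' where "B' = (\<Sum>j<n. \<bar>B j\<bar>)"
  have \<delta>': "\<delta>' \<le> \<delta>\<^sub>0" "\<And>j. j < n \<Longrightarrow> \<delta>' \<le> \<delta> j" unfolding \<delta>'_def by auto
  show ?thesis
  proof (rule that[of \<delta>' B'])
    show "\<delta>' > 0" unfolding \<delta>'_def using \<delta>\<^sub>0(1) \<delta> by auto
    show "B' \<ge> 0" unfolding B'_def by (simp add: sum_nonneg)
  next
    fix z :: "nat \<Rightarrow> real"
    assume "\<And>i. i \<ge> n \<Longrightarrow> z i = 0" "\<And>i. i < n \<Longrightarrow> \<bar>z i - coord c p i\<bar> < \<delta>'"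
    then show "chart_inv c z \<in> W \<and> coord c (chart_inv c z) = z"
      using \<delta>'(1) by (intro \<delta>\<^sub>0(2)) (auto intro: less_le_trans)
  next
    fix j d q
    assume jdq: "j < n" "d \<in> D" "q \<in> W" "\<And>i. i < n \<Longrightarrow> \<bar>coord c q i - coord c p i\<bar> < \<delta>'"
    have "\<bar>chart_partial c j (F d) q\<bar> \<le> B j"
      using jdq \<delta>'(2)[OF jdq(1)] by (intro B) (auto intro: less_le_trans)
    also have "\<dots> \<le> \<bar>B j\<bar>" by simp
    also have "\<dots> \<le> B'" unfolding B'_def using jdq(1) by (intro member_le_sum) auto
    finally show "\<bar>chart_partial c j (F d) q\<bar> \<le> B'" .
  qed
qed

context chart_domain
begin

lemma C0_family_pointwise_bounded:
  assumes "C0_family D F" "p \<in> W"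
  shows "\<exists>B. \<forall>d\<in>D. \<bar>F d p\<bar> \<le> B"
  using assms unfolding C0_family_def locally_bounded_def by blast

lemma functional_chart_partial:
  assumes "sup_continuous_functional D \<Phi>" and F: "Cr_family 2 D F" and p: "p \<in> W" and j: "j < n"
  shows "((\<lambda>t. \<Phi> (\<lambda>d. F d (chart_line c j p t))) has_real_derivative \<Phi> (\<lambda>d. chart_partial c j (F d) p))
    (at (coord c p j))"
proof -
  interpret sup_continuous_functional D \<Phi> by fact
  let ?x = "coord c p"
  obtain C where C: "C \<ge> 0" "\<And>l B. B \<ge> 0 \<Longrightarrow> (\<forall>d\<in>D. \<bar>l d\<bar> \<le> B) \<Longrightarrow> \<bar>\<Phi> l\<bar> \<le> C * B"
    using cont by blast
  have F': "Cr_family (Suc (Suc 0)) D F" using F by (simp add: numeral_2_eq_2)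
  have F1: "Cr_family (Suc 0) D (\<lambda>d. chart_partial c i (F d))" if "i < n" for i
    using F' that unfolding Cr_family.simps(2) by blast
  have dF: "chart_differentiable c i (F d) q" if "i < n" "d \<in> D" "q \<in> W" for i d q
    using F' that unfolding Cr_family.simps(2) by blast
  have dF1: "chart_differentiable c k (chart_partial c i (F d)) q" if "i < n" "k < n" "d \<in> D" "q \<in> W" for i k d q
    using F1 that unfolding Cr_family.simps(2) by blast
  have lb: "locally_bounded D (\<lambda>d. chart_partial c k (chart_partial c i (F d)))" if "i < n" "k < n" for i k
    using F1[OF that(1)] that(2) by (simp add: C0_family_def)
  define P where "P i \<delta> B \<longleftrightarrow> \<delta> > 0 \<and> B \<ge> 0 \<and>
      (\<forall>d\<in>D. \<forall>q\<in>W. (\<forall>i<n. \<bar>coord c q i - ?x i\<bar> < \<delta>) \<longrightarrow>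
      \<bar>chart_partial c i (F d) q - chart_partial c i (F d) p\<bar> \<le> B * (\<Sum>k<n. \<bar>coord c q k - ?x k\<bar>))"
    for i \<delta> B
  have "\<exists>\<delta> B. P i \<delta> B" if i: "i < n" for i
  proof -
    obtain \<delta> B where b: "\<delta> > 0" "B \<ge> 0"
      "\<And>z. \<lbrakk>\<And>i. i \<ge> n \<Longrightarrow> z i = 0; \<And>i. i < n \<Longrightarrow> \<bar>z i - coord c p i\<bar> < \<delta>\<rbrakk> \<Longrightarrow>
        chart_inv c z \<in> W \<and> coord c (chart_inv c z) = z"
      "\<And>j d q. j < n \<Longrightarrow> d \<in> D \<Longrightarrow> q \<in> W \<Longrightarrow> (\<And>i. i < n \<Longrightarrow> \<bar>coord c q i - coord c p i\<bar> < \<delta>) \<Longrightarrow>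
        \<bar>chart_partial c j (chart_partial c i (F d)) q\<bar> \<le> B"
      using uniform_box[of D "\<lambda>d. chart_partial c i (F d)" p, OF lb[OF i] p] by blast
    have "\<bar>chart_partial c i (F d) q - chart_partial c i (F d) p\<bar> \<le> B * (\<Sum>k<n. \<bar>coord c q k - ?x k\<bar>)"
      if "d \<in> D" "q \<in> W" "\<forall>i<n. \<bar>coord c q i - ?x i\<bar> < \<delta>" for d q
      using cube_mean_value[of p \<delta> "chart_partial c i (F d)" "\<lambda>_. 0" B q] b dF1[OF i _ that(1)] p that
      by simp
    then have "P i \<delta> B" unfolding P_def using b(1,2) by blast
    then show ?thesis by blast
  qed
  then obtain \<delta> B where "\<And>i. i < n \<Longrightarrow> P i (\<delta> i) (B i)" by metis
  then have \<delta>: "\<And>i. i < n \<Longrightarrow> \<delta> i > (0::real)" and B: "\<And>i. i < n \<Longrightarrow> B i \<ge> 0" and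
    lip: "\<And>i d q. i < n \<Longrightarrow> d \<in> D \<Longrightarrow> q \<in> W \<Longrightarrow> \<forall>i'<n. \<bar>coord c q i' - ?x i'\<bar> < \<delta> i \<Longrightarrow>
      \<bar>chart_partial c i (F d) q - chart_partial c i (F d) p\<bar> \<le> B i * (\<Sum>k<n. \<bar>coord c q k - ?x k\<bar>)"
    unfolding P_def by blast+
  obtain \<delta>\<^sub>0 where \<delta>\<^sub>0: "\<delta>\<^sub>0 > 0" "\<And>z. \<lbrakk>\<And>i. i \<ge> n \<Longrightarrow> z i = 0; \<And>i. i < n \<Longrightarrow> \<bar>z i - ?x i\<bar> < \<delta>\<^sub>0\<rbrakk> \<Longrightarrow>
      chart_inv c z \<in> W \<and> coord c (chart_inv c z) = z"
    using cube[OF p] by blast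
  define \<eta> where "\<eta> = Min (insert \<delta>\<^sub>0 (\<delta> ` {..<n}))"
  have \<eta>: "\<eta> > 0" "\<eta> \<le> \<delta>\<^sub>0" "\<And>i. i < n \<Longrightarrow> \<eta> \<le> \<delta> i" unfolding \<eta>_def using \<delta>\<^sub>0(1) \<delta> by auto
  define K where "K = (\<Sum>i<n. B i)"
  have K: "K \<ge> 0" "\<And>i. i < n \<Longrightarrow> B i \<le> K"
    unfolding K_def using B by (auto intro!: sum_nonneg member_le_sum)
  let ?g = "\<lambda>t. \<Phi> (\<lambda>d. F d (chart_line c j p t))" and ?D = "\<Phi> (\<lambda>d. chart_partial c j (F d) p)"
  have bd: "\<exists>B. \<forall>d\<in>D. \<bar>F d q\<bar> \<le> B" "\<exists>B. \<forall>d\<in>D. \<bar>chart_partial c j (F d) q\<bar> \<le> B" if "q \<in> W" for q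
    using C0_family_pointwise_bounded[OF C0_family_if_Cr[OF F] that]
      C0_family_pointwise_bounded[OF C0_family_if_Cr[OF F1[OF j]] that] by auto
  have est: "\<bar>?g t - ?g (?x j) - ?D * (t - ?x j)\<bar> \<le> C * (2 * K * real n * \<bar>t - ?x j\<bar> * \<bar>t - ?x j\<bar>)"
    if t: "t \<noteq> ?x j" "2 * \<bar>t - ?x j\<bar> < \<eta>" for t
  proof -
    let ?h = "2 * \<bar>t - ?x j\<bar>" and ?q = "chart_line c j p t"
    have h: "?h > 0" using t by simp
    have out: "?x i = 0" if "i \<ge> n" for i using coord_outside p that W_dom by auto
    have q: "?q \<in> W \<and> coord c ?q = ?x(j := t)"
      using h t \<eta>(2) j out \<delta>\<^sub>0(1) by (intro \<delta>\<^sub>0(2)) auto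
    have F_est: "\<bar>F d ?q - F d p - chart_partial c j (F d) p * (t - ?x j)\<bar> \<le>
        2 * K * real n * \<bar>t - ?x j\<bar> * \<bar>t - ?x j\<bar>" if d: "d \<in> D" for d
    proof -
      have "\<bar>F d ?q - F d p - (\<Sum>i<n. chart_partial c i (F d) p * (coord c ?q i - ?x i))\<bar> \<le>
        (K * (real n * ?h)) * (\<Sum>i<n. \<bar>coord c ?q i - ?x i\<bar>)"
      proof (rule cube_mean_value[of p ?h])
        show "chart_inv c z \<in> W \<and> coord c (chart_inv c z) = z"
          if "\<And>i. i \<ge> n \<Longrightarrow> z i = 0" "\<And>i. i < n \<Longrightarrow> \<bar>z i - ?x i\<bar> < ?h" for z
        proof (rule \<delta>\<^sub>0(2))
          show "\<bar>z i - ?x i\<bar> < \<delta>\<^sub>0" if "i < n" for i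
            using \<open>\<And>i. i < n \<Longrightarrow> \<bar>z i - ?x i\<bar> < ?h\<close>[OF that] t(2) \<eta>(2) by linarith
        qed (rule that(1))
        show "chart_differentiable c i (F d) q" if "i < n" "q \<in> W" for i q using dF that d by blast
        show "\<bar>chart_partial c i (F d) q - chart_partial c i (F d) p\<bar> \<le> K * (real n * ?h)"
          if i: "i < n" "q \<in> W" and near: "\<And>k. k < n \<Longrightarrow> \<bar>coord c q k - ?x k\<bar> < ?h" for i q
        proof -
          have "\<bar>chart_partial c i (F d) q - chart_partial c i (F d) p\<bar> \<le>
              B i * (\<Sum>k<n. \<bar>coord c q k - ?x k\<bar>)"
          proof (rule lip[OF i(1) d i(2)], intro allI impI)
            fix k assume "k < n"
            then show "\<bar>coord c q k - ?x k\<bar> < \<delta> i" using near[of k] t(2) \<eta>(3)[OF i(1)] by linarith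
          qed
          also have "\<dots> \<le> K * (\<Sum>k<n. ?h)"
            using near K i B by (intro mult_mono sum_mono sum_nonneg) (auto intro: less_imp_le)
          finally show ?thesis by simp
        qed
        show "p \<in> W" by (rule p)
        show "?q \<in> W" using q by simp
        show "\<bar>coord c ?q i - ?x i\<bar> < ?h" for i using q h by simp
      qed
      moreover have "(\<Sum>i<n. chart_partial c i (F d) p * (coord c ?q i - ?x i)) =
          (\<Sum>i<n. if i = j then chart_partial c j (F d) p * (t - ?x j) else 0)"
        using q by (intro sum.cong) auto
      moreover have "(\<Sum>i<n. \<bar>coord c ?q i - ?x i\<bar>) = (\<Sum>i<n. if i = j then \<bar>t - ?x j\<bar> else 0)"
        using q by (intro sum.cong) auto
      ultimately show ?thesis using j by (simp add: mult_ac)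
    qed
    obtain A1 where A1: "\<And>d. d \<in> D \<Longrightarrow> \<bar>F d ?q\<bar> \<le> A1" using bd(1)[of ?q] q by blast
    obtain A2 where A2: "\<And>d. d \<in> D \<Longrightarrow> \<bar>F d p\<bar> \<le> A2" using bd(1)[OF p] by blast
    obtain A3 where A3: "\<And>d. d \<in> D \<Longrightarrow> \<bar>chart_partial c j (F d) p\<bar> \<le> A3" using bd(2)[OF p] by blast
    have s2: "\<bar>- 1 * F d p\<bar> \<le> A2" if "d \<in> D" for d using A2[OF that] by simp
    have s3: "\<bar>- (t - ?x j) * chart_partial c j (F d) p\<bar> \<le> \<bar>t - ?x j\<bar> * A3" if "d \<in> D" for d
      unfolding abs_mult abs_minus_cancel using A3[OF that] by (intro mult_left_mono) auto
    have s23: "\<bar>- 1 * F d p + - (t - ?x j) * chart_partial c j (F d) p\<bar> \<le> A2 + \<bar>t - ?x j\<bar> * A3"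
      if "d \<in> D" for d using s2[OF that] s3[OF that] by linarith
    have "\<Phi> (\<lambda>d. F d ?q + (- 1 * F d p + - (t - ?x j) * chart_partial c j (F d) p)) =
        ?g t + (- 1 * \<Phi> (\<lambda>d. F d p) + - (t - ?x j) * ?D)"
      using functional_add[of "\<lambda>d. F d ?q" A1, OF A1 s23]
        functional_add[of "\<lambda>d. - 1 * F d p" A2, OF s2 s3]
        functional_scale[of "\<lambda>d. F d p" A2 "- 1", OF A2]
        functional_scale[of "\<lambda>d. chart_partial c j (F d) p" A3 "- (t - ?x j)", OF A3] by simp
    moreover have "\<bar>\<Phi> (\<lambda>d. F d ?q + (- 1 * F d p + - (t - ?x j) * chart_partial c j (F d) p))\<bar> \<le>
        C * (2 * K * real n * \<bar>t - ?x j\<bar> * \<bar>t - ?x j\<bar>)"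
    proof (rule C(2), goal_cases)
      case 2
      show ?case
      proof
        fix d assume "d \<in> D"
        have "F d ?q + (- 1 * F d p + - (t - ?x j) * chart_partial c j (F d) p) =
          F d ?q - F d p - chart_partial c j (F d) p * (t - ?x j)" by (simp add: algebra_simps)
        then show "\<bar>F d ?q + (- 1 * F d p + - (t - ?x j) * chart_partial c j (F d) p)\<bar> \<le>
          2 * K * real n * \<bar>t - ?x j\<bar> * \<bar>t - ?x j\<bar>" using F_est[OF \<open>d \<in> D\<close>] by simp
      qed
    qed (use K in auto)
    moreover have "?g (?x j) = \<Phi> (\<lambda>d. F d p)" using chart_line_same[OF p] by simp
    ultimately show ?thesis by (simp add: algebra_simps)
  qed
  have "((\<lambda>t. (?g t - ?g (?x j)) / (t - ?x j) - ?D) \<longlongrightarrow> 0) (at (?x j))"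
  proof (rule Lim_null_comparison)
    show "\<forall>\<^sub>F t in at (?x j). norm ((?g t - ?g (?x j)) / (t - ?x j) - ?D) \<le> C * (2 * K * real n * \<bar>t - ?x j\<bar>)"
      unfolding eventually_at
    proof (intro exI[of _ "\<eta> / 2"] conjI ballI impI)
      show "\<eta> / 2 > 0" using \<eta>(1) by simp
      fix t assume "t \<noteq> ?x j \<and> dist t (?x j) < \<eta> / 2"
      then have t: "t \<noteq> ?x j" "2 * \<bar>t - ?x j\<bar> < \<eta>" by (auto simp: dist_real_def)
      have "(?g t - ?g (?x j)) / (t - ?x j) - ?D = (?g t - ?g (?x j) - ?D * (t - ?x j)) / (t - ?x j)"
        using t(1) by (simp add: diff_divide_distrib)
      also have "norm \<dots> \<le> C * (2 * K * real n * \<bar>t - ?x j\<bar> * \<bar>t - ?x j\<bar>) / \<bar>t - ?x j\<bar>"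
        unfolding real_norm_def abs_divide using est[OF t] by (intro divide_right_mono) auto
      also have "\<dots> = C * (2 * K * real n * \<bar>t - ?x j\<bar>)" using t(1) by simp
      finally show "norm ((?g t - ?g (?x j)) / (t - ?x j) - ?D) \<le> C * (2 * K * real n * \<bar>t - ?x j\<bar>)" .
    qed
    show "((\<lambda>t. C * (2 * K * real n * \<bar>t - ?x j\<bar>)) \<longlongrightarrow> 0) (at (?x j))"
      by (auto intro!: tendsto_eq_intros)
  qed
  then show ?thesis unfolding has_field_derivative_iff by (rule LIM_zero_cancel)
qed

lemma functional_continuous:
  assumes "sup_continuous_functional D \<Phi>" and F: "Cr_family 1 D F"
  shows "continuous_map (subtopology X W) euclideanreal (\<lambda>p. \<Phi> (\<lambda>d. F d p))"
proof -
  interpret sup_continuous_functional D \<Phi> by fact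
  obtain C where C: "C \<ge> 0" "\<And>l B. B \<ge> 0 \<Longrightarrow> (\<forall>d\<in>D. \<bar>l d\<bar> \<le> B) \<Longrightarrow> \<bar>\<Phi> l\<bar> \<le> C * B"
    using cont by blast
  have F': "Cr_family (Suc 0) D F" using F by simp
  have dF: "chart_differentiable c i (F d) q" if "i < n" "d \<in> D" "q \<in> W" for i d q
    using F' that unfolding Cr_family.simps(2) by blast
  have lb: "locally_bounded D (\<lambda>d. chart_partial c i (F d))" if "i < n" for i
    using F' that by (simp add: C0_family_def)
  have bd: "\<exists>B. \<forall>d\<in>D. \<bar>F d q\<bar> \<le> B" if "q \<in> W" for q
    using C0_family_pointwise_bounded[OF C0_family_if_Cr[OF F] that] .
  have "openin (subtopology X W) {p \<in> W. \<Phi> (\<lambda>d. F d p) \<in> U}" if U: "open U" for U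
  proof (subst openin_subopen, intro ballI)
    fix p assume "p \<in> {p \<in> W. \<Phi> (\<lambda>d. F d p) \<in> U}"
    then have p: "p \<in> W" "\<Phi> (\<lambda>d. F d p) \<in> U" by auto
    obtain e where e: "e > 0" "ball (\<Phi> (\<lambda>d. F d p)) e \<subseteq> U" using U p(2) by (meson open_contains_ball)
    obtain \<delta> B where b: "\<delta> > 0" "B \<ge> 0"
      "\<And>z. \<lbrakk>\<And>i. i \<ge> n \<Longrightarrow> z i = 0; \<And>i. i < n \<Longrightarrow> \<bar>z i - coord c p i\<bar> < \<delta>\<rbrakk> \<Longrightarrow>
        chart_inv c z \<in> W \<and> coord c (chart_inv c z) = z"
      "\<And>j d q. j < n \<Longrightarrow> d \<in> D \<Longrightarrow> q \<in> W \<Longrightarrow> (\<And>i. i < n \<Longrightarrow> \<bar>coord c q i - coord c p i\<bar> < \<delta>) \<Longrightarrow>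
        \<bar>chart_partial c j (F d) q\<bar> \<le> B"
      using uniform_box[OF lb p(1)] by blast
    define \<eta> where "\<eta> = min \<delta> (e / (C * B * real n + 1))"
    have CB: "0 \<le> C * B * real n" using C(1) b(2) by simp
    have \<eta>: "\<eta> > 0" "\<eta> \<le> \<delta>" "\<eta> \<le> e / (C * B * real n + 1)" using b(1) e(1) CB by (auto simp: \<eta>_def)
    have "\<Phi> (\<lambda>d. F d q) \<in> U" if q: "q \<in> W" "\<forall>i<n. \<bar>coord c q i - coord c p i\<bar> < \<eta>" for q
    proof -
      have F_est: "\<bar>F d q + - 1 * F d p\<bar> \<le> B * (real n * \<eta>)" if d: "d \<in> D" for d
      proof -
        have "\<bar>F d q - F d p\<bar> \<le> B * (\<Sum>k<n. \<bar>coord c q k - coord c p k\<bar>)"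
          using cube_mean_value[of p \<delta> "F d" "\<lambda>_. 0" B q] b dF d p q \<eta>(2) by fastforce
        also have "\<dots> \<le> B * (\<Sum>k<n. \<eta>)"
          using q b(2) by (intro mult_left_mono sum_mono) (auto intro: less_imp_le)
        finally show ?thesis by simp
      qed
      obtain A1 where A1: "\<And>d. d \<in> D \<Longrightarrow> \<bar>F d q\<bar> \<le> A1" using bd[OF q(1)] by blast
      obtain A2 where A2: "\<And>d. d \<in> D \<Longrightarrow> \<bar>F d p\<bar> \<le> A2" using bd[OF p(1)] by blast
      have s2: "\<bar>- 1 * F d p\<bar> \<le> A2" if "d \<in> D" for d using A2[OF that] by simp
      have "\<Phi> (\<lambda>d. F d q + - 1 * F d p) = \<Phi> (\<lambda>d. F d q) + - 1 * \<Phi> (\<lambda>d. F d p)"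
        using functional_add[of "\<lambda>d. F d q" A1, OF A1 s2]
          functional_scale[of "\<lambda>d. F d p" A2 "- 1", OF A2] by simp
      moreover have "\<bar>\<Phi> (\<lambda>d. F d q + - 1 * F d p)\<bar> \<le> C * (B * (real n * \<eta>))"
        using F_est b(2) \<eta>(1) by (intro C(2)) auto
      moreover have "C * (B * (real n * \<eta>)) < e"
      proof -
        have "C * (B * (real n * \<eta>)) < (C * B * real n + 1) * \<eta>"
          using \<eta>(1) by (simp add: algebra_simps)
        also have "\<dots> \<le> e" using \<eta>(3) CB by (simp add: pos_le_divide_eq mult.commute)
        finally show ?thesis .
      qed
      ultimately have "\<Phi> (\<lambda>d. F d q) \<in> ball (\<Phi> (\<lambda>d. F d p)) e"
        by (simp add: dist_real_def abs_minus_commute)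
      then show ?thesis using e(2) by blast
    qed
    then have "{q \<in> W. \<forall>i<n. \<bar>coord c q i - coord c p i\<bar> < \<eta>} \<subseteq> {p \<in> W. \<Phi> (\<lambda>d. F d p) \<in> U}" by blast
    moreover have "openin (subtopology X W) {q \<in> W. \<forall>i<n. \<bar>coord c q i - coord c p i\<bar> < \<eta>}"
      unfolding openin_open_subtopology[OF W] using openin_box by blast
    moreover have "p \<in> {q \<in> W. \<forall>i<n. \<bar>coord c q i - coord c p i\<bar> < \<eta>}" using p \<eta>(1) by simp
    ultimately show "\<exists>T. openin (subtopology X W) T \<and> p \<in> T \<and> T \<subseteq> {p \<in> W. \<Phi> (\<lambda>d. F d p) \<in> U}"
      by blast
  qed
  then show ?thesis unfolding continuous_map_def topspace_W by auto
qed

theorem functional_smooth: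
  assumes "sup_continuous_functional D \<Phi>" "\<And>r. Cr_family r D F"
  shows "smooth (\<lambda>p. \<Phi> (\<lambda>d. F d p))"
proof -
  have "Cr_family r {()} (\<lambda>_ p. \<Phi> (\<lambda>d. F d p))" for r
    using assms(2)
  proof (induction r arbitrary: F)
    case 0
    then show ?case by (simp add: C0_family_single functional_continuous[OF assms(1)])
  next
    case (Suc r)
    note D = functional_chart_partial[OF assms(1) Suc.prems[of 2]]
    have "Cr_family r {()} (\<lambda>_. chart_partial c j (\<lambda>p. \<Phi> (\<lambda>d. F d p)))" if j: "j < n" for j
    proof -
      have "Cr_family r D (\<lambda>d. chart_partial c j (F d))" for r
        using Suc.prems[of "Suc r"] j by simp
      then have "Cr_family r {()} (\<lambda>_ p. \<Phi> (\<lambda>d. chart_partial c j (F d) p))" by (rule Suc.IH)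
      then show ?thesis by (rule Cr_family_cong) (simp add: chart_partialI[OF D[OF _ j]])
    qed
    moreover have "chart_differentiable c j (\<lambda>p. \<Phi> (\<lambda>d. F d p)) p" if "j < n" "p \<in> W" for j p
      using D[OF that(2,1)] by (rule chart_differentiableI)
    ultimately show ?case
      using functional_continuous[OF assms(1) Suc.prems] by (simp add: C0_family_single)
  qed
  then show ?thesis by (simp add: smooth_def)
qed

end

section \<open>Riemannian manifolds\<close>

lemma chart_Cr_mono:
  "chart_Cr X n c r W f \<Longrightarrow> W' \<subseteq> W \<Longrightarrow> chart_Cr X n c r W' f"
  unfolding chart_Cr_def using continuous_map_from_subtopology_mono by (meson subsetD)

lemma multi_indices_Suc: "multi_indices n (Suc m) = (\<lambda>(j, I). j # I) ` ({..<n} \<times> multi_indices n m)"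
  by (auto simp: multi_indices_def length_Suc_conv image_iff)

lemma finite_multi_indices: "finite (multi_indices n m)"
proof (induction m)
  case 0
  have "multi_indices n 0 \<subseteq> {[]}" by (auto simp: multi_indices_def)
  then show ?case by (rule finite_subset) simp
next
  case (Suc m)
  then show ?case unfolding multi_indices_Suc by (intro finite_imageI finite_cartesian_product) auto
qed

lemma multi_indices_nth: "I \<in> multi_indices n m \<Longrightarrow> a < m \<Longrightarrow> I ! a < n"
  by (auto simp: multi_indices_def subset_iff)

lemma multi_indices_update: "I \<in> multi_indices n m \<Longrightarrow> l < n \<Longrightarrow> I[a := l] \<in> multi_indices n m"
  using set_update_subset_insert[of I a l] by (auto simp: multi_indices_def)

definition tensor_value :: "nat \<Rightarrow> nat \<Rightarrow> (nat list \<Rightarrow> real) \<Rightarrow> (nat \<Rightarrow> nat \<Rightarrow> real) \<Rightarrow> real"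
  where "tensor_value n m T v = (\<Sum>I\<in>multi_indices n m. T I * (\<Prod>a<m. v a (I ! a)))"

locale riemannian_open =
  fixes M :: "'m riemannian" and U :: "'m set" and k :: nat
  assumes M: "riemannian_manifold M" and U: "openin (mtop M) U"
begin

abbreviation n where "n \<equiv> mdim M"
abbreviation W where "W c \<equiv> dom_of c \<inter> U"
abbreviation smooth_in where "smooth_in c \<equiv> chart_domain.smooth (mtop M) n c (W c)"
abbreviation nabla where "nabla j \<equiv> cov_deriv M ^^ j"

lemma atlas: "smooth_atlas (mtop M) n (atlas M)" and metric: "riemannian_metric (mtop M) n (atlas M) (metric M)"
  using M by (auto simp: riemannian_manifold_def)

lemma chart_domain_Int:
  assumes "c \<in> atlas M" "openin (mtop M) V"
  shows "chart_domain (mtop M) n c (dom_of c \<inter> V)"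
proof -
  have "is_chart (mtop M) n c" using atlas assms by (auto simp: smooth_atlas_def)
  then show ?thesis using assms(2) by unfold_locales (auto simp: is_chart_def)
qed

lemmas chart_domain_U = chart_domain_Int[OF _ U]

lemma positive_definite_metric: "c \<in> atlas M \<Longrightarrow> p \<in> dom_of c \<Longrightarrow> positive_definite n (metric M c p)"
  using metric unfolding riemannian_metric_def positive_definite_def quadratic_form_def by blast

lemma metric_sym: "c \<in> atlas M \<Longrightarrow> p \<in> dom_of c \<Longrightarrow> i < n \<Longrightarrow> j < n \<Longrightarrow> metric M c p i j = metric M c p j i"
  using metric unfolding riemannian_metric_def by blast

lemma metric_diag_pos:
  assumes "c \<in> atlas M" "p \<in> dom_of c" "i < n"
  shows "0 < metric M c p i i"
proof -
  let ?e = "\<lambda>j. if j = i then 1 else (0::real)"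
  have "(\<exists>j<n. ?e j \<noteq> 0) \<longrightarrow> 0 < quadratic_form n (metric M c p) ?e ?e"
    using positive_definite_metric[OF assms(1,2)] unfolding positive_definite_def by (rule spec)
  then have "0 < quadratic_form n (metric M c p) ?e ?e" using assms(3) by auto
  also have "\<dots> = (\<Sum>a<n. \<Sum>b<n. if b = i then if a = i then metric M c p i i else 0 else 0)"
    unfolding quadratic_form_def by (intro sum.cong) auto
  also have "\<dots> = metric M c p i i" using assms(3) by simp
  finally show ?thesis .
qed

lemma metric_smooth:
  assumes "c \<in> atlas M" "i < n" "j < n"
  shows "smooth_in c (\<lambda>p. metric M c p i j)"
proof -
  interpret chart_domain "mtop M" n c "W c" using assms(1) by (rule chart_domain_U)
  have "chart_Cr (mtop M) n c r (dom_of c) (\<lambda>p. metric M c p i j)" for r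
    using metric assms unfolding riemannian_metric_def by blast
  then show ?thesis unfolding smooth_iff using chart_Cr_mono by blast
qed

lemma inverse_metric_smooth:
  assumes c: "c \<in> atlas M" and ij: "i < n" "j < n"
  shows "smooth_in c (\<lambda>p. inverse_metric M c p i j)"
    and "p \<in> W c \<Longrightarrow> left_inverse n (inverse_metric M c p) (metric M c p)"
proof -
  interpret chart_domain "mtop M" n c "W c" using c by (rule chart_domain_U)
  obtain H where H: "\<And>i j. i < n \<Longrightarrow> j < n \<Longrightarrow> smooth (\<lambda>p. H p i j)"
    "\<And>p. p \<in> W c \<Longrightarrow> left_inverse n (H p) (metric M c p)"
  proof -
    have "\<exists>H. (\<forall>i<n. \<forall>j<n. smooth (\<lambda>p. H p i j)) \<and> (\<forall>p\<in>W c. left_inverse n (H p) (metric M c p))"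
      by (rule smooth_left_inverse) (auto intro: metric_smooth[OF c] positive_definite_metric[OF c])
    then show ?thesis using that by blast
  qed
  have eq: "inverse_metric M c p = (\<lambda>i j. if i < n \<and> j < n then H p i j else 0)" if p: "p \<in> W c" for p
    unfolding inverse_metric_def
  proof (rule the_equality)
    show "(\<forall>i j. n \<le> i \<or> n \<le> j \<longrightarrow> (if i < n \<and> j < n then H p i j else 0) = 0) \<and>
      (\<forall>i<n. \<forall>k<n. (\<Sum>j<n. (if i < n \<and> j < n then H p i j else 0) * metric M c p j k) = (if i = k then 1 else 0))"
      using H(2)[OF p] by (auto simp: left_inverse_def)
  next
    fix h assume h: "(\<forall>i j. n \<le> i \<or> n \<le> j \<longrightarrow> h i j = 0) \<and>
      (\<forall>i<n. \<forall>k<n. (\<Sum>j<n. h i j * metric M c p j k) = (if i = k then 1 else 0))"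
    then have h': "left_inverse n h (metric M c p)" by (simp add: left_inverse_def)
    have pd: "positive_definite n (metric M c p)" using positive_definite_metric[OF c] p by blast
    show "h = (\<lambda>i j. if i < n \<and> j < n then H p i j else 0)"
      using left_inverse_unique[OF pd h' H(2)[OF p]] h by (intro ext) (auto simp: not_less)
  qed
  show "smooth (\<lambda>p. inverse_metric M c p i j)"
    by (rule smooth_cong[OF H(1)[OF ij]]) (simp add: eq ij)
  show "left_inverse n (inverse_metric M c p) (metric M c p)" if "p \<in> W c"
    using H(2)[OF that] by (simp add: eq[OF that] left_inverse_def)
qed

lemma christoffel_smooth:
  assumes c: "c \<in> atlas M" and "l < n" "i < n" "j < n"
  shows "smooth_in c (\<lambda>p. christoffel M c p l i j)"
proof -
  interpret chart_domain "mtop M" n c "W c" using c by (rule chart_domain_U)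
  show ?thesis
    unfolding christoffel_def
    using assms
    by (intro smooth_mult smooth_const smooth_sum smooth_add smooth_diff smooth_partial
      inverse_metric_smooth metric_smooth) auto
qed

definition smooth_tensor :: "nat \<Rightarrow> 'm tensor_field \<Rightarrow> bool"
  where "smooth_tensor m T \<longleftrightarrow>
    (\<forall>c\<in>atlas M. \<forall>I\<in>multi_indices n m. smooth_in c (\<lambda>p. T c p I))"

lemma smooth_tensorD: "smooth_tensor m T \<Longrightarrow> c \<in> atlas M \<Longrightarrow> I \<in> multi_indices n m \<Longrightarrow> smooth_in c (\<lambda>p. T c p I)"
  by (auto simp: smooth_tensor_def)

lemma cov_deriv_Cons:
  "I \<in> multi_indices n m \<Longrightarrow> cov_deriv M T c p (j # I) = chart_partial c j (\<lambda>q. T c q I) p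
    - (\<Sum>a<m. \<Sum>l<n. christoffel M c p l j (I ! a) * T c p (I[a := l]))"
  by (auto simp: cov_deriv_def multi_indices_def)

lemma smooth_cov_deriv:
  assumes T: "smooth_tensor m T"
  shows "smooth_tensor (Suc m) (cov_deriv M T)"
  unfolding smooth_tensor_def
proof (intro ballI)
  fix c J assume c: "c \<in> atlas M" and "J \<in> multi_indices n (Suc m)"
  then obtain j I where J: "J = j # I" "j < n" "I \<in> multi_indices n m" by (auto simp: multi_indices_Suc)
  interpret chart_domain "mtop M" n c "W c" using c by (rule chart_domain_U)
  have "smooth (\<lambda>p. chart_partial c j (\<lambda>q. T c q I) p
    - (\<Sum>a<m. \<Sum>l<n. christoffel M c p l j (I ! a) * T c p (I[a := l])))"
    using J smooth_tensorD[OF T c] multi_indices_nth multi_indices_update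
    by (intro smooth_diff smooth_partial smooth_sum smooth_mult christoffel_smooth[OF c]) auto
  then show "smooth (\<lambda>p. cov_deriv M T c p J)" by (simp add: J(1) cov_deriv_Cons[OF J(3)])
qed

lemma smooth_nabla: "smooth_tensor m T \<Longrightarrow> smooth_tensor (j + m) (nabla j T)"
  by (induction j) (auto intro: smooth_cov_deriv)

lemma cov_deriv_cong:
  assumes c: "c \<in> atlas M" and p: "p \<in> W c" and J: "J \<in> multi_indices n (Suc m)"
    and eq: "\<And>q I. q \<in> W c \<Longrightarrow> I \<in> multi_indices n m \<Longrightarrow> T c q I = S c q I"
  shows "cov_deriv M T c p J = cov_deriv M S c p J"
proof -
  interpret chart_domain "mtop M" n c "W c" using c by (rule chart_domain_U)
  obtain j I where J: "J = j # I" "j < n" "I \<in> multi_indices n m" using J by (auto simp: multi_indices_Suc)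
  have "chart_partial c j (\<lambda>q. T c q I) p = chart_partial c j (\<lambda>q. S c q I) p"
    by (rule chart_partial_cong(1)[OF p J(2)]) (rule eq[OF _ J(3)])
  then show ?thesis
    using eq[OF p] J(3) multi_indices_update by (simp add: J(1) cov_deriv_Cons)
qed

lemma cov_deriv_linear:
  assumes T: "smooth_tensor m T" and S: "smooth_tensor m S"
    and c: "c \<in> atlas M" and p: "p \<in> W c" and J: "J \<in> multi_indices n (Suc m)"
  shows "cov_deriv M (\<lambda>c p I. a * T c p I + S c p I) c p J = a * cov_deriv M T c p J + cov_deriv M S c p J"
proof -
  interpret chart_domain "mtop M" n c "W c" using c by (rule chart_domain_U)
  obtain j I where J: "J = j # I" "j < n" "I \<in> multi_indices n m" using J by (auto simp: multi_indices_Suc)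
  have dT: "chart_differentiable c j (\<lambda>q. T c q I) p" and dS: "chart_differentiable c j (\<lambda>q. S c q I) p"
    using smooth_differentiable[OF smooth_tensorD[OF T c J(3)] J(2) p]
      smooth_differentiable[OF smooth_tensorD[OF S c J(3)] J(2) p] by auto
  have "chart_partial c j (\<lambda>q. a * T c q I + S c q I) p =
      a * chart_partial c j (\<lambda>q. T c q I) p + chart_partial c j (\<lambda>q. S c q I) p"
    using chart_partial_add(2)[OF chart_partial_mult(1)[OF chart_partial_const(1)[where k = a] dT p] dS]
      chart_partial_mult(2)[OF chart_partial_const(1)[where k = a] dT p] chart_partial_const(2)[where k = a]
    by simp
  then show ?thesis
    by (simp add: J(1) cov_deriv_Cons[OF J(3)] distrib_left right_diff_distrib sum.distrib
      sum_distrib_left mult.left_commute)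
qed

lemma nabla_linear:
  assumes T: "smooth_tensor m T" and S: "smooth_tensor m S"
    and c: "c \<in> atlas M" and p: "p \<in> W c" and J: "J \<in> multi_indices n (j + m)"
  shows "nabla j (a *\<^sub>R T + S) c p J = a * nabla j T c p J + nabla j S c p J"
  using p J
proof (induction j arbitrary: p J)
  case 0
  then show ?case by (simp add: plus_fun_def scaleR_fun_def)
next
  case (Suc j)
  have "nabla (Suc j) (a *\<^sub>R T + S) c p J =
      cov_deriv M (\<lambda>c p I. a * nabla j T c p I + nabla j S c p I) c p J"
    unfolding funpow.simps(2) o_apply
  proof (rule cov_deriv_cong[where m = "j + m", OF c Suc.prems(1)])
    show "J \<in> multi_indices n (Suc (j + m))" using Suc.prems(2) by simp
  qed (rule Suc.IH)
  also have "\<dots> = a * cov_deriv M (nabla j T) c p J + cov_deriv M (nabla j S) c p J"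
    by (rule cov_deriv_linear[OF smooth_nabla[OF T] smooth_nabla[OF S] c Suc.prems(1)])
      (use Suc.prems(2) in simp)
  finally show ?case unfolding funpow.simps(2) o_apply .
qed

definition unit_vectors :: "'m chart \<Rightarrow> 'm \<Rightarrow> nat \<Rightarrow> (nat \<Rightarrow> nat \<Rightarrow> real) set"
  where "unit_vectors c p m = {v. \<forall>a<m. quadratic_form n (metric M c p) (v a) (v a) \<le> 1}"

lemma pointwise_norm_eq:
  "pointwise_norm M m T c p = Sup ((\<lambda>v. \<bar>tensor_value n m (T c p) v\<bar>) ` unit_vectors c p m)"
  unfolding pointwise_norm_def tensor_value_def unit_vectors_def quadratic_form_def
  by (rule arg_cong[where f = Sup]) auto

lemma tensor_value_bounded:
  assumes c: "c \<in> atlas M" and p: "p \<in> W c"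
  shows "\<exists>B. \<forall>v\<in>unit_vectors c p m. \<bar>tensor_value n m T v\<bar> \<le> B"
proof -
  let ?g = "metric M c p"
  obtain R where R: "\<And>v a i. v \<in> unit_vectors c p m \<Longrightarrow> a < m \<Longrightarrow> i < n \<Longrightarrow> \<bar>v a i\<bar> \<le> R i"
  proof (cases "n = 0")
    case False
    then have inv: "left_inverse n (inverse_metric M c p) ?g"
      using inverse_metric_smooth(2)[OF c, of 0 0 p] p by simp
    have pc: "p \<in> dom_of c" using p by simp
    have "\<bar>v a i\<bar> \<le> sqrt (quadratic_form n ?g (inverse_metric M c p i) (inverse_metric M c p i))"
      if "v \<in> unit_vectors c p m" "a < m" "i < n" for v a i
      using that
      by (intro positive_definite_component_bound[OF positive_definite_metric[OF c pc] metric_sym[OF c pc] inv])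
        (auto simp: unit_vectors_def)
    then show ?thesis by (rule that)
  qed (use that in simp)
  have "\<bar>tensor_value n m T v\<bar> \<le> (\<Sum>I\<in>multi_indices n m. \<bar>T I\<bar> * (\<Prod>a<m. R (I ! a)))"
    if v: "v \<in> unit_vectors c p m" for v
    unfolding tensor_value_def
  proof (intro order_trans[OF sum_abs] sum_mono)
    fix I assume I: "I \<in> multi_indices n m"
    have "(\<Prod>a<m. \<bar>v a (I ! a)\<bar>) \<le> (\<Prod>a<m. R (I ! a))"
      using R[OF v] multi_indices_nth[OF I] by (intro prod_mono) auto
    then show "\<bar>T I * (\<Prod>a<m. v a (I ! a))\<bar> \<le> \<bar>T I\<bar> * (\<Prod>a<m. R (I ! a))"
      by (simp add: abs_mult abs_prod mult_left_mono)
  qed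
  then show ?thesis by blast
qed

lemma pointwise_norm_le_iff:
  assumes c: "c \<in> atlas M" and p: "p \<in> W c"
  shows "pointwise_norm M m T c p \<le> B \<longleftrightarrow> (\<forall>v\<in>unit_vectors c p m. \<bar>tensor_value n m (T c p) v\<bar> \<le> B)"
proof -
  have "(\<lambda>_ _. 0) \<in> unit_vectors c p m" by (simp add: unit_vectors_def quadratic_form_def)
  then have ne: "unit_vectors c p m \<noteq> {}" by blast
  have bdd: "bdd_above ((\<lambda>v. \<bar>tensor_value n m (T c p) v\<bar>) ` unit_vectors c p m)"
    using tensor_value_bounded[OF c p, of m "T c p"] by (auto simp: bdd_above_def)
  show ?thesis
    unfolding pointwise_norm_eq using cSup_le_iff[OF _ bdd] ne by auto
qed

definition jet_bound :: "nat \<Rightarrow> 'm tensor_field \<Rightarrow> real \<Rightarrow> bool"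
  where "jet_bound r \<omega> B \<longleftrightarrow> (\<forall>j\<le>r. \<forall>c\<in>atlas M. \<forall>p\<in>W c. \<forall>v\<in>unit_vectors c p (j + k).
    \<bar>tensor_value n (j + k) (nabla j \<omega> c p) v\<bar> \<le> B)"

lemma jet_bound_iff: "jet_bound r \<omega> B \<longleftrightarrow> (\<forall>x\<in>deriv_norms M U k r \<omega>. x \<le> B)"
proof -
  have "jet_bound r \<omega> B \<longleftrightarrow> (\<forall>j\<le>r. \<forall>c\<in>atlas M. \<forall>p\<in>W c. pointwise_norm M (j + k) (nabla j \<omega>) c p \<le> B)"
    unfolding jet_bound_def using pointwise_norm_le_iff by auto
  then show ?thesis unfolding deriv_norms_def by blast
qed

lemma bdd_above_deriv_norms: "bdd_above (deriv_norms M U k r \<omega>) \<longleftrightarrow> (\<exists>B. jet_bound r \<omega> B)"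
  by (auto simp: bdd_above_def jet_bound_iff)

lemma Cr_norm_le: "jet_bound r \<omega> B \<Longrightarrow> 0 \<le> B \<Longrightarrow> Cr_norm M U k r \<omega> \<le> B"
  unfolding Cr_norm_def by (rule cSup_least) (auto simp: jet_bound_iff)

lemma jet_bound_Cr_norm:
  assumes "\<exists>B. jet_bound r \<omega> B"
  shows "jet_bound r \<omega> (Cr_norm M U k r \<omega>)" "0 \<le> Cr_norm M U k r \<omega>"
proof -
  have "bdd_above (insert 0 (deriv_norms M U k r \<omega>))" using assms bdd_above_deriv_norms by simp
  then show "jet_bound r \<omega> (Cr_norm M U k r \<omega>)" "0 \<le> Cr_norm M U k r \<omega>"
    unfolding Cr_norm_def jet_bound_iff by (auto intro: cSup_upper)
qed

abbreviation B where "B \<equiv> bounded_forms M U k"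

lemma bounded_forms_iff:
  "\<omega> \<in> B \<longleftrightarrow> components_on M U k \<omega> \<and> alternating k \<omega> \<and> covariant M U k \<omega> \<and>
    smooth_tensor k \<omega> \<and> (\<forall>r. \<exists>B. jet_bound r \<omega> B)"
proof -
  have "smooth_in c f \<longleftrightarrow> (\<forall>r. chart_Cr (mtop M) n c r (W c) f)" if "c \<in> atlas M" for c f
    using chart_domain.smooth_iff[OF chart_domain_U[OF that]] .
  then have "smooth_tensor k \<omega> \<longleftrightarrow> (\<forall>r. \<forall>c\<in>atlas M. \<forall>I\<in>multi_indices n k.
      chart_Cr (mtop M) n c r (W c) (\<lambda>p. \<omega> c p I))"
    unfolding smooth_tensor_def by blast
  then show ?thesis
    unfolding bounded_forms_def bounded_Cr_forms_def Cr_forms_def bdd_above_deriv_norms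
    by blast
qed

lemma tensor_value_linear:
  assumes "\<And>I. I \<in> multi_indices n m \<Longrightarrow> R I = a * T I + S I"
  shows "tensor_value n m R v = a * tensor_value n m T v + tensor_value n m S v"
  by (simp add: tensor_value_def assms distrib_right sum.distrib sum_distrib_left mult.assoc)

lemma tensor_value_nabla_linear:
  assumes "\<omega> \<in> B" "\<omega>' \<in> B" "c \<in> atlas M" "p \<in> W c"
  shows "tensor_value n (j + k) (nabla j (a *\<^sub>R \<omega> + \<omega>') c p) v =
    a * tensor_value n (j + k) (nabla j \<omega> c p) v + tensor_value n (j + k) (nabla j \<omega>' c p) v"
  using assms by (intro tensor_value_linear nabla_linear) (auto simp: bounded_forms_iff)

lemma jet_bound_linear:
  assumes "\<omega> \<in> B" "\<omega>' \<in> B" "jet_bound r \<omega> A" "jet_bound r \<omega>' A'"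
  shows "jet_bound r (a *\<^sub>R \<omega> + \<omega>') (\<bar>a\<bar> * A + A')"
  unfolding jet_bound_def
proof (intro allI impI ballI)
  fix j c p v assume h: "j \<le> r" "c \<in> atlas M" "p \<in> W c" "v \<in> unit_vectors c p (j + k)"
  let ?t = "\<lambda>\<omega>. tensor_value n (j + k) (nabla j \<omega> c p) v"
  have "\<bar>?t (a *\<^sub>R \<omega> + \<omega>')\<bar> \<le> \<bar>a\<bar> * \<bar>?t \<omega>\<bar> + \<bar>?t \<omega>'\<bar>"
    unfolding tensor_value_nabla_linear[OF assms(1,2) h(2,3)] abs_mult[symmetric] by (rule abs_triangle_ineq)
  also have "\<dots> \<le> \<bar>a\<bar> * A + A'"
    using assms(3,4) h unfolding jet_bound_def by (intro add_mono mult_left_mono) auto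
  finally show "\<bar>?t (a *\<^sub>R \<omega> + \<omega>')\<bar> \<le> \<bar>a\<bar> * A + A'" .
qed

lemma smooth_tensor_linear:
  assumes "smooth_tensor m T" "smooth_tensor m S"
  shows "smooth_tensor m (a *\<^sub>R T + S)"
  unfolding smooth_tensor_def
proof (intro ballI)
  fix c I assume c: "c \<in> atlas M" and I: "I \<in> multi_indices n m"
  interpret chart_domain "mtop M" n c "W c" using c by (rule chart_domain_U)
  show "smooth (\<lambda>p. (a *\<^sub>R T + S) c p I)"
    using assms c I unfolding smooth_tensor_def plus_fun_def scaleR_fun_def real_scaleR_def
    by (intro smooth_add smooth_mult smooth_const) auto
qed

lemma bounded_forms_linear:
  assumes w: "\<omega> \<in> B" "\<omega>' \<in> B"
  shows "a *\<^sub>R \<omega> + \<omega>' \<in> B"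
proof -
  have "components_on M U k (a *\<^sub>R \<omega> + \<omega>')" "alternating k (a *\<^sub>R \<omega> + \<omega>')"
    using w by (auto simp: bounded_forms_iff components_on_def alternating_def plus_fun_def scaleR_fun_def)
  moreover have "covariant M U k (a *\<^sub>R \<omega> + \<omega>')"
    unfolding covariant_def
  proof (intro ballI)
    fix c d p I
    assume h: "c \<in> atlas M" "d \<in> atlas M" "p \<in> dom_of c \<inter> dom_of d \<inter> U" "I \<in> multi_indices n k"
    have "\<omega> c p I = (\<Sum>K\<in>multi_indices n k. \<omega> d p K * (\<Prod>a<k. transition_deriv c d p (K ! a) (I ! a)))"
      "\<omega>' c p I = (\<Sum>K\<in>multi_indices n k. \<omega>' d p K * (\<Prod>a<k. transition_deriv c d p (K ! a) (I ! a)))"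
      using w h unfolding bounded_forms_iff covariant_def by blast+
    then show "(a *\<^sub>R \<omega> + \<omega>') c p I =
      (\<Sum>K\<in>multi_indices n k. (a *\<^sub>R \<omega> + \<omega>') d p K * (\<Prod>a<k. transition_deriv c d p (K ! a) (I ! a)))"
      by (simp add: plus_fun_def scaleR_fun_def distrib_right sum.distrib sum_distrib_left mult.assoc)
  qed
  moreover have "\<exists>B. jet_bound r (a *\<^sub>R \<omega> + \<omega>') B" for r
    using jet_bound_linear[OF w] w unfolding bounded_forms_iff by blast
  ultimately show ?thesis
    using w smooth_tensor_linear unfolding bounded_forms_iff by blast
qed

lemma zero_bounded_forms: "0 \<in> B"
proof -
  have z: "nabla j 0 c p J = 0" if "c \<in> atlas M" "p \<in> W c" "J \<in> multi_indices n (j + k)" for j c p J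
    using that
  proof (induction j arbitrary: p J)
    case (Suc j)
    interpret chart_domain "mtop M" n c "W c" using Suc.prems(1) by (rule chart_domain_U)
    obtain i I where J: "J = i # I" "i < n" "I \<in> multi_indices n (j + k)"
      using Suc.prems(3) by (auto simp: multi_indices_Suc)
    have "nabla (Suc j) 0 c p J = cov_deriv M (\<lambda>_ _ _. 0) c p J"
      unfolding funpow.simps(2) o_apply
    proof (rule cov_deriv_cong[where m = "j + k", OF Suc.prems(1,2)])
      show "J \<in> multi_indices n (Suc (j + k))" using Suc.prems(3) by simp
    qed (rule Suc.IH[OF Suc.prems(1)])
    also have "\<dots> = 0" by (simp add: J(1) cov_deriv_Cons[OF J(3)] chart_partial_const)
    finally show ?case .
  qed simp
  have "jet_bound r 0 0" for r
    unfolding jet_bound_def tensor_value_def using z by simp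
  moreover have "smooth_tensor k 0"
    unfolding smooth_tensor_def using chart_domain.smooth_const[OF chart_domain_U, of _ 0] by simp
  ultimately show ?thesis
    unfolding bounded_forms_iff by (auto simp: components_on_def alternating_def covariant_def)
qed

lemma subspace_bounded_forms: "subspace B"
proof (rule subspaceI)
  show "x + y \<in> B" if "x \<in> B" "y \<in> B" for x y using bounded_forms_linear[OF that, of 1] by simp
  show "a *\<^sub>R x \<in> B" if "x \<in> B" for a x using bounded_forms_linear[OF that zero_bounded_forms, of a] by simp
qed (rule zero_bounded_forms)

lemma seminorm_on_Cr_norm: "seminorm_on B (Cr_norm M U k r)"
proof (unfold seminorm_on_def, intro conjI ballI allI)
  have bnd: "jet_bound r \<omega> (Cr_norm M U k r \<omega>)" "0 \<le> Cr_norm M U k r \<omega>" if "\<omega> \<in> B" for \<omega>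
    using that jet_bound_Cr_norm[of r \<omega>] unfolding bounded_forms_iff by blast+
  show "Cr_norm M U k r (x + y) \<le> Cr_norm M U k r x + Cr_norm M U k r y" if "x \<in> B" "y \<in> B" for x y
    using jet_bound_linear[OF that bnd(1)[OF that(1)] bnd(1)[OF that(2)], of 1] bnd(2) that
    by (intro Cr_norm_le) auto
  have j0: "jet_bound r 0 0"
    using jet_bound_linear[OF zero_bounded_forms zero_bounded_forms
        bnd(1)[OF zero_bounded_forms] bnd(1)[OF zero_bounded_forms], of "- 1"]
      tensor_value_nabla_linear[OF zero_bounded_forms zero_bounded_forms, of _ _ _ "- 1"]
    unfolding jet_bound_def by simp
  have le: "Cr_norm M U k r (a *\<^sub>R x) \<le> \<bar>a\<bar> * Cr_norm M U k r x" if "x \<in> B" for a x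
    using jet_bound_linear[OF that zero_bounded_forms bnd(1)[OF that] j0, of a] bnd(2)[OF that]
    by (intro Cr_norm_le) auto
  show "Cr_norm M U k r (a *\<^sub>R x) = \<bar>a\<bar> * Cr_norm M U k r x" if x: "x \<in> B" for a x
  proof (cases "a = 0")
    case True
    then show ?thesis using le[OF x, of 0] bnd(2)[OF zero_bounded_forms] by simp
  next
    case False
    have "Cr_norm M U k r (inverse a *\<^sub>R (a *\<^sub>R x)) \<le> \<bar>inverse a\<bar> * Cr_norm M U k r (a *\<^sub>R x)"
      using x subspace_bounded_forms by (intro le) (auto simp: subspace_scale)
    then have "\<bar>a\<bar> * Cr_norm M U k r x \<le> Cr_norm M U k r (a *\<^sub>R x)"
      using False by (simp add: field_simps)
    then show ?thesis using le[OF x, of a] by simp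
  qed
qed

lemma seminorm_family_bounded_forms: "seminorm_family B (range (Cr_norm M U k))"
  using subspace_bounded_forms seminorm_on_Cr_norm by unfold_locales auto

lemma bounded_in_bounded_forms_iff:
  "bounded_in (bounded_forms_topology M U k) D \<longleftrightarrow> D \<subseteq> B \<and> (\<forall>r. \<exists>C. \<forall>\<omega>\<in>D. jet_bound r \<omega> C)"
proof -
  have eq: "(\<exists>C. \<forall>\<omega>\<in>D. Cr_norm M U k r \<omega> \<le> C) \<longleftrightarrow> (\<exists>C. \<forall>\<omega>\<in>D. jet_bound r \<omega> C)" if D: "D \<subseteq> B" for r
  proof
    assume "\<exists>C. \<forall>\<omega>\<in>D. Cr_norm M U k r \<omega> \<le> C"
    then obtain C where C: "\<forall>\<omega>\<in>D. Cr_norm M U k r \<omega> \<le> C" by blast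
    have "jet_bound r \<omega> C" if "\<omega> \<in> D" for \<omega>
    proof -
      have "jet_bound r \<omega> (Cr_norm M U k r \<omega>)"
        using that D jet_bound_Cr_norm(1)[of r \<omega>] unfolding bounded_forms_iff subset_iff by blast
      then show ?thesis using C that unfolding jet_bound_iff by force
    qed
    then show "\<exists>C. \<forall>\<omega>\<in>D. jet_bound r \<omega> C" by blast
  next
    assume "\<exists>C. \<forall>\<omega>\<in>D. jet_bound r \<omega> C"
    then obtain C where C: "\<forall>\<omega>\<in>D. jet_bound r \<omega> C" by blast
    have "Cr_norm M U k r \<omega> \<le> \<bar>C\<bar>" if "\<omega> \<in> D" for \<omega>
      using C that by (intro Cr_norm_le) (force simp: jet_bound_iff)+
    then show "\<exists>C. \<forall>\<omega>\<in>D. Cr_norm M U k r \<omega> \<le> C" by blast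
  qed
  show ?thesis
    unfolding bounded_forms_topology_def seminorm_family.bounded_in_iff[OF seminorm_family_bounded_forms]
    using eq by auto
qed

end

context riemannian_open
begin

lemma component_le_jet_bound:
  assumes b: "jet_bound r \<omega> C" and j: "j \<le> r" and c: "c \<in> atlas M" and p: "p \<in> W c"
    and I: "I \<in> multi_indices n (j + k)"
  shows "\<bar>nabla j \<omega> c p I\<bar> \<le> C * (\<Prod>a<j + k. 1 + metric M c p (I ! a) (I ! a))"
proof -
  let ?g = "\<lambda>a. 1 + metric M c p (I ! a) (I ! a)" and ?m = "j + k" and ?T = "nabla j \<omega> c p"
  have g: "?g a > 1" if "a < ?m" for a
    using metric_diag_pos[OF c, of p "I ! a"] p multi_indices_nth[OF I that] by simp
  define v where "v a i = (if i = I ! a then inverse (?g a) else 0)" for a i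
  have "quadratic_form n (metric M c p) (v a) (v a) \<le> 1" if a: "a < ?m" for a
  proof -
    have "quadratic_form n (metric M c p) (v a) (v a) = (\<Sum>i<n. \<Sum>l<n. if l = I ! a then
        if i = I ! a then metric M c p (I ! a) (I ! a) * (inverse (?g a) * inverse (?g a)) else 0 else 0)"
      unfolding quadratic_form_def v_def by (intro sum.cong) auto
    also have "\<dots> = metric M c p (I ! a) (I ! a) * (inverse (?g a) * inverse (?g a))"
      using multi_indices_nth[OF I a] by simp
    also have "\<dots> \<le> ?g a * (inverse (?g a) * 1)"
      using g[OF a] by (intro mult_mono mult_left_mono) (auto simp: inverse_le_1_iff)
    finally show ?thesis using g[OF a] by simp
  qed
  then have "v \<in> unit_vectors c p ?m" by (simp add: unit_vectors_def)
  then have "\<bar>tensor_value n ?m ?T v\<bar> \<le> C" using b j c p unfolding jet_bound_def by blast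
  also have "tensor_value n ?m ?T v =
      (\<Sum>K\<in>multi_indices n ?m. if K = I then ?T I * (\<Prod>a<?m. inverse (?g a)) else 0)"
    unfolding tensor_value_def
  proof (intro sum.cong refl)
    fix K assume K: "K \<in> multi_indices n ?m"
    show "?T K * (\<Prod>a<?m. v a (K ! a)) = (if K = I then ?T I * (\<Prod>a<?m. inverse (?g a)) else 0)"
    proof (cases "K = I")
      case False
      then obtain a where "a < ?m" "K ! a \<noteq> I ! a"
        using K I by (auto simp: multi_indices_def list_eq_iff_nth_eq)
      then have "(\<Prod>a<?m. v a (K ! a)) = 0" by (intro prod_zero) (auto simp: v_def)
      then show ?thesis using False by simp
    qed (simp add: v_def)
  qed
  also have "\<dots> = ?T I * inverse (\<Prod>a<?m. ?g a)"
    using I finite_multi_indices by (simp add: prod_inversef[symmetric] o_def)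
  finally have "\<bar>?T I * inverse (\<Prod>a<?m. ?g a)\<bar> \<le> C" .
  moreover have pos: "(\<Prod>a<?m. ?g a) > 0"
  proof (rule prod_pos)
    fix a assume "a \<in> {..<?m}"
    then show "?g a > 0" using g[of a] by simp
  qed
  ultimately have "\<bar>?T I\<bar> / (\<Prod>a<?m. ?g a) \<le> C"
    unfolding abs_mult abs_inverse divide_inverse by (simp only: abs_of_pos)
  then show ?thesis unfolding pos_divide_le_eq[OF pos] .
qed

theorem nabla_family:
  assumes D: "D \<subseteq> B" and bounded: "\<And>r. \<exists>C. \<forall>\<omega>\<in>D. jet_bound r \<omega> C"
    and c: "c \<in> atlas M" and I: "I \<in> multi_indices n (j + k)"
  shows "chart_domain.Cr_family (mtop M) n c (W c) r D (\<lambda>\<omega> p. nabla j \<omega> c p I)"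
proof -
  interpret chart_domain "mtop M" n c "W c" using c by (rule chart_domain_U)
  have sm: "smooth (\<lambda>p. nabla j \<omega> c p I)" if "\<omega> \<in> D" "I \<in> multi_indices n (j + k)" for \<omega> j I
  proof -
    have "smooth_tensor k \<omega>" using that(1) D by (auto simp: bounded_forms_iff)
    then show ?thesis by (rule smooth_tensorD[OF smooth_nabla c that(2)])
  qed
  have C0: "C0_family D (\<lambda>\<omega> p. nabla j \<omega> c p I)" if I: "I \<in> multi_indices n (j + k)" for j I
  proof -
    obtain C where C: "\<And>\<omega>. \<omega> \<in> D \<Longrightarrow> jet_bound j \<omega> C" using bounded by blast
    have "smooth (\<lambda>p. \<Prod>a\<in>A. 1 + metric M c p (I ! a) (I ! a))" if "finite A" "A \<subseteq> {..<j + k}" for A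
      using that
    proof (induction A rule: finite_induct)
      case empty
      show ?case by (simp add: smooth_const)
    next
      case (insert a A)
      then show ?case
        using multi_indices_nth[OF I] by (simp add: smooth_mult smooth_add smooth_const metric_smooth[OF c])
    qed
    from this[of "{..<j + k}"] have "smooth (\<lambda>p. C * (\<Prod>a<j + k. 1 + metric M c p (I ! a) (I ! a)))"
      by (simp add: smooth_mult smooth_const)
    then have "C0_family {()} (\<lambda>_ p. C * (\<Prod>a<j + k. 1 + metric M c p (I ! a) (I ! a)))"
      by (simp add: C0_family_single smooth_continuous)
    then have lb: "\<exists>N A. openin (mtop M) N \<and> p \<in> N \<and>
        (\<forall>q\<in>N \<inter> W c. \<bar>C * (\<Prod>a<j + k. 1 + metric M c q (I ! a) (I ! a))\<bar> \<le> A)" if "p \<in> W c" for p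
      using that unfolding C0_family_def locally_bounded_def by simp
    have "locally_bounded D (\<lambda>\<omega> p. nabla j \<omega> c p I)"
      unfolding locally_bounded_def
    proof
      fix p assume "p \<in> W c"
      then obtain N A where N: "openin (mtop M) N" "p \<in> N"
        "\<forall>q\<in>N \<inter> W c. \<bar>C * (\<Prod>a<j + k. 1 + metric M c q (I ! a) (I ! a))\<bar> \<le> A"
        using lb by blast
      have "\<bar>nabla j \<omega> c q I\<bar> \<le> A" if "\<omega> \<in> D" "q \<in> N \<inter> W c" for \<omega> q
      proof -
        have "\<bar>nabla j \<omega> c q I\<bar> \<le> C * (\<Prod>a<j + k. 1 + metric M c q (I ! a) (I ! a))"
          using component_le_jet_bound[OF C[OF that(1)] order_refl c _ I] that(2) by blast
        then show ?thesis using bspec[OF N(3) that(2)] by linarith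
      qed
      then show "\<exists>N A. openin (mtop M) N \<and> p \<in> N \<and> (\<forall>\<omega>\<in>D. \<forall>q\<in>N \<inter> W c. \<bar>nabla j \<omega> c q I\<bar> \<le> A)"
        using N by blast
    qed
    then show ?thesis using smooth_continuous[OF sm[OF _ I]] by (simp add: C0_family_def)
  qed
  show "Cr_family r D (\<lambda>\<omega> p. nabla j \<omega> c p I)"
    using I
  proof (induction r arbitrary: j I)
    case 0
    then show ?case by (simp add: C0)
  next
    case (Suc r)
    have "Cr_family r D (\<lambda>\<omega>. chart_partial c i (\<lambda>p. nabla j \<omega> c p I))" if i: "i < n" for i
    proof -
      have iI: "i # I \<in> multi_indices n (Suc j + k)"
        using Suc.prems i by (auto simp: multi_indices_def)
      have "Cr_family r D (\<lambda>\<omega> p. nabla (Suc j) \<omega> c p (i # I) +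
          (\<Sum>a<j + k. \<Sum>l<n. christoffel M c p l i (I ! a) * nabla j \<omega> c p (I[a := l])))"
        using iI multi_indices_nth[OF Suc.prems] i
        by (intro Cr_family_add Cr_family_sum Cr_family_mult smooth_family christoffel_smooth[OF c]
            Suc.IH multi_indices_update[OF Suc.prems]) auto
      then show ?thesis
        by (rule Cr_family_cong) (simp add: cov_deriv_Cons[OF Suc.prems])
    qed
    then show ?case
      using C0[OF Suc.prems] smooth_differentiable[OF sm[OF _ Suc.prems]] by simp
  qed
qed

end

context chart_domain
begin

lemma smooth_first_order:
  assumes f: "smooth f" and p: "p \<in> W" and e: "\<epsilon> > 0"
  obtains \<delta> where "\<delta> > 0" "\<And>q. q \<in> W \<Longrightarrow> (\<And>i. i < n \<Longrightarrow> \<bar>coord c q i - coord c p i\<bar> < \<delta>) \<Longrightarrow>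
    \<bar>f q - f p - (\<Sum>i<n. chart_partial c i f p * (coord c q i - coord c p i))\<bar> \<le>
      \<epsilon> * (\<Sum>i<n. \<bar>coord c q i - coord c p i\<bar>)"
proof -
  have "openin X {q \<in> W. \<forall>i\<in>{..<m}. \<bar>chart_partial c i f q - chart_partial c i f p\<bar> < \<epsilon>}" if "m \<le> n" for m
    using that
  proof (induction m)
    case (Suc m)
    have "openin (subtopology X W) {q \<in> topspace (subtopology X W). chart_partial c m f q \<in> ball (chart_partial c m f p) \<epsilon>}"
      using Suc by (intro openin_continuous_map_preimage[OF smooth_continuous[OF smooth_partial[OF f]]]) auto
    then have "openin X {q \<in> W. \<bar>chart_partial c m f q - chart_partial c m f p\<bar> < \<epsilon>}"
      unfolding openin_open_subtopology[OF W] topspace_W by (simp add: dist_real_def abs_minus_commute)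
    then have "openin X ({q \<in> W. \<bar>chart_partial c m f q - chart_partial c m f p\<bar> < \<epsilon>} \<inter>
        {q \<in> W. \<forall>i\<in>{..<m}. \<bar>chart_partial c i f q - chart_partial c i f p\<bar> < \<epsilon>})"
      using Suc by (intro openin_Int) auto
    also have "{q \<in> W. \<bar>chart_partial c m f q - chart_partial c m f p\<bar> < \<epsilon>} \<inter>
        {q \<in> W. \<forall>i\<in>{..<m}. \<bar>chart_partial c i f q - chart_partial c i f p\<bar> < \<epsilon>} =
        {q \<in> W. \<forall>i\<in>{..<Suc m}. \<bar>chart_partial c i f q - chart_partial c i f p\<bar> < \<epsilon>}"
      by (auto simp: less_Suc_eq)
    finally show ?case .
  qed (use W in simp)
  from this[OF order_refl]
  have "openin X {q \<in> W. \<forall>i\<in>{..<n}. \<bar>chart_partial c i f q - chart_partial c i f p\<bar> < \<epsilon>}" .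
  moreover have "p \<in> {q \<in> W. \<forall>i\<in>{..<n}. \<bar>chart_partial c i f q - chart_partial c i f p\<bar> < \<epsilon>}"
    using p e by simp
  ultimately obtain \<delta>\<^sub>1 where d1: "\<delta>\<^sub>1 > 0" "\<And>q. q \<in> W \<Longrightarrow> (\<And>i. i < n \<Longrightarrow> \<bar>coord c q i - coord c p i\<bar> < \<delta>\<^sub>1) \<Longrightarrow>
      q \<in> {q \<in> W. \<forall>i\<in>{..<n}. \<bar>chart_partial c i f q - chart_partial c i f p\<bar> < \<epsilon>}"
    using box_subset_open[OF _ _ p] by blast
  obtain \<delta>\<^sub>2 where d2: "\<delta>\<^sub>2 > 0" "\<And>z. \<lbrakk>\<And>i. i \<ge> n \<Longrightarrow> z i = 0; \<And>i. i < n \<Longrightarrow> \<bar>z i - coord c p i\<bar> < \<delta>\<^sub>2\<rbrakk> \<Longrightarrow>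
      chart_inv c z \<in> W \<and> coord c (chart_inv c z) = z"
    using cube[OF p] by blast
  show ?thesis
  proof (rule that[of "min \<delta>\<^sub>1 \<delta>\<^sub>2"])
    show "min \<delta>\<^sub>1 \<delta>\<^sub>2 > 0" using d1 d2 by simp
    fix q assume q: "q \<in> W" "\<And>i. i < n \<Longrightarrow> \<bar>coord c q i - coord c p i\<bar> < min \<delta>\<^sub>1 \<delta>\<^sub>2"
    show "\<bar>f q - f p - (\<Sum>i<n. chart_partial c i f p * (coord c q i - coord c p i))\<bar> \<le>
      \<epsilon> * (\<Sum>i<n. \<bar>coord c q i - coord c p i\<bar>)"
    proof (rule cube_mean_value[where \<delta> = "min \<delta>\<^sub>1 \<delta>\<^sub>2"])
      show "chart_inv c z \<in> W \<and> coord c (chart_inv c z) = z"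
        if "\<And>i. i \<ge> n \<Longrightarrow> z i = 0" "\<And>i. i < n \<Longrightarrow> \<bar>z i - coord c p i\<bar> < min \<delta>\<^sub>1 \<delta>\<^sub>2" for z
        using that by (intro d2(2)) auto
      show "\<bar>chart_partial c i f q - chart_partial c i f p\<bar> \<le> \<epsilon>"
        if "i < n" "q \<in> W" "\<And>i. i < n \<Longrightarrow> \<bar>coord c q i - coord c p i\<bar> < min \<delta>\<^sub>1 \<delta>\<^sub>2" for i q
        using d1(2)[of q] that by (auto intro: less_imp_le)
    qed (use smooth_differentiable[OF f] p q in auto)
  qed
qed

lemma smooth_chain_rule:
  assumes f: "smooth f" and p: "p \<in> W" and q0: "q t\<^sub>0 = p"
    and q: "\<forall>\<^sub>F t in at t\<^sub>0. q t \<in> W"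
    and y: "\<And>i. i < n \<Longrightarrow> ((\<lambda>t. coord c (q t) i) has_real_derivative D i) (at t\<^sub>0)"
  shows "((\<lambda>t. f (q t)) has_real_derivative (\<Sum>i<n. chart_partial c i f p * D i)) (at t\<^sub>0)"
proof -
  let ?y = "\<lambda>t i. coord c (q t) i - coord c p i"
  define R where "R t = f (q t) - f p - (\<Sum>i<n. chart_partial c i f p * ?y t i)" for t
  define L where "L = (\<Sum>i<n. \<bar>D i\<bar>) + 1"
  have L: "L > 0" unfolding L_def by (simp add: add_nonneg_pos sum_nonneg)
  have quot: "((\<lambda>t. ?y t i / (t - t\<^sub>0)) \<longlongrightarrow> D i) (at t\<^sub>0)" if "i < n" for i
    using y[OF that] unfolding has_field_derivative_iff q0 .
  have "((\<lambda>t. \<Sum>i<n. \<bar>?y t i / (t - t\<^sub>0)\<bar>) \<longlongrightarrow> (\<Sum>i<n. \<bar>D i\<bar>)) (at t\<^sub>0)"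
    using quot by (intro tendsto_sum tendsto_rabs) auto
  then have evL: "\<forall>\<^sub>F t in at t\<^sub>0. (\<Sum>i<n. \<bar>?y t i / (t - t\<^sub>0)\<bar>) < L"
    by (rule order_tendstoD) (simp add: L_def)
  have small: "\<forall>\<^sub>F t in at t\<^sub>0. \<forall>i\<in>{..<n}. \<bar>?y t i\<bar> < \<delta>" if "\<delta> > 0" for \<delta>
  proof (rule eventually_ball_finite)
    show "\<forall>i\<in>{..<n}. \<forall>\<^sub>F t in at t\<^sub>0. \<bar>?y t i\<bar> < \<delta>"
    proof
      fix i assume "i \<in> {..<n}"
      then have "isCont (\<lambda>t. coord c (q t) i) t\<^sub>0" using y DERIV_isCont by blast
      then have "((\<lambda>t. coord c (q t) i) \<longlongrightarrow> coord c p i) (at t\<^sub>0)" by (simp add: isCont_def q0)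
      then show "\<forall>\<^sub>F t in at t\<^sub>0. \<bar>?y t i\<bar> < \<delta>" using tendstoD[OF _ that] by (force simp: dist_real_def)
    qed
  qed simp
  have "((\<lambda>t. R t / (t - t\<^sub>0)) \<longlongrightarrow> 0) (at t\<^sub>0)"
  proof (rule tendstoI)
    fix e :: real assume e: "e > 0"
    define \<epsilon> where "\<epsilon> = e / L"
    have \<epsilon>: "\<epsilon> > 0" using e L by (simp add: \<epsilon>_def)
    obtain \<delta> where \<delta>: "\<delta> > 0" "\<And>q. q \<in> W \<Longrightarrow> (\<And>i. i < n \<Longrightarrow> \<bar>coord c q i - coord c p i\<bar> < \<delta>) \<Longrightarrow>
        \<bar>f q - f p - (\<Sum>i<n. chart_partial c i f p * (coord c q i - coord c p i))\<bar> \<le>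
          \<epsilon> * (\<Sum>i<n. \<bar>coord c q i - coord c p i\<bar>)"
      using smooth_first_order[OF f p \<epsilon>] by blast
    show "\<forall>\<^sub>F t in at t\<^sub>0. dist (R t / (t - t\<^sub>0)) 0 < e"
      using q small[OF \<delta>(1)] evL
    proof eventually_elim
      case (elim t)
      have "\<bar>R t\<bar> \<le> \<epsilon> * (\<Sum>i<n. \<bar>?y t i\<bar>)" unfolding R_def using elim by (intro \<delta>(2)) auto
      then have "\<bar>R t\<bar> / \<bar>t - t\<^sub>0\<bar> \<le> \<epsilon> * (\<Sum>i<n. \<bar>?y t i\<bar>) / \<bar>t - t\<^sub>0\<bar>" by (intro divide_right_mono) auto
      also have "\<dots> = \<epsilon> * (\<Sum>i<n. \<bar>?y t i / (t - t\<^sub>0)\<bar>)" by (simp add: sum_divide_distrib[symmetric])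
      also have "\<dots> < \<epsilon> * L" using elim \<epsilon> by (intro mult_strict_left_mono) auto
      also have "\<dots> = e" using L by (simp add: \<epsilon>_def)
      finally show ?case by (simp add: dist_real_def)
    qed
  qed
  then have "(R has_real_derivative 0) (at t\<^sub>0)"
    unfolding has_field_derivative_iff by (simp add: R_def q0)
  moreover have "((\<lambda>t. \<Sum>i<n. chart_partial c i f p * ?y t i) has_real_derivative
      (\<Sum>i<n. chart_partial c i f p * D i)) (at t\<^sub>0)"
    using y by (intro DERIV_sum DERIV_cmult) (auto intro!: derivative_eq_intros)
  ultimately have "((\<lambda>t. R t + (\<Sum>i<n. chart_partial c i f p * ?y t i) + f p) has_real_derivative
      0 + (\<Sum>i<n. chart_partial c i f p * D i) + 0) (at t\<^sub>0)"
    by (intro DERIV_add DERIV_const)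
  then show ?thesis by (simp add: R_def)
qed

end

context riemannian_open
begin

lemma transition_smooth:
  assumes "c \<in> atlas M" "d \<in> atlas M" "i < n"
  shows "chart_domain.smooth (mtop M) n c (dom_of c \<inter> dom_of d) (\<lambda>q. coord d q i)"
proof -
  have "is_chart (mtop M) n d" using atlas assms by (auto simp: smooth_atlas_def)
  then interpret chart_domain "mtop M" n c "dom_of c \<inter> dom_of d"
    by (intro chart_domain_Int assms) (simp add: is_chart_def)
  show ?thesis
    unfolding smooth_iff using atlas assms unfolding smooth_atlas_def by blast
qed

lemma transition_deriv_trans:
  assumes c: "c \<in> atlas M" and d: "d \<in> atlas M" and e: "e \<in> atlas M"
    and p: "p \<in> dom_of c \<inter> dom_of d \<inter> dom_of e" and ij: "i < n" "j < n"
  shows "transition_deriv c e p i j = (\<Sum>l<n. transition_deriv d e p i l * transition_deriv c d p l j)"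
proof -
  have op: "openin (mtop M) (dom_of d)" "openin (mtop M) (dom_of e)"
    using atlas d e by (auto simp: smooth_atlas_def is_chart_def)
  interpret d: chart_domain "mtop M" n d "dom_of d \<inter> dom_of e" by (rule chart_domain_Int[OF d op(2)])
  interpret cd: chart_domain "mtop M" n c "dom_of c \<inter> dom_of d" by (rule chart_domain_Int[OF c op(1)])
  interpret cde: chart_domain "mtop M" n c "dom_of c \<inter> (dom_of d \<inter> dom_of e)"
    by (rule chart_domain_Int[OF c]) (use op in auto)
  have pW: "p \<in> dom_of c \<inter> (dom_of d \<inter> dom_of e)" using p by auto
  have "((\<lambda>t. coord e (chart_line c j p t) i) has_real_derivative
      (\<Sum>l<n. chart_partial d l (\<lambda>q. coord e q i) p * transition_deriv c d p l j)) (at (coord c p j))"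
  proof (rule d.smooth_chain_rule)
    show "d.smooth (\<lambda>q. coord e q i)" by (rule transition_smooth[OF d e ij(1)])
    show "p \<in> dom_of d \<inter> dom_of e" using p by simp
    show "chart_line c j p (coord c p j) = p" by (rule cde.chart_line_same[OF pW])
    show "\<forall>\<^sub>F t in at (coord c p j). chart_line c j p t \<in> dom_of d \<inter> dom_of e"
      using cde.chart_line_nhds[OF pW ij(2)] unfolding eventually_at_filter
      by (rule eventually_mono) simp
    fix l assume l: "l < n"
    show "((\<lambda>t. coord d (chart_line c j p t) l) has_real_derivative transition_deriv c d p l j) (at (coord c p j))"
    proof -
      have "chart_differentiable c j (\<lambda>q. coord d q l) p"
        using cd.smooth_differentiable[OF transition_smooth[OF c d l] ij(2)] p by simp
      then show ?thesis
        unfolding transition_deriv_def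
        by (rule chart_differentiable_iff[where f = "\<lambda>q. coord d q l", THEN iffD1])
    qed
  qed
  then show ?thesis unfolding transition_deriv_def by (rule chart_partialI)
qed

lemma transition_deriv_same:
  assumes c: "c \<in> atlas M" and p: "p \<in> dom_of c" and ij: "i < n" "j < n"
  shows "transition_deriv c c p i j = (if i = j then 1 else 0)"
proof -
  have op: "openin (mtop M) (dom_of c)" using atlas c by (auto simp: smooth_atlas_def is_chart_def)
  interpret chart_domain "mtop M" n c "dom_of c \<inter> dom_of c" by (rule chart_domain_Int[OF c op])
  show ?thesis unfolding transition_deriv_def using chart_partial_coord[of p j i] p ij by simp
qed

end

section \<open>Pointed chains\<close>

lemma swap_entries_nth:
  assumes "length I = k" "i < k" "j < k" "a < k"
  shows "I[i := I ! j, j := I ! i] ! a = I ! (Transposition.transpose i j a)"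
  using assms by (auto simp: nth_list_update Transposition.transpose_def)

lemma swap_entries_multi_indices:
  assumes "length I = k" "i < k" "j < k"
  shows "I[i := I ! j, j := I ! i] \<in> multi_indices n k \<longleftrightarrow> I \<in> multi_indices n k"
proof -
  have "set (I[i := I ! j, j := I ! i]) = set I" using assms by (simp add: set_swap)
  then show ?thesis using assms by (simp add: multi_indices_def)
qed

lemma swap_entries_involution:
  assumes "length I = k" "i < k" "j < k"
  defines "I' \<equiv> I[i := I ! j, j := I ! i]"
  shows "I'[i := I' ! j, j := I' ! i] = I"
proof (rule nth_equalityI)
  fix a assume "a < length (I'[i := I' ! j, j := I' ! i])"
  then have a: "a < k" using assms by simp
  have t: "Transposition.transpose i j a < k" using assms a by (auto simp: Transposition.transpose_def)
  show "I'[i := I' ! j, j := I' ! i] ! a = I ! a"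
    using swap_entries_nth[of I' k i j a] swap_entries_nth[of I k i j "Transposition.transpose i j a"] assms a t
    by simp
qed (simp add: assms)

definition alternating_basis :: "nat list \<Rightarrow> nat \<Rightarrow> nat list \<Rightarrow> real"
  where "alternating_basis I\<^sub>0 k I = (\<Sum>\<pi> | \<pi> permutes {..<k}.
    of_int (sign \<pi>) * (if I = map (\<lambda>a. I\<^sub>0 ! \<pi> a) [0..<k] then 1 else 0))"

lemma alternating_basis_swap:
  assumes I: "length I = k" and ij: "i < j" "j < k"
  shows "alternating_basis I\<^sub>0 k (I[i := I ! j, j := I ! i]) = - alternating_basis I\<^sub>0 k I"
proof -
  let ?t = "Transposition.transpose i j" and ?I = "I[i := I ! j, j := I ! i]"
  have t: "?t permutes {..<k}" using ij by (intro permutes_swap_id) auto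
  have "?I = map (\<lambda>a. I\<^sub>0 ! \<pi> a) [0..<k] \<longleftrightarrow> I = map (\<lambda>a. I\<^sub>0 ! (\<pi> \<circ> ?t) a) [0..<k]" for \<pi>
  proof -
    have "?I = map (\<lambda>a. I\<^sub>0 ! \<pi> a) [0..<k] \<longleftrightarrow> (\<forall>a<k. I ! ?t a = I\<^sub>0 ! \<pi> a)"
      using I ij swap_entries_nth[OF I, of i j] by (auto simp: list_eq_iff_nth_eq)
    also have "\<dots> \<longleftrightarrow> (\<forall>a<k. I ! a = I\<^sub>0 ! \<pi> (?t a))"
    proof (intro iffI allI impI)
      fix a assume "\<forall>a<k. I ! ?t a = I\<^sub>0 ! \<pi> a" "a < k"
      then show "I ! a = I\<^sub>0 ! \<pi> (?t a)" using permutes_in_image[OF t, of a] by force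
    next
      fix a assume "\<forall>a<k. I ! a = I\<^sub>0 ! \<pi> (?t a)" "a < k"
      then show "I ! ?t a = I\<^sub>0 ! \<pi> a" using permutes_in_image[OF t, of a] by force
    qed
    also have "\<dots> \<longleftrightarrow> I = map (\<lambda>a. I\<^sub>0 ! (\<pi> \<circ> ?t) a) [0..<k]"
      using I by (auto simp: list_eq_iff_nth_eq)
    finally show ?thesis .
  qed
  then have "alternating_basis I\<^sub>0 k ?I = (\<Sum>\<pi> | \<pi> permutes {..<k}.
      of_int (sign \<pi>) * (if I = map (\<lambda>a. I\<^sub>0 ! (\<pi> \<circ> ?t) a) [0..<k] then 1 else 0))"
    unfolding alternating_basis_def by simp
  also have "\<dots> = (\<Sum>\<pi> | \<pi> permutes {..<k}.
      - (of_int (sign (\<pi> \<circ> ?t)) * (if I = map (\<lambda>a. I\<^sub>0 ! (\<pi> \<circ> ?t) a) [0..<k] then 1 else 0)))"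
  proof (intro sum.cong refl)
    fix \<pi> assume "\<pi> \<in> {\<pi>. \<pi> permutes {..<k}}"
    then have "permutation \<pi>" "permutation ?t"
      using t by (auto intro: permutes_imp_permutation[OF finite_lessThan])
    then have "sign (\<pi> \<circ> ?t) = - sign \<pi>" using ij by (simp add: sign_compose sign_swap_id)
    then show "of_int (sign \<pi>) * (if I = map (\<lambda>a. I\<^sub>0 ! (\<pi> \<circ> ?t) a) [0..<k] then 1 else 0) =
      - (of_int (sign (\<pi> \<circ> ?t)) * (if I = map (\<lambda>a. I\<^sub>0 ! (\<pi> \<circ> ?t) a) [0..<k] then 1 else (0::real)))"
      by simp
  qed
  also have "\<dots> = - alternating_basis I\<^sub>0 k I"
    unfolding alternating_basis_def sum_negf
    using sum_permutations_compose_right[OF t, of "\<lambda>\<pi>. of_int (sign \<pi>) *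
      (if I = map (\<lambda>a. I\<^sub>0 ! \<pi> a) [0..<k] then 1 else (0::real))"] by simp
  finally show ?thesis .
qed

lemma alternating_basis_increasing:
  assumes I0: "sorted_wrt (<) I\<^sub>0" "length I\<^sub>0 = k" and I: "sorted_wrt (<) I" "length I = k"
  shows "alternating_basis I\<^sub>0 k I = (if I = I\<^sub>0 then 1 else 0)"
proof -
  have "I = I\<^sub>0 \<and> \<pi> = id" if \<pi>: "\<pi> permutes {..<k}" and eq: "I = map (\<lambda>a. I\<^sub>0 ! \<pi> a) [0..<k]" for \<pi>
  proof
    have "set I = (\<lambda>a. I\<^sub>0 ! a) ` (\<pi> ` {..<k})" by (subst eq) (auto simp: image_image)
    also have "\<dots> = set I\<^sub>0"
      unfolding permutes_image[OF \<pi>] using I0(2) by (auto simp: in_set_conv_nth image_iff)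
    finally show II: "I = I\<^sub>0" using I0 I by (intro strict_sorted_equal) auto
    have "\<pi> a = a" for a
    proof (cases "a < k")
      case True
      then have "I\<^sub>0 ! \<pi> a = I\<^sub>0 ! a" using eq II by (metis add_0 diff_zero length_upt nth_map nth_upt)
      moreover have "\<pi> a < k" using permutes_in_image[OF \<pi>, of a] True by simp
      moreover have "distinct I\<^sub>0" using I0(1) by (simp add: strict_sorted_iff)
      ultimately show ?thesis using nth_eq_iff_index_eq[of I\<^sub>0 "\<pi> a" a] I0(2) True by simp
    qed (use \<pi> in \<open>simp add: permutes_def\<close>)
    then show "\<pi> = id" by (simp add: fun_eq_iff)
  qed
  moreover have "I\<^sub>0 = map (\<lambda>a. I\<^sub>0 ! id a) [0..<k]"
    using I0(2) by (simp add: list_eq_iff_nth_eq)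
  ultimately have "(I = map (\<lambda>a. I\<^sub>0 ! \<pi> a) [0..<k]) \<longleftrightarrow> \<pi> = id \<and> I = I\<^sub>0" if "\<pi> permutes {..<k}" for \<pi>
    using that by blast
  then have "alternating_basis I\<^sub>0 k I = (\<Sum>\<pi> | \<pi> permutes {..<k}.
      if \<pi> = id then (if I = I\<^sub>0 then 1 else 0) else 0)"
    unfolding alternating_basis_def by (intro sum.cong) auto
  then show ?thesis using permutes_id by (simp add: finite_permutations)
qed

lemma sum_prod_multi_indices:
  fixes F :: "nat \<Rightarrow> nat \<Rightarrow> real"
  shows "(\<Sum>I\<in>multi_indices n k. \<Prod>a<k. F a (I ! a)) = (\<Prod>a<k. \<Sum>l<n. F a l)"
proof (induction k arbitrary: F)
  case 0
  have "multi_indices n 0 = {[]}" by (auto simp: multi_indices_def)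
  then show ?case by simp
next
  case (Suc k)
  have inj: "inj_on (\<lambda>(j, I). j # I) ({..<n} \<times> multi_indices n k)" by (auto simp: inj_on_def)
  have "(\<Sum>I\<in>multi_indices n (Suc k). \<Prod>a<Suc k. F a (I ! a)) =
      (\<Sum>(j, I)\<in>{..<n} \<times> multi_indices n k. F 0 j * (\<Prod>a<k. F (Suc a) (I ! a)))"
    unfolding multi_indices_Suc sum.reindex[OF inj]
    by (intro sum.cong) (auto simp: prod.lessThan_Suc_shift simp del: prod.lessThan_Suc)
  also have "\<dots> = (\<Sum>j<n. F 0 j) * (\<Sum>I\<in>multi_indices n k. \<Prod>a<k. F (Suc a) (I ! a))"
    by (simp add: sum.cartesian_product[symmetric] sum_product)
  finally show ?case
    using Suc[of "\<lambda>a. F (Suc a)"] by (simp add: prod.lessThan_Suc_shift del: prod.lessThan_Suc)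
qed

context riemannian_open
begin

abbreviation P where "P \<equiv> pointed_chains M U k"

definition chain_at :: "'m chart \<Rightarrow> 'm \<Rightarrow> (nat list \<Rightarrow> real) \<Rightarrow> 'm tensor_field"
  where "chain_at c p e = (\<lambda>d q K. if q = p \<and> d \<in> atlas M \<and> p \<in> dom_of d \<and> K \<in> multi_indices n k
    then \<Sum>I\<in>multi_indices n k. e I * (\<Prod>a<k. transition_deriv c d p (K ! a) (I ! a)) else 0)"

lemma chain_at_in_chains:
  assumes c: "c \<in> atlas M" and p: "p \<in> W c"
    and e: "\<And>I i j. length I = k \<Longrightarrow> i < j \<Longrightarrow> j < k \<Longrightarrow> e (I[i := I ! j, j := I ! i]) = - e I"
  shows "chain_at c p e \<in> P"
    and "K \<in> multi_indices n k \<Longrightarrow> chain_at c p e c p K = e K"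
    and "chain_support (chain_at c p e) \<subseteq> {p}"
proof -
  show supp: "chain_support (chain_at c p e) \<subseteq> {p}"
    by (auto simp: chain_support_def chain_at_def split: if_splits)
  have "alternating k (chain_at c p e)"
    unfolding alternating_def
  proof (intro allI impI)
    fix d q and K :: "nat list" and i j
    assume h: "length K = k \<and> i < j \<and> j < k"
    define s where "s I = I[i := I ! j, j := I ! i]" for I :: "nat list"
    let ?t = "Transposition.transpose i j"
    let ?f = "\<lambda>K I. \<Prod>a<k. transition_deriv c d p (K ! a) (I ! a)"
    have t: "?t permutes {..<k}" using h by (intro permutes_swap_id) auto
    have len: "length I = k" if "I \<in> multi_indices n k" for I using that by (simp add: multi_indices_def)
    have s_inv: "s (s I) = I" and s_mem: "s I \<in> multi_indices n k \<longleftrightarrow> I \<in> multi_indices n k"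
      and s_nth: "a < k \<Longrightarrow> s I ! a = I ! ?t a" and s_e: "e (s I) = - e I"
      if "length I = k" for I a
      using that h e[of I i j] swap_entries_involution[of I k i j] swap_entries_multi_indices[of I k i j n]
        swap_entries_nth[of I k i j a] unfolding s_def by auto
    have "(\<Sum>I\<in>multi_indices n k. e I * ?f (s K) I) = (\<Sum>I\<in>multi_indices n k. e (s I) * ?f (s K) (s I))"
      by (rule sum.reindex_bij_witness[of _ s s])
        (simp_all add: s_inv s_mem len)
    also have "\<dots> = (\<Sum>I\<in>multi_indices n k. - (e I * ?f K I))"
    proof (intro sum.cong refl)
      fix I assume I: "I \<in> multi_indices n k"
      have "?f (s K) (s I) = (\<Prod>a<k. transition_deriv c d p (K ! ?t a) (I ! ?t a))"
        using h len[OF I] by (intro prod.cong refl) (simp add: s_nth)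
      also have "\<dots> = ?f K I"
        using prod.permute[OF t, of "\<lambda>a. transition_deriv c d p (K ! a) (I ! a)"] by (simp add: o_def)
      finally show "e (s I) * ?f (s K) (s I) = - (e I * ?f K I)"
        using s_e[OF len[OF I]] by simp
    qed
    finally have "(\<Sum>I\<in>multi_indices n k. e I * ?f (s K) I) = - (\<Sum>I\<in>multi_indices n k. e I * ?f K I)"
      by (simp add: sum_negf)
    then have "chain_at c p e d q (s K) = - chain_at c p e d q K"
      using h s_mem[of K] by (simp add: chain_at_def)
    then show "chain_at c p e d q (K[i := K ! j, j := K ! i]) = - chain_at c p e d q K"
      by (simp only: s_def)
  qed
  moreover have "contravariant M U k (chain_at c p e)"
    unfolding contravariant_def
  proof (intro ballI)
    fix d d' q K
    assume h: "d \<in> atlas M" "d' \<in> atlas M" "q \<in> dom_of d \<inter> dom_of d' \<inter> U" and K: "K \<in> multi_indices n k"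
    let ?T = "\<lambda>d d' K I. \<Prod>a<k. transition_deriv d d' p (K ! a) (I ! a)"
    show "chain_at c p e d' q K = (\<Sum>I\<in>multi_indices n k. chain_at c p e d q I *
        (\<Prod>a<k. transition_deriv d d' q (K ! a) (I ! a)))"
    proof (cases "q = p")
      case True
      have pd: "p \<in> dom_of c \<inter> dom_of d \<inter> dom_of d'" using h p True by auto
      have "(\<Sum>I\<in>multi_indices n k. chain_at c p e d q I * ?T d d' K I) =
          (\<Sum>I\<in>multi_indices n k. \<Sum>J\<in>multi_indices n k. e J * (?T d d' K I * ?T c d I J))"
        using True h by (intro sum.cong) (auto simp: chain_at_def sum_distrib_left sum_distrib_right mult_ac)
      also have "\<dots> = (\<Sum>J\<in>multi_indices n k. e J * (\<Sum>I\<in>multi_indices n k. ?T d d' K I * ?T c d I J))"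
        by (subst sum.swap) (simp add: sum_distrib_left)
      also have "\<dots> = (\<Sum>J\<in>multi_indices n k. e J * ?T c d' K J)"
      proof (intro sum.cong refl arg_cong2[where f = times])
        fix J assume J: "J \<in> multi_indices n k"
        have "(\<Sum>I\<in>multi_indices n k. ?T d d' K I * ?T c d I J) = (\<Prod>a<k. \<Sum>l<n.
            transition_deriv d d' p (K ! a) l * transition_deriv c d p l (J ! a))"
          unfolding prod.distrib[symmetric]
          by (rule sum_prod_multi_indices[of "\<lambda>a l. transition_deriv d d' p (K ! a) l *
              transition_deriv c d p l (J ! a)"])
        also have "\<dots> = ?T c d' K J"
          using transition_deriv_trans[OF c h(1,2) pd] multi_indices_nth[OF K] multi_indices_nth[OF J]
          by (intro prod.cong) auto
        finally show "(\<Sum>I\<in>multi_indices n k. ?T d d' K I * ?T c d I J) = ?T c d' K J" .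
      qed
      finally show ?thesis using True h K by (simp add: chain_at_def)
    qed (simp add: chain_at_def)
  qed
  moreover have "components_on M U k (chain_at c p e)"
    using p by (auto simp: components_on_def chain_at_def)
  moreover have "finite (chain_support (chain_at c p e))" using supp by (rule finite_subset) simp
  ultimately show "chain_at c p e \<in> P" by (simp add: pointed_chains_def)
  show "chain_at c p e c p K = e K" if K: "K \<in> multi_indices n k"
  proof -
    have "e I * (\<Prod>a<k. transition_deriv c c p (K ! a) (I ! a)) = (if I = K then e K else 0)"
      if I: "I \<in> multi_indices n k" for I
    proof (cases "I = K")
      case True
      have "(\<Prod>a<k. transition_deriv c c p (K ! a) (I ! a)) = (\<Prod>a<k. 1)"
        using transition_deriv_same[OF c, of p] p multi_indices_nth[OF K] True by (intro prod.cong) auto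
      then show ?thesis using True by simp
    next
      case False
      then obtain a where a: "a < k" "K ! a \<noteq> I ! a"
        using K I by (auto simp: multi_indices_def list_eq_iff_nth_eq)
      then have "transition_deriv c c p (K ! a) (I ! a) = 0"
        using transition_deriv_same[OF c, of p] p multi_indices_nth[OF K] multi_indices_nth[OF I] by simp
      then have "(\<Prod>a<k. transition_deriv c c p (K ! a) (I ! a)) = 0" using a(1) by (intro prod_zero) auto
      then show ?thesis using False by simp
    qed
    then have "(\<Sum>I\<in>multi_indices n k. e I * (\<Prod>a<k. transition_deriv c c p (K ! a) (I ! a))) =
        (\<Sum>I\<in>multi_indices n k. if I = K then e K else 0)" by (intro sum.cong) auto
    then show ?thesis using c p K by (simp add: chain_at_def finite_multi_indices)
  qed
qed

definition pick :: "'m \<Rightarrow> 'm chart"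
  where "pick p = (SOME c. c \<in> atlas M \<and> p \<in> dom_of c)"

definition increasing :: "nat list set"
  where "increasing = {I. I \<in> multi_indices n k \<and> sorted_wrt (<) I}"

lemma finite_increasing: "finite increasing"
  unfolding increasing_def using finite_multi_indices[of n k] by simp

lemma pick:
  assumes "p \<in> U"
  shows "pick p \<in> atlas M" "p \<in> W (pick p)"
proof -
  have "p \<in> \<Union> (dom_of ` atlas M)"
    using atlas openin_subset[OF U] assms by (auto simp: smooth_atlas_def)
  then have "\<exists>c. c \<in> atlas M \<and> p \<in> dom_of c" by blast
  then have "pick p \<in> atlas M \<and> p \<in> dom_of (pick p)" unfolding pick_def by (rule someI_ex)
  then show "pick p \<in> atlas M" "p \<in> W (pick p)" using assms by auto
qed

lemma eval_at_eq: "eval_at M k A \<omega> p = (\<Sum>I\<in>increasing. A (pick p) p I * \<omega> (pick p) p I)"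
  unfolding eval_at_def Let_def increasing_def pick_def by (simp add: mult.commute)

lemma chain_support_subset: "A \<in> P \<Longrightarrow> chain_support A \<subseteq> U"
  by (auto simp: pointed_chains_def components_on_def chain_support_def)

lemma finite_chain_support: "A \<in> P \<Longrightarrow> finite (chain_support A)"
  by (simp add: pointed_chains_def)

lemma chain_integral_eq:
  assumes "finite S" "chain_support A \<subseteq> S"
  shows "chain_integral M k A \<omega> = (\<Sum>p\<in>S. \<Sum>I\<in>increasing. A (pick p) p I * \<omega> (pick p) p I)"
  unfolding chain_integral_def eval_at_eq
proof (rule sum.mono_neutral_left[OF assms])
  have "A c p I = 0" if "p \<notin> chain_support A" for c p I
    using that unfolding chain_support_def by blast
  then show "\<forall>p\<in>S - chain_support A. (\<Sum>I\<in>increasing. A (pick p) p I * \<omega> (pick p) p I) = 0"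
    by simp
qed

lemma chain_integral_chain_at:
  assumes p: "p \<in> U" and I: "I \<in> increasing"
  shows "chain_at (pick p) p (alternating_basis I k) \<in> P"
    "chain_integral M k (chain_at (pick p) p (alternating_basis I k)) \<omega> = \<omega> (pick p) p I"
proof -
  note ch = chain_at_in_chains[OF pick[OF p], of "alternating_basis I k", OF alternating_basis_swap]
  show "chain_at (pick p) p (alternating_basis I k) \<in> P" by (rule ch(1))
  have "chain_integral M k (chain_at (pick p) p (alternating_basis I k)) \<omega> =
      (\<Sum>J\<in>increasing. alternating_basis I k J * \<omega> (pick p) p J)"
    using chain_integral_eq[OF _ ch(3)] ch(2) by (simp add: increasing_def)
  also have "\<dots> = (\<Sum>J\<in>increasing. if J = I then \<omega> (pick p) p I else 0)"
    using I by (intro sum.cong) (auto simp: increasing_def multi_indices_def alternating_basis_increasing)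
  finally show "chain_integral M k (chain_at (pick p) p (alternating_basis I k)) \<omega> = \<omega> (pick p) p I"
    using I finite_increasing by simp
qed

lemma pointed_chains_linear:
  assumes A: "A \<in> P" and A': "A' \<in> P"
  shows "a *\<^sub>R A + A' \<in> P"
proof -
  have "components_on M U k (a *\<^sub>R A + A')" "alternating k (a *\<^sub>R A + A')"
    using assms by (auto simp: pointed_chains_def components_on_def alternating_def plus_fun_def scaleR_fun_def)
  moreover have "contravariant M U k (a *\<^sub>R A + A')"
    unfolding contravariant_def
  proof (intro ballI)
    fix c d p K
    assume h: "c \<in> atlas M" "d \<in> atlas M" "p \<in> dom_of c \<inter> dom_of d \<inter> U" "K \<in> multi_indices n k"
    have "A d p K = (\<Sum>I\<in>multi_indices n k. A c p I * (\<Prod>a<k. transition_deriv c d p (K ! a) (I ! a)))"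
      "A' d p K = (\<Sum>I\<in>multi_indices n k. A' c p I * (\<Prod>a<k. transition_deriv c d p (K ! a) (I ! a)))"
      using assms h unfolding pointed_chains_def contravariant_def by blast+
    then show "(a *\<^sub>R A + A') d p K = (\<Sum>I\<in>multi_indices n k. (a *\<^sub>R A + A') c p I *
        (\<Prod>a<k. transition_deriv c d p (K ! a) (I ! a)))"
      by (simp add: plus_fun_def scaleR_fun_def distrib_right sum.distrib sum_distrib_left mult.assoc)
  qed
  moreover have "finite (chain_support (a *\<^sub>R A + A'))"
  proof (rule finite_subset)
    show "chain_support (a *\<^sub>R A + A') \<subseteq> chain_support A \<union> chain_support A'"
      by (auto simp: chain_support_def plus_fun_def scaleR_fun_def) (metis add_0 mult_zero_right)
  qed (use finite_chain_support[OF A] finite_chain_support[OF A'] in simp)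
  ultimately show ?thesis by (simp add: pointed_chains_def)
qed

lemma zero_pointed_chains: "0 \<in> P"
  by (auto simp: pointed_chains_def components_on_def alternating_def contravariant_def chain_support_def)

lemma subspace_pointed_chains: "subspace P"
proof (rule subspaceI)
  show "x + y \<in> P" if "x \<in> P" "y \<in> P" for x y using pointed_chains_linear[OF that, of 1] by simp
  show "a *\<^sub>R x \<in> P" if "x \<in> P" for a x using pointed_chains_linear[OF that zero_pointed_chains, of a] by simp
qed (rule zero_pointed_chains)

end

lemma linear_functional_onI:
  assumes S: "subspace S" and lin: "\<And>a x y. x \<in> S \<Longrightarrow> y \<in> S \<Longrightarrow> f (a *\<^sub>R x + y) = a * f x + f y"
  shows "linear_functional_on S f"
proof -
  have "0 \<in> S" using S by (rule subspace_0)
  have f0: "f 0 = 0" using lin[OF \<open>0 \<in> S\<close> \<open>0 \<in> S\<close>, of 1] by simp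
  have "f (x + y) = f x + f y" if "x \<in> S" "y \<in> S" for x y using lin[OF that, of 1] by simp
  moreover have "f (a *\<^sub>R x) = a * f x" if "x \<in> S" for a x using lin[OF that \<open>0 \<in> S\<close>, of a] f0 by simp
  ultimately show ?thesis by (simp add: linear_functional_on_def)
qed

definition bounded_on :: "'w set \<Rightarrow> ('w \<Rightarrow> real) \<Rightarrow> bool"
  where "bounded_on D l \<longleftrightarrow> (\<exists>C. \<forall>w\<in>D. \<bar>l w\<bar> \<le> C)"

lemma bounded_on_add: "bounded_on D l \<Longrightarrow> bounded_on D l' \<Longrightarrow> bounded_on D (\<lambda>w. l w + l' w)"
  unfolding bounded_on_def by (meson abs_triangle_ineq add_mono order_trans)

lemma bounded_on_cmult: "bounded_on D l \<Longrightarrow> bounded_on D (\<lambda>w. a * l w)"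
  unfolding bounded_on_def abs_mult by (meson abs_ge_zero mult_left_mono)

lemma bounded_on_0: "bounded_on D (\<lambda>w. 0)"
  by (auto simp: bounded_on_def)

lemma bounded_on_sum:
  "(\<And>i. i \<in> A \<Longrightarrow> bounded_on D (l i)) \<Longrightarrow> bounded_on D (\<lambda>w. \<Sum>i\<in>A. l i w)"
  by (induction A rule: infinite_finite_induct) (auto simp: bounded_on_0 bounded_on_add)

lemma bounded_on_cong: "bounded_on D l \<Longrightarrow> (\<And>w. w \<in> D \<Longrightarrow> l w = l' w) \<Longrightarrow> bounded_on D l'"
  by (simp add: bounded_on_def)

section \<open>The Mackey topology of pointed chains\<close>

context riemannian_open
begin

lemma linear_functional_tensor_value_nabla:
  "c \<in> atlas M \<Longrightarrow> p \<in> W c \<Longrightarrow>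
    linear_functional_on B (\<lambda>\<omega>. tensor_value n (j + k) (nabla j \<omega> c p) v)"
  by (intro linear_functional_onI subspace_bounded_forms tensor_value_nabla_linear)

lemma linear_functional_nabla:
  assumes "c \<in> atlas M" "p \<in> W c" "J \<in> multi_indices n (j + k)"
  shows "linear_functional_on B (\<lambda>\<omega>. nabla j \<omega> c p J)"
  using assms
  by (intro linear_functional_onI subspace_bounded_forms nabla_linear) (auto simp: bounded_forms_iff)

lemma chain_integral_linear_form:
  "linear_functional_on B (chain_integral M k A)"
  by (intro linear_functional_onI subspace_bounded_forms)
    (simp add: chain_integral_def eval_at_eq plus_fun_def scaleR_fun_def distrib_left sum.distrib
      sum_distrib_left mult.left_commute)

lemma chain_integral_linear_chain:
  "linear_functional_on P (\<lambda>A. chain_integral M k A \<omega>)"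
proof (intro linear_functional_onI subspace_pointed_chains)
  fix a A A' assume A: "A \<in> P" "A' \<in> P"
  let ?S = "chain_support A \<union> chain_support A' \<union> chain_support (a *\<^sub>R A + A')"
  have fin: "finite ?S" using A pointed_chains_linear[OF A] finite_chain_support by blast
  have eq: "chain_integral M k C \<omega> = (\<Sum>p\<in>?S. \<Sum>I\<in>increasing. C (pick p) p I * \<omega> (pick p) p I)"
    if "C \<in> {A, A', a *\<^sub>R A + A'}" for C
    by (rule chain_integral_eq[OF fin]) (use that in auto)
  have "chain_integral M k (a *\<^sub>R A + A') \<omega> =
      (\<Sum>p\<in>?S. \<Sum>I\<in>increasing. (a *\<^sub>R A + A') (pick p) p I * \<omega> (pick p) p I)"
    by (rule eq) simp
  also have "\<dots> = a * (\<Sum>p\<in>?S. \<Sum>I\<in>increasing. A (pick p) p I * \<omega> (pick p) p I) +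
      (\<Sum>p\<in>?S. \<Sum>I\<in>increasing. A' (pick p) p I * \<omega> (pick p) p I)"
    unfolding plus_fun_def scaleR_fun_def real_scaleR_def distrib_right sum.distrib sum_distrib_left
    by (simp only: mult.assoc)
  also have "\<dots> = a * chain_integral M k A \<omega> + chain_integral M k A' \<omega>"
    using eq[of A] eq[of A'] by simp
  finally show "chain_integral M k (a *\<^sub>R A + A') \<omega> = a * chain_integral M k A \<omega> + chain_integral M k A' \<omega>" .
qed

abbreviation bounded_sets where "bounded_sets \<equiv> {D. bounded_in (bounded_forms_topology M U k) D}"

lemma bounded_on_components:
  assumes D: "D \<in> bounded_sets" and "c \<in> atlas M" "p \<in> W c" "I \<in> multi_indices n (j + k)"
  shows "bounded_on D (\<lambda>\<omega>. nabla j \<omega> c p I)"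
proof -
  obtain C where C: "\<forall>\<omega>\<in>D. jet_bound j \<omega> C"
    using D unfolding bounded_in_bounded_forms_iff mem_Collect_eq by blast
  show ?thesis
    unfolding bounded_on_def
    using component_le_jet_bound[OF bspec[OF C] order_refl assms(2-4)] by blast
qed

lemma bounded_on_chain_integral:
  assumes D: "D \<in> bounded_sets" and A: "A \<in> P"
  shows "bounded_on D (chain_integral M k A)"
proof -
  have "bounded_on D (\<lambda>\<omega>. \<omega> (pick p) p I)" if "p \<in> chain_support A" "I \<in> increasing" for p I
    using bounded_on_components[OF D pick, of p I 0] that chain_support_subset[OF A]
    by (auto simp: increasing_def)
  then show ?thesis
    unfolding chain_integral_def eval_at_eq by (intro bounded_on_sum bounded_on_cmult) auto
qed

end

locale chain_complete = riemannian_open +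
  fixes K :: "'a tensor_field set"
  assumes KB: "K \<subseteq> bounded_forms M U k" and sym: "\<And>\<omega>. \<omega> \<in> K \<Longrightarrow> - \<omega> \<in> K"
    and pointwise: "\<And>A. A \<in> pointed_chains M U k \<Longrightarrow> bounded_on K (chain_integral M k A)"
    and complete: "series_complete (bounded_forms M U k) K"
begin

lemma bounded_on_increasing:
  assumes "p \<in> U" "I \<in> increasing"
  shows "bounded_on K (\<lambda>\<omega>. \<omega> (pick p) p I)"
  by (rule bounded_on_cong[OF pointwise[OF chain_integral_chain_at(1)[OF assms]]])
    (rule chain_integral_chain_at(2)[OF assms])

text \<open>Exchanging two entries in the wrong order decreases \<open>\<Sum>a. (k - a) I\<^sub>a\<close>, which sorts any multi-index.\<close>

lemma bounded_on_pick:
  assumes p: "p \<in> U" and I: "I \<in> multi_indices n k"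
  shows "bounded_on K (\<lambda>\<omega>. \<omega> (pick p) p I)"
  using I
proof (induction "\<Sum>a<k. (k - a) * I ! a" arbitrary: I rule: less_induct)
  case less
  have len: "length I = k" using less.prems by (simp add: multi_indices_def)
  show ?case
  proof (cases "sorted_wrt (<) I")
    case True
    then show ?thesis using bounded_on_increasing[OF p] less.prems by (simp add: increasing_def)
  next
    case False
    then obtain i j where ij: "i < j" "j < k" "I ! j \<le> I ! i"
      using len by (auto simp: sorted_wrt_iff_nth_less not_less)
    define I' where "I' = I[i := I ! j, j := I ! i]"
    have alt: "\<omega> (pick p) p I' = - \<omega> (pick p) p I" if "\<omega> \<in> K" for \<omega>
    proof -
      have "alternating k \<omega>" using that KB by (auto simp: bounded_forms_iff)
      then show ?thesis using len ij unfolding I'_def alternating_def by blast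
    qed
    show ?thesis
    proof (cases "I ! j = I ! i")
      case True
      then have "I' = I" by (simp add: I'_def) (metis list_update_id True)
      then have "\<omega> (pick p) p I = 0" if "\<omega> \<in> K" for \<omega> using alt[OF that] by simp
      then show ?thesis unfolding bounded_on_def by (intro exI[of _ 0]) auto
    next
      case False
      have I'_nth: "I' ! a = (if a = i then I ! j else if a = j then I ! i else I ! a)" if "a < k" for a
        using that len ij by (auto simp: I'_def nth_list_update)
      have "int (\<Sum>a<k. (k - a) * I ! a) - int (\<Sum>a<k. (k - a) * I' ! a) =
          (\<Sum>a<k. int (k - a) * (int (I ! a) - int (I' ! a)))"
        by (simp add: sum_subtractf right_diff_distrib)
      also have "\<dots> = (\<Sum>a\<in>{i, j}. int (k - a) * (int (I ! a) - int (I' ! a)))"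
        using ij I'_nth by (intro sum.mono_neutral_right) auto
      also have "\<dots> = (int j - int i) * (int (I ! i) - int (I ! j))"
        using ij I'_nth by (simp add: of_nat_diff algebra_simps)
      also have "\<dots> > 0" using ij False by simp
      finally have "(\<Sum>a<k. (k - a) * I' ! a) < (\<Sum>a<k. (k - a) * I ! a)"
        unfolding diff_gt_0_iff_gt of_nat_less_iff .
      moreover have "I' \<in> multi_indices n k"
        using swap_entries_multi_indices[OF len, of i j n] ij less.prems by (simp add: I'_def)
      ultimately have "bounded_on K (\<lambda>\<omega>. \<omega> (pick p) p I')" by (rule less.hyps)
      then have "bounded_on K (\<lambda>\<omega>. - 1 * \<omega> (pick p) p I')" by (rule bounded_on_cmult)
      then show ?thesis by (rule bounded_on_cong) (simp add: alt)
    qed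
  qed
qed

lemma bounded_on_component:
  assumes c: "c \<in> atlas M" and p: "p \<in> W c" and I: "I \<in> multi_indices n k"
  shows "bounded_on K (\<lambda>\<omega>. \<omega> c p I)"
proof -
  have pU: "p \<in> U" using p by simp
  let ?d = "pick p"
  have "bounded_on K (\<lambda>\<omega>. \<Sum>J\<in>multi_indices n k.
      (\<Prod>a<k. transition_deriv c ?d p (J ! a) (I ! a)) * \<omega> ?d p J)"
    by (intro bounded_on_sum bounded_on_cmult bounded_on_pick pU)
  then show ?thesis
  proof (rule bounded_on_cong)
    fix \<omega> assume "\<omega> \<in> K"
    then have "covariant M U k \<omega>" using KB by (auto simp: bounded_forms_iff)
    moreover have "p \<in> dom_of c \<inter> dom_of ?d \<inter> U" using p pick(2)[OF pU] by auto
    ultimately have "\<omega> c p I = (\<Sum>J\<in>multi_indices n k. \<omega> ?d p J *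
        (\<Prod>a<k. transition_deriv c ?d p (J ! a) (I ! a)))"
      using c pick(1)[OF pU] I unfolding covariant_def by blast
    then show "(\<Sum>J\<in>multi_indices n k. (\<Prod>a<k. transition_deriv c ?d p (J ! a) (I ! a)) * \<omega> ?d p J) = \<omega> c p I"
      by (simp add: mult.commute)
  qed
qed

text \<open>Partial derivatives are limits of difference quotients, so the Banach--Steinhaus theorem applies.\<close>

lemma bounded_on_nabla:
  assumes "c \<in> atlas M" "p \<in> W c" "I \<in> multi_indices n (j + k)"
  shows "bounded_on K (\<lambda>\<omega>. nabla j \<omega> c p I)"
  using assms
proof (induction j arbitrary: p I)
  case 0
  then show ?case using bounded_on_component by simp
next
  case (Suc j)
  note c = Suc.prems(1) and p = Suc.prems(2)
  interpret chart_domain "mtop M" n c "W c" using c by (rule chart_domain_U)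
  obtain i J where I: "I = i # J" "i < n" "J \<in> multi_indices n (j + k)"
    using Suc.prems(3) by (auto simp: multi_indices_Suc)
  let ?x = "coord c p i"
  obtain \<delta> where \<delta>: "\<delta> > 0" "\<And>t. dist t ?x < \<delta> \<Longrightarrow> chart_line c i p t \<in> W c"
    using chart_line_nhds[OF p I(2)] unfolding eventually_nhds_metric by blast
  define t where "t m = ?x + \<delta> / 2 * inverse (real (Suc m))" for m
  have t: "t m \<noteq> ?x" "chart_line c i p (t m) \<in> W c" for m
  proof -
    have "inverse (real (Suc m)) \<le> 1" by (simp add: inverse_le_1_iff)
    then have "\<delta> / 2 * inverse (real (Suc m)) \<le> \<delta> / 2 * 1" using \<delta>(1) by (intro mult_left_mono) auto
    moreover have "\<delta> / 2 * inverse (real (Suc m)) > 0" using \<delta>(1) by simp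
    ultimately have "dist (t m) ?x < \<delta>" "t m \<noteq> ?x"
      using \<delta>(1) by (auto simp: t_def dist_real_def)
    then show "t m \<noteq> ?x" "chart_line c i p (t m) \<in> W c" using \<delta>(2) by auto
  qed
  have t_lim: "t \<longlonglongrightarrow> ?x"
    unfolding t_def using tendsto_add[OF tendsto_const[of ?x] tendsto_mult_right_zero[OF LIMSEQ_inverse_real_of_nat, of "\<delta> / 2"]]
    by simp
  define l where "l m \<omega> = inverse (t m - ?x) * (nabla j \<omega> c (chart_line c i p (t m)) J + - 1 * nabla j \<omega> c p J)"
    for m \<omega>
  have "\<exists>C. \<forall>\<omega>\<in>K. \<bar>chart_partial c i (\<lambda>q. nabla j \<omega> c q J) p\<bar> \<le> C"
  proof (rule limit_bounded_on_series_complete[OF subspace_bounded_forms KB sym complete])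
    show "linear_functional_on B (l m)" for m
      unfolding l_def
      using linear_functional_onD[OF linear_functional_nabla[OF c t(2) I(3)]]
        linear_functional_onD[OF linear_functional_nabla[OF c p I(3)]]
      by (simp add: linear_functional_on_def algebra_simps)
    show "\<exists>C. \<forall>\<omega>\<in>K. \<bar>l m \<omega>\<bar> \<le> C" for m
      unfolding bounded_on_def[symmetric] l_def
      by (intro bounded_on_cmult bounded_on_add Suc.IH c p t(2) I(3))
    show "(\<lambda>m. l m \<omega>) \<longlonglongrightarrow> chart_partial c i (\<lambda>q. nabla j \<omega> c q J) p" if \<omega>: "\<omega> \<in> B" for \<omega>
    proof -
      have "smooth_tensor k \<omega>" using \<omega> by (simp add: bounded_forms_iff)
      then have "smooth (\<lambda>q. nabla j \<omega> c q J)" by (rule smooth_tensorD[OF smooth_nabla c I(3)])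
      then have "chart_differentiable c i (\<lambda>q. nabla j \<omega> c q J) p" by (rule smooth_differentiable[OF _ I(2) p])
      then have "((\<lambda>s. nabla j \<omega> c (chart_line c i p s) J) has_real_derivative
          chart_partial c i (\<lambda>q. nabla j \<omega> c q J) p) (at ?x)"
        by (rule chart_differentiable_iff[where f = "\<lambda>q. nabla j \<omega> c q J", THEN iffD1])
      then have "((\<lambda>s. (nabla j \<omega> c (chart_line c i p s) J - nabla j \<omega> c (chart_line c i p ?x) J) / (s - ?x))
          \<longlongrightarrow> chart_partial c i (\<lambda>q. nabla j \<omega> c q J) p) (at ?x)"
        unfolding has_field_derivative_iff .
      moreover have "filterlim t (at ?x) sequentially"
        unfolding filterlim_at using t_lim t(1) by simp
      ultimately have "(\<lambda>m. (nabla j \<omega> c (chart_line c i p (t m)) J - nabla j \<omega> c (chart_line c i p ?x) J) / (t m - ?x))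
          \<longlonglongrightarrow> chart_partial c i (\<lambda>q. nabla j \<omega> c q J) p"
        by (rule filterlim_compose)
      then show ?thesis
        unfolding l_def chart_line_same[OF p] by (simp add: divide_inverse mult.commute)
    qed
  qed
  then have 1: "bounded_on K (\<lambda>\<omega>. chart_partial c i (\<lambda>q. nabla j \<omega> c q J) p)"
    by (simp add: bounded_on_def)
  have "bounded_on K (\<lambda>\<omega>. chart_partial c i (\<lambda>q. nabla j \<omega> c q J) p +
      - 1 * (\<Sum>a<j + k. \<Sum>l<n. christoffel M c p l i (J ! a) * nabla j \<omega> c p (J[a := l])))"
    using multi_indices_update[OF I(3)]
    by (intro bounded_on_add 1 bounded_on_cmult bounded_on_sum Suc.IH c p) auto
  then show ?case
    by (rule bounded_on_cong) (simp add: I(1) cov_deriv_Cons[OF I(3)])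
qed

theorem bounded_in_K: "K \<in> bounded_sets"
proof -
  have "\<exists>C. \<forall>\<omega>\<in>K. jet_bound r \<omega> C" for r
  proof -
    let ?f = "\<lambda>j c p v \<omega>. tensor_value n (j + k) (nabla j \<omega> c p) v"
    let ?F = "{?f j c p v | j c p v. j \<le> r \<and> c \<in> atlas M \<and> p \<in> W c \<and> v \<in> unit_vectors c p (j + k)}"
    have "\<exists>C. \<forall>f\<in>?F. \<forall>\<omega>\<in>K. \<bar>f \<omega>\<bar> \<le> C"
    proof (rule uniform_boundedness_series_complete[OF subspace_bounded_forms KB sym complete])
      show "linear_functional_on B f" if "f \<in> ?F" for f
        using that linear_functional_tensor_value_nabla by auto
      show "\<exists>C. \<forall>\<omega>\<in>K. \<bar>f \<omega>\<bar> \<le> C" if fF: "f \<in> ?F" for f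
      proof -
        obtain j c p v where f: "f = ?f j c p v" and h: "c \<in> atlas M" "p \<in> W c" using fF by blast
        have "bounded_on K (\<lambda>\<omega>. \<Sum>I\<in>multi_indices n (j + k). (\<Prod>a<j + k. v a (I ! a)) * nabla j \<omega> c p I)"
          by (intro bounded_on_sum bounded_on_cmult bounded_on_nabla h)
        then show ?thesis unfolding f tensor_value_def bounded_on_def by (simp add: mult.commute)
      qed
      show "\<exists>C. \<forall>f\<in>?F. \<bar>f \<omega>\<bar> \<le> C" if \<omega>: "\<omega> \<in> B" for \<omega>
      proof -
        obtain C where "jet_bound r \<omega> C" using \<omega> unfolding bounded_forms_iff by blast
        then show ?thesis unfolding jet_bound_def by (intro exI[of _ C]) auto
      qed
    qed auto
    then obtain C where C: "\<forall>f\<in>?F. \<forall>\<omega>\<in>K. \<bar>f \<omega>\<bar> \<le> C" ..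
    have "jet_bound r \<omega> C" if \<omega>: "\<omega> \<in> K" for \<omega>
      unfolding jet_bound_def
    proof (intro allI impI ballI)
      fix j c p v assume "j \<le> r" "c \<in> atlas M" "p \<in> W c" "v \<in> unit_vectors c p (j + k)"
      then have "?f j c p v \<in> ?F" by blast
      then show "\<bar>?f j c p v \<omega>\<bar> \<le> C" using \<omega> by (rule bspec[OF bspec[OF C]])
    qed
    then show ?thesis by blast
  qed
  then show ?thesis using KB by (simp add: bounded_in_bounded_forms_iff)
qed

end

context sup_continuous_functional
begin

lemma functional_plus:
  assumes "bounded_on D l" "bounded_on D m"
  shows "\<Phi> (\<lambda>d. l d + m d) = \<Phi> l + \<Phi> m"
  using assms functional_add[of l _ m] unfolding bounded_on_def by blast

lemma functional_lincomb:
  assumes "finite A" "\<And>i. i \<in> A \<Longrightarrow> bounded_on D (l i)"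
  shows "\<Phi> (\<lambda>d. \<Sum>i\<in>A. a i * l i d) = (\<Sum>i\<in>A. a i * \<Phi> (l i))"
proof -
  have "\<exists>C. \<forall>d\<in>D. \<bar>l i d\<bar> \<le> C" if "i \<in> A" for i using assms(2)[OF that] by (simp add: bounded_on_def)
  then obtain C where "\<And>i. i \<in> A \<Longrightarrow> \<forall>d\<in>D. \<bar>l i d\<bar> \<le> C i" by metis
  then show ?thesis using functional_sum[OF assms(1), of l C a] by blast
qed

end

context riemannian_open
begin

lemma functional_representation:
  assumes D: "D \<in> bounded_sets" and f: "linear_functional_on P f" and C: "C \<ge> 0"
    and le: "\<And>A. A \<in> P \<Longrightarrow> \<bar>f A\<bar> \<le> C * sup_on (chain_integral M k) D A"
  shows "\<exists>\<omega>\<in>B. \<forall>A\<in>P. f A = chain_integral M k A \<omega>"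
proof -
  define S where "S = {l :: 'm tensor_field \<Rightarrow> real. \<exists>C. \<forall>d\<in>D. \<bar>l d\<bar> \<le> C}"
  have S_iff: "l \<in> S \<longleftrightarrow> bounded_on D l" for l by (simp add: S_def bounded_on_def)
  have S: "subspace S"
  proof (rule subspaceI)
    show "0 \<in> S" by (auto simp: S_def)
    show "x + y \<in> S" if "x \<in> S" "y \<in> S" for x y
      using bounded_on_add that unfolding S_iff plus_fun_def by blast
    show "a *\<^sub>R x \<in> S" if "x \<in> S" for a x
      using bounded_on_cmult that unfolding S_iff scaleR_fun_def real_scaleR_def by blast
  qed
  define q where "q l = C * sup_on (\<lambda>l d. l d) D l" for l :: "'m tensor_field \<Rightarrow> real"
  have "seminorm_on S (sup_on (\<lambda>l d. l d) D)"
  proof (rule seminorm_on_sup_on[OF _ S])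
    show "\<exists>C. \<forall>d\<in>D. \<bar>l d\<bar> \<le> C" if "l \<in> S" for l using that by (simp add: S_def)
  qed (simp add: linear_functional_on_def plus_fun_def scaleR_fun_def)
  then have "seminorm_on S q"
    using C unfolding seminorm_on_def q_def
    by (auto simp: distrib_left[symmetric] mult_left_mono mult.left_commute)
  then have q: "sublinear_on S q" by (rule seminorm_on_sublinear[OF S])
  note linA = linear_functional_onD[OF chain_integral_linear_chain]
  obtain \<Phi> where \<Phi>: "linear_functional_on S \<Phi>" "\<And>l. l \<in> S \<Longrightarrow> \<Phi> l \<le> q l"
    "\<And>A. A \<in> P \<Longrightarrow> \<Phi> (chain_integral M k A) = f A"
  proof (rule hahn_banach[OF S q subspace_pointed_chains _ _ _ f, of "chain_integral M k"])
    show "chain_integral M k A \<in> S" if "A \<in> P" for A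
      using bounded_on_chain_integral[OF D that] by (simp add: S_iff)
    show "chain_integral M k (A + A') = chain_integral M k A + chain_integral M k A'"
      if "A \<in> P" "A' \<in> P" for A A' using linA(1)[OF that] by (simp add: fun_eq_iff plus_fun_def)
    show "chain_integral M k (a *\<^sub>R A) = a *\<^sub>R chain_integral M k A" if "A \<in> P" for a A
      using linA(2)[OF that] by (simp add: fun_eq_iff scaleR_fun_def)
    show "f A \<le> q (chain_integral M k A)" if "A \<in> P" for A
      using le[OF that] by (simp add: q_def sup_on_def)
  qed blast
  have bound: "\<bar>\<Phi> l\<bar> \<le> C * A" if A: "A \<ge> 0" "\<forall>d\<in>D. \<bar>l d\<bar> \<le> A" for l A
  proof -
    have l: "l \<in> S" "- l \<in> S" using A S by (auto simp: S_def fun_Compl_def)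
    have "sup_on (\<lambda>l d. l d) D l \<le> A" "sup_on (\<lambda>l d. l d) D (- l) \<le> A"
      using A by (auto intro!: sup_on_le simp: fun_Compl_def)
    then have "q l \<le> C * A" "q (- l) \<le> C * A" using C by (auto simp: q_def intro: mult_left_mono)
    then show ?thesis
      using \<Phi>(2)[OF l(1)] \<Phi>(2)[OF l(2)] linear_functional_on_minus[OF \<Phi>(1) l(1)] by linarith
  qed
  have scf: "sup_continuous_functional D \<Phi>"
    using \<Phi>(1) C bound by unfold_locales (auto simp: S_def)
  interpret sup_continuous_functional D \<Phi> by (rule scf)
  have DB: "D \<subseteq> B" and jets: "\<And>r. \<exists>C. \<forall>\<omega>\<in>D. jet_bound r \<omega> C"
    using D by (auto simp: bounded_in_bounded_forms_iff)
  note comp = bounded_on_components[OF D]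
  have comp0: "bounded_on D (\<lambda>\<omega>. \<omega> c p I)" if "c \<in> atlas M" "p \<in> W c" "I \<in> multi_indices n k" for c p I
    using comp[of c p I 0] that by simp
  note family = nabla_family[OF DB jets]
  define w where "w = (\<lambda>c p I. if c \<in> atlas M \<and> p \<in> W c \<and> I \<in> multi_indices n k
    then \<Phi> (\<lambda>\<omega>. \<omega> c p I) else 0)"
  have w_eq: "w c p I = \<Phi> (\<lambda>\<omega>. \<omega> c p I)" if "c \<in> atlas M" "p \<in> W c" "I \<in> multi_indices n k" for c p I
    using that by (simp add: w_def)
  have nabla_w: "nabla j w c p I = \<Phi> (\<lambda>\<omega>. nabla j \<omega> c p I)"
    if "c \<in> atlas M" "p \<in> W c" "I \<in> multi_indices n (j + k)" for j c p I
    using that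
  proof (induction j arbitrary: p I)
    case 0
    then show ?case by (simp add: w_eq)
  next
    case (Suc j)
    note c = Suc.prems(1) and p = Suc.prems(2)
    interpret chart_domain "mtop M" n c "W c" using c by (rule chart_domain_U)
    obtain i J where I: "I = i # J" "i < n" "J \<in> multi_indices n (j + k)"
      using Suc.prems(3) by (auto simp: multi_indices_Suc)
    let ?F = "\<lambda>\<omega> q. nabla j \<omega> c q J"
    let ?A = "{..<j + k} \<times> {..<n}"
    let ?a = "\<lambda>x. - christoffel M c p (snd x) i (J ! fst x)" and ?l = "\<lambda>x \<omega>. nabla j \<omega> c p (J[fst x := snd x])"
    have expand: "nabla (Suc j) \<omega> c p I = chart_partial c i (?F \<omega>) p + (\<Sum>x\<in>?A. ?a x * ?l x \<omega>)" for \<omega>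
      by (simp add: I(1) cov_deriv_Cons[OF I(3)] sum.cartesian_product split_def sum_negf)
    have "chart_partial c i (?F w) p = chart_partial c i (\<lambda>q. \<Phi> (\<lambda>\<omega>. ?F \<omega> q)) p"
      by (rule chart_partial_cong(1)[OF p I(2)]) (rule Suc.IH[OF c _ I(3)])
    also have "\<dots> = \<Phi> (\<lambda>\<omega>. chart_partial c i (?F \<omega>) p)"
      by (rule chart_partialI[OF functional_chart_partial[OF scf family[OF c I(3)] p I(2)]])
    finally have 1: "chart_partial c i (?F w) p = \<Phi> (\<lambda>\<omega>. chart_partial c i (?F \<omega>) p)" .
    have "Cr_family (Suc 0) D ?F" by (rule family[OF c I(3)])
    then have "C0_family D (\<lambda>\<omega>. chart_partial c i (?F \<omega>))" using I(2) by simp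
    then have b1: "bounded_on D (\<lambda>\<omega>. chart_partial c i (?F \<omega>) p)"
      unfolding bounded_on_def by (rule C0_family_pointwise_bounded[OF _ p])
    have b2: "bounded_on D (?l x)" if "x \<in> ?A" for x
      using that comp[OF c p multi_indices_update[OF I(3)]] by auto
    have "nabla (Suc j) w c p I = \<Phi> (\<lambda>\<omega>. chart_partial c i (?F \<omega>) p) + (\<Sum>x\<in>?A. ?a x * ?l x w)"
      unfolding expand 1 ..
    also have "(\<Sum>x\<in>?A. ?a x * ?l x w) = (\<Sum>x\<in>?A. ?a x * \<Phi> (?l x))"
      using Suc.IH[OF c p multi_indices_update[OF I(3)]] by (intro sum.cong) auto
    also have "\<dots> = \<Phi> (\<lambda>\<omega>. \<Sum>x\<in>?A. ?a x * ?l x \<omega>)"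
      by (rule functional_lincomb[symmetric]) (use b2 in auto)
    also have "\<Phi> (\<lambda>\<omega>. chart_partial c i (?F \<omega>) p) + \<dots> =
        \<Phi> (\<lambda>\<omega>. chart_partial c i (?F \<omega>) p + (\<Sum>x\<in>?A. ?a x * ?l x \<omega>))"
      by (rule functional_plus[symmetric, OF b1]) (intro bounded_on_sum bounded_on_cmult b2)
    finally show ?case unfolding expand .
  qed
  have "jet_bound r w (C * \<bar>A\<bar>)" if A: "\<forall>\<omega>\<in>D. jet_bound r \<omega> A" for r A
    unfolding jet_bound_def
  proof (intro allI impI ballI)
    fix j c p v assume h: "j \<le> r" "c \<in> atlas M" "p \<in> W c" "v \<in> unit_vectors c p (j + k)"
    have "tensor_value n (j + k) (nabla j w c p) v =
        (\<Sum>I\<in>multi_indices n (j + k). (\<Prod>a<j + k. v a (I ! a)) * \<Phi> (\<lambda>\<omega>. nabla j \<omega> c p I))"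
      unfolding tensor_value_def using nabla_w[OF h(2,3)] by (intro sum.cong) (auto simp: mult.commute)
    also have "\<dots> = \<Phi> (\<lambda>\<omega>. \<Sum>I\<in>multi_indices n (j + k). (\<Prod>a<j + k. v a (I ! a)) * nabla j \<omega> c p I)"
      by (rule functional_lincomb[symmetric]) (use comp[OF h(2,3)] finite_multi_indices in auto)
    also have "\<dots> = \<Phi> (\<lambda>\<omega>. tensor_value n (j + k) (nabla j \<omega> c p) v)"
      unfolding tensor_value_def by (simp add: mult.commute)
    finally have "tensor_value n (j + k) (nabla j w c p) v =
        \<Phi> (\<lambda>\<omega>. tensor_value n (j + k) (nabla j \<omega> c p) v)" .
    moreover have "\<bar>\<Phi> (\<lambda>\<omega>. tensor_value n (j + k) (nabla j \<omega> c p) v)\<bar> \<le> C * \<bar>A\<bar>"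
    proof (rule bound)
      show "\<forall>\<omega>\<in>D. \<bar>tensor_value n (j + k) (nabla j \<omega> c p) v\<bar> \<le> \<bar>A\<bar>"
        using A h unfolding jet_bound_def by (meson abs_ge_self order_trans)
    qed simp
    ultimately show "\<bar>tensor_value n (j + k) (nabla j w c p) v\<bar> \<le> C * \<bar>A\<bar>" by simp
  qed
  then have w_jets: "\<exists>A. jet_bound r w A" for r using jets[of r] by blast
  have w_smooth: "smooth_tensor k w"
    unfolding smooth_tensor_def
  proof (intro ballI)
    fix c I assume c: "c \<in> atlas M" and I: "I \<in> multi_indices n k"
    interpret chart_domain "mtop M" n c "W c" using c by (rule chart_domain_U)
    have "Cr_family r D (\<lambda>\<omega> p. \<omega> c p I)" for r using family[OF c, of I 0 r] I by simp
    then have "smooth (\<lambda>p. \<Phi> (\<lambda>\<omega>. \<omega> c p I))" by (rule functional_smooth[OF scf])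
    then show "smooth (\<lambda>p. w c p I)" by (rule smooth_cong) (simp add: w_eq c I)
  qed
  have w_comp: "components_on M U k w" by (auto simp: components_on_def w_def)
  have w_alt: "alternating k w"
    unfolding alternating_def
  proof (intro allI impI)
    fix c p and I :: "nat list" and i j
    assume h: "length I = k \<and> i < j \<and> j < k"
    define I' where "I' = I[i := I ! j, j := I ! i]"
    have mem: "I' \<in> multi_indices n k \<longleftrightarrow> I \<in> multi_indices n k"
      using swap_entries_multi_indices[of I k i j n] h by (simp add: I'_def)
    have "w c p I' = - w c p I"
    proof (cases "c \<in> atlas M \<and> p \<in> W c \<and> I \<in> multi_indices n k")
      case True
      have alt: "- 1 * \<omega> c p I = \<omega> c p I'" if "\<omega> \<in> D" for \<omega>
      proof -
        have "alternating k \<omega>" using that DB by (auto simp: bounded_forms_iff)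
        then have "\<omega> c p I' = - \<omega> c p I" using h unfolding alternating_def I'_def by blast
        then show ?thesis by simp
      qed
      obtain A where A: "\<And>\<omega>. \<omega> \<in> D \<Longrightarrow> \<bar>\<omega> c p I\<bar> \<le> A"
        using comp0[of c p I] True unfolding bounded_on_def by blast
      have "\<Phi> (\<lambda>\<omega>. - 1 * \<omega> c p I) = \<Phi> (\<lambda>\<omega>. \<omega> c p I')"
        by (rule functional_cong[OF alt]) (use A in auto)
      moreover have "\<Phi> (\<lambda>\<omega>. - 1 * \<omega> c p I) = - 1 * \<Phi> (\<lambda>\<omega>. \<omega> c p I)"
        by (rule functional_scale[OF A])
      ultimately show ?thesis using True mem by (simp add: w_eq)
    qed (use mem in \<open>auto simp: w_def\<close>)
    then show "w c p (I[i := I ! j, j := I ! i]) = - w c p I" by (simp only: I'_def)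
  qed
  have w_cov: "covariant M U k w"
    unfolding covariant_def
  proof (intro ballI)
    fix c d p I
    assume h: "c \<in> atlas M" "d \<in> atlas M" "p \<in> dom_of c \<inter> dom_of d \<inter> U" "I \<in> multi_indices n k"
    let ?t = "\<lambda>J. \<Prod>a<k. transition_deriv c d p (J ! a) (I ! a)"
    have p: "p \<in> W c" "p \<in> W d" using h by auto
    have cov: "\<omega> c p I = (\<Sum>J\<in>multi_indices n k. ?t J * \<omega> d p J)" if "\<omega> \<in> D" for \<omega>
    proof -
      have "covariant M U k \<omega>" using that DB by (auto simp: bounded_forms_iff)
      then have "\<omega> c p I = (\<Sum>J\<in>multi_indices n k. \<omega> d p J * ?t J)"
        using h unfolding covariant_def by blast
      then show ?thesis by (simp add: mult.commute)
    qed
    obtain A where A: "\<And>\<omega>. \<omega> \<in> D \<Longrightarrow> \<bar>\<omega> c p I\<bar> \<le> A"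
      using comp0[OF h(1) p(1) h(4)] unfolding bounded_on_def by blast
    have "w c p I = \<Phi> (\<lambda>\<omega>. \<Sum>J\<in>multi_indices n k. ?t J * \<omega> d p J)"
      unfolding w_eq[OF h(1) p(1) h(4)] by (rule functional_cong[OF cov A])
    also have "\<dots> = (\<Sum>J\<in>multi_indices n k. ?t J * \<Phi> (\<lambda>\<omega>. \<omega> d p J))"
      by (rule functional_lincomb) (use comp0[OF h(2) p(2)] finite_multi_indices in auto)
    also have "\<dots> = (\<Sum>J\<in>multi_indices n k. w d p J * ?t J)"
      using w_eq[OF h(2) p(2)] by (intro sum.cong) (auto simp: mult.commute)
    finally show "w c p I = (\<Sum>J\<in>multi_indices n k. w d p J * ?t J)" .
  qed
  have wB: "w \<in> B" using w_comp w_alt w_cov w_smooth w_jets by (simp add: bounded_forms_iff)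
  have "f A = chain_integral M k A w" if A: "A \<in> P" for A
  proof -
    let ?S = "chain_support A"
    have b: "bounded_on D (\<lambda>\<omega>. \<omega> (pick p) p I)" "w (pick p) p I = \<Phi> (\<lambda>\<omega>. \<omega> (pick p) p I)"
      if "p \<in> ?S" "I \<in> increasing" for p I
    proof -
      have p: "p \<in> U" using that(1) chain_support_subset[OF A] by blast
      have I: "I \<in> multi_indices n k" using that(2) by (simp add: increasing_def)
      show "bounded_on D (\<lambda>\<omega>. \<omega> (pick p) p I)" "w (pick p) p I = \<Phi> (\<lambda>\<omega>. \<omega> (pick p) p I)"
        using comp0[OF pick[OF p] I] w_eq[OF pick[OF p] I] by auto
    qed
    have "chain_integral M k A w = (\<Sum>p\<in>?S. 1 * (\<Sum>I\<in>increasing. A (pick p) p I * \<Phi> (\<lambda>\<omega>. \<omega> (pick p) p I)))"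
      unfolding chain_integral_def eval_at_eq using b(2) by simp
    also have "\<dots> = (\<Sum>p\<in>?S. 1 * \<Phi> (\<lambda>\<omega>. \<Sum>I\<in>increasing. A (pick p) p I * \<omega> (pick p) p I))"
      using functional_lincomb[OF finite_increasing b(1)] by (intro sum.cong) auto
    also have "\<dots> = \<Phi> (\<lambda>\<omega>. \<Sum>p\<in>?S. 1 * (\<Sum>I\<in>increasing. A (pick p) p I * \<omega> (pick p) p I))"
      by (rule functional_lincomb[symmetric, OF finite_chain_support[OF A]])
        (intro bounded_on_sum bounded_on_cmult b(1))
    also have "\<dots> = \<Phi> (chain_integral M k A)"
      unfolding chain_integral_def eval_at_eq by simp
    finally show ?thesis using \<Phi>(3)[OF A] by simp
  qed
  then show ?thesis using wB by blast
qed

lemma chain_integral_Cr_norm: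
  assumes A: "A \<in> P"
  shows "\<exists>C. \<forall>\<omega>\<in>B. \<bar>chain_integral M k A \<omega>\<bar> \<le> C * Cr_norm M U k 0 \<omega>"
proof -
  let ?g = "\<lambda>p I. \<Prod>a<k. 1 + metric M (pick p) p (I ! a) (I ! a)"
  have "\<bar>chain_integral M k A \<omega>\<bar> \<le>
      (\<Sum>p\<in>chain_support A. \<Sum>I\<in>increasing. \<bar>A (pick p) p I\<bar> * ?g p I) * Cr_norm M U k 0 \<omega>" if \<omega>: "\<omega> \<in> B" for \<omega>
    unfolding chain_integral_def eval_at_eq sum_distrib_right
  proof (intro order_trans[OF sum_abs] sum_mono order_trans[OF sum_abs])
    fix p I assume p: "p \<in> chain_support A" and I: "I \<in> increasing"
    have pU: "p \<in> U" using p chain_support_subset[OF A] by blast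
    have "jet_bound 0 \<omega> (Cr_norm M U k 0 \<omega>)"
      using \<omega> jet_bound_Cr_norm(1)[of 0 \<omega>] unfolding bounded_forms_iff by blast
    then have "\<bar>\<omega> (pick p) p I\<bar> \<le> Cr_norm M U k 0 \<omega> * ?g p I"
      using component_le_jet_bound[of 0 \<omega> _ 0 "pick p" p I] pick[OF pU] I by (simp add: increasing_def)
    then have "\<bar>A (pick p) p I\<bar> * \<bar>\<omega> (pick p) p I\<bar> \<le> \<bar>A (pick p) p I\<bar> * (Cr_norm M U k 0 \<omega> * ?g p I)"
      by (intro mult_left_mono) auto
    then show "\<bar>A (pick p) p I * \<omega> (pick p) p I\<bar> \<le> \<bar>A (pick p) p I\<bar> * ?g p I * Cr_norm M U k 0 \<omega>"
      by (simp add: abs_mult mult_ac)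
  qed
  then show ?thesis by blast
qed

theorem mackey_seminorms:
  "is_mackey_topology P B (chain_integral M k) (seminorm_topology P (sup_on (chain_integral M k) ` bounded_sets))"
proof (rule is_mackey_topology_sup_on(2)[OF subspace_pointed_chains subspace_bounded_forms
      chain_integral_linear_form chain_integral_linear_chain])
  show "D \<subseteq> B" if "D \<in> bounded_sets" for D using that by (simp add: bounded_in_bounded_forms_iff)
  show "\<exists>C. \<forall>w\<in>D. \<bar>chain_integral M k x w\<bar> \<le> C" if "D \<in> bounded_sets" "x \<in> P" for D x
    using bounded_on_chain_integral[OF that] by (simp add: bounded_on_def)
  show "{w} \<in> bounded_sets" if "w \<in> B" for w
    using that by (simp add: bounded_in_bounded_forms_iff bounded_forms_iff)
  show "D \<union> D' \<in> bounded_sets" if DD: "D \<in> bounded_sets" "D' \<in> bounded_sets" for D D'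
  proof -
    have mono: "jet_bound r \<omega> (max C C')" if "jet_bound r \<omega> C \<or> jet_bound r \<omega> C'" for r \<omega> C C'
      using that unfolding jet_bound_iff by (meson le_max_iff_disj)
    have "\<exists>C. \<forall>\<omega>\<in>D \<union> D'. jet_bound r \<omega> C" for r
    proof -
      obtain C C' where "\<forall>\<omega>\<in>D. jet_bound r \<omega> C" "\<forall>\<omega>\<in>D'. jet_bound r \<omega> C'"
        using DD unfolding bounded_in_bounded_forms_iff mem_Collect_eq by blast
      then have "\<forall>\<omega>\<in>D \<union> D'. jet_bound r \<omega> (max C C')" using mono by blast
      then show ?thesis by blast
    qed
    then show ?thesis using DD by (simp add: bounded_in_bounded_forms_iff)
  qed
  show "\<exists>w\<in>B. \<forall>x\<in>P. f x = chain_integral M k x w"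
    if "D \<in> bounded_sets" "linear_functional_on P f" "C \<ge> 0"
      "\<And>x. x \<in> P \<Longrightarrow> \<bar>f x\<bar> \<le> C * sup_on (chain_integral M k) D x" for D f C
    using that by (rule functional_representation)
  show "K \<in> bounded_sets"
    if K: "K \<subseteq> B" "\<And>w. w \<in> K \<Longrightarrow> - w \<in> K" "\<And>x. x \<in> P \<Longrightarrow> \<exists>C. \<forall>w\<in>K. \<bar>chain_integral M k x w\<bar> \<le> C"
      "series_complete B K" for K
  proof -
    interpret chain_complete M U k K
      using K by unfold_locales (auto simp: bounded_on_def)
    show ?thesis by (rule bounded_in_K)
  qed
qed

theorem pullback_strong_dual_topology:
  "pullback_topology P (chain_to_dual M U k) (strong_dual_topology (bounded_forms_topology M U k)) =
    seminorm_topology P (sup_on (chain_integral M k) ` bounded_sets)"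
proof -
  interpret F: seminorm_family B "range (Cr_norm M U k)" by (rule seminorm_family_bounded_forms)
  let ?T = "bounded_forms_topology M U k"
  have T: "?T = F.T" by (simp add: bounded_forms_topology_def)
  let ?E = "continuous_dual ?T" and ?b = "\<lambda>(f :: 'm tensor_field \<Rightarrow> real) x. f x"
  have E_iff: "f \<in> ?E \<longleftrightarrow> linear_functional_on B f \<and> continuous_map F.T euclideanreal f \<and> (\<forall>x. x \<notin> B \<longrightarrow> f x = 0)" for f
    by (simp add: continuous_dual_def T F.topspace_eq)
  have E: "subspace ?E"
  proof (rule subspaceI)
    show "0 \<in> ?E" by (simp add: E_iff linear_functional_on_def zero_fun_def)
    show "f + g \<in> ?E" if "f \<in> ?E" "g \<in> ?E" for f g
      using that continuous_map_add[of F.T f g]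
      by (auto simp: E_iff linear_functional_on_def plus_fun_def algebra_simps)
    show "a *\<^sub>R f \<in> ?E" if "f \<in> ?E" for a f
      using that continuous_map_real_mult_left[of F.T f a]
      by (auto simp: E_iff linear_functional_on_def scaleR_fun_def algebra_simps)
  qed
  have bdd: "\<exists>C. \<forall>w\<in>D. \<bar>?b f w\<bar> \<le> C" if D: "D \<in> bounded_sets" and f: "f \<in> ?E" for D f
  proof -
    have f': "linear_functional_on B f" "continuous_map F.T euclideanreal f" using f by (auto simp: E_iff)
    obtain Fs C where Fs: "Fs \<subseteq> range (Cr_norm M U k)" "finite Fs" "0 \<le> C"
      "\<And>x. x \<in> B \<Longrightarrow> \<bar>f x\<bar> \<le> C * (\<Sum>q\<in>Fs. q x)"
      using F.continuous_functional_bound[OF f'] by blast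
    have DB: "D \<subseteq> B" and Dq: "\<And>q. q \<in> Fs \<Longrightarrow> \<exists>C. \<forall>x\<in>D. q x \<le> C"
      using D Fs(1) unfolding mem_Collect_eq T F.bounded_in_iff by blast+
    obtain c where c: "\<And>q x. q \<in> Fs \<Longrightarrow> x \<in> D \<Longrightarrow> q x \<le> c q" using Dq by metis
    have "\<bar>f x\<bar> \<le> C * (\<Sum>q\<in>Fs. c q)" if "x \<in> D" for x
    proof -
      have "(\<Sum>q\<in>Fs. q x) \<le> (\<Sum>q\<in>Fs. c q)" using c that by (intro sum_mono) auto
      then have "C * (\<Sum>q\<in>Fs. q x) \<le> C * (\<Sum>q\<in>Fs. c q)" using Fs(3) by (rule mult_left_mono)
      then show ?thesis using Fs(4)[of x] that DB by force
    qed
    then show ?thesis by blast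
  qed
  have "{} \<in> bounded_sets" by (simp add: bounded_in_bounded_forms_iff)
  then have fam: "seminorm_family ?E (sup_on ?b ` bounded_sets)"
    using E seminorm_on_sup_on[of ?E _ ?b, OF bdd E]
    by unfold_locales (auto simp: linear_functional_on_def plus_fun_def scaleR_fun_def)
  have strong: "strong_dual_topology ?T = seminorm_topology ?E (sup_on ?b ` bounded_sets)"
    unfolding strong_dual_topology_def by (rule arg_cong[where f = "seminorm_topology ?E"])
      (auto simp: sup_on_def[abs_def])
  let ?J = "chain_to_dual M U k"
  note linA = linear_functional_onD[OF chain_integral_linear_chain]
  have J_E: "?J A \<in> ?E" if A: "A \<in> P" for A
  proof -
    have lin: "linear_functional_on B (?J A)"
      using linear_functional_onD[OF chain_integral_linear_form[of A]] subspace_bounded_forms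
      by (auto simp: chain_to_dual_def functional_on_def linear_functional_on_def subspace_add subspace_scale)
    obtain C where C: "\<And>\<omega>. \<omega> \<in> B \<Longrightarrow> \<bar>chain_integral M k A \<omega>\<bar> \<le> C * Cr_norm M U k 0 \<omega>"
      using chain_integral_Cr_norm[OF A] by blast
    have "continuous_map F.T euclideanreal (?J A)"
      by (rule F.continuous_functionalI[OF lin rangeI[of _ 0], of C])
        (simp add: C chain_to_dual_def functional_on_def)
    then show ?thesis using lin by (simp add: E_iff chain_to_dual_def functional_on_def)
  qed
  have "pullback_topology P ?J (strong_dual_topology ?T) =
      seminorm_topology P ((\<lambda>q. q \<circ> ?J) ` sup_on ?b ` bounded_sets)"
    unfolding strong
  proof (rule pullback_seminorm_topology(2)[OF fam subspace_pointed_chains J_E])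
    show "?J (A + A') = ?J A + ?J A'" if "A \<in> P" "A' \<in> P" for A A'
      using linA(1)[OF that] by (auto simp: chain_to_dual_def functional_on_def plus_fun_def)
    show "?J (a *\<^sub>R A) = a *\<^sub>R ?J A" if "A \<in> P" for a A
      using linA(2)[OF that] by (auto simp: chain_to_dual_def functional_on_def scaleR_fun_def)
  qed
  also have "(\<lambda>q. q \<circ> ?J) ` sup_on ?b ` bounded_sets = sup_on (chain_integral M k) ` bounded_sets"
    unfolding image_image
  proof (rule image_cong[OF refl])
    fix D assume "D \<in> bounded_sets"
    then have D: "D \<subseteq> B" by (simp add: bounded_in_bounded_forms_iff)
    have "(\<lambda>w. \<bar>?J A w\<bar>) ` D = (\<lambda>w. \<bar>chain_integral M k A w\<bar>) ` D" for A
      using D by (intro image_cong) (auto simp: chain_to_dual_def functional_on_def)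
    then show "sup_on ?b D \<circ> ?J = sup_on (chain_integral M k) D"
      by (simp add: fun_eq_iff sup_on_def)
  qed
  finally show ?thesis .
qed

end

theorem corollary3p0p6:
  fixes M :: "'m riemannian" and U :: "'m set" and k :: nat
  assumes "riemannian_manifold M"
    and "openin (mtop M) U"
    and "k \<le> mdim M"
  shows "is_mackey_topology (pointed_chains M U k) (bounded_forms M U k) (chain_integral M k)
    (pullback_topology (pointed_chains M U k) (chain_to_dual M U k)
      (strong_dual_topology (bounded_forms_topology M U k)))"
proof -
  interpret riemannian_open M U k using assms by unfold_locales
  show ?thesis unfolding pullback_strong_dual_topology by (rule mackey_seminorms)
qed

end
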